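(* The following inclusions hold: $$C^\infty_{\rm slow}(\mathbb{R}^d)\subseteq WFW^{\perp}(\mathbb{R}^d),$$ $$C^\infty_{\rm slow}(\mathbb{R}^d)\subseteq V_{\rm con}(\mathbb{R}^d)\subseteq WFW^{\neq}(\mathbb{R}^d).$$
   Context: Notation: $\langle x\rangle=(1+|x|^2)^{1/2}$; $T_yf(x)=f(x-y)$, $M_\xi f(x)=e^{2\pi i x\cdot\xi}f(x)$; $(\cdot,\cdot)$ is the pairing of distributions with test functions that is conjugate linear in the second argument. The Fourier transform is $\widehat f(\xi)=\int f(x)e^{-2\pi i x\cdot\xi}\,dx$. $WF(u)$ is the $C^\infty$ wave front set of a distribution $u$. $C^\infty_{\rm slow}(\mathbb{R}^d)$ is the space of smooth functions $f:\mathbb{R}^d\to\mathbb{C}$ for which there is $N>0$ such that for every multi-index $\alpha\in\mathbb{N}^d$ there is $C_\alpha>0$ with $|\partial^\alpha f(x)|\le C_\alpha\langle x\rangle^N$ for all $x\in\mathbb{R}^d$ ($N$ independent of $\alpha$). For $f\in\mathscr{S}'(\mathbb{R}^d)$ the Wigner distribution is $W_f=\mathscr{F}_2\big((f\otimes\overline f)\circ\kappa\big)\in\mathscr{S}'(\mathbb{R}^{2d})$, where $\kappa(x,y)=(x+y/2,x-y/2)$ and $\mathscr{F}_2$ is the partial Fourier transform in the second $\mathbb{R}^d$ variable. Points of $\mathbb{R}^{4d}$ containing $WF(W_f)$ are written $(t,\xi;\eta,x)$, with $(t,\xi)$ the space variables and $(\eta,x)$ the dual variables. $WFW^\perp(\mathbb{R}^d)=\{f\in\mathscr{S}'(\mathbb{R}^d):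 WF(W_f)\subseteq\mathbb{R}^{2d}\times(\{0\}\times(\mathbb{R}^d\setminus\{0\}))\}$. $WFW^{\neq}(\mathbb{R}^d)=\{f\in\mathscr{S}'(\mathbb{R}^d): WF(W_f)\cap\big(\mathbb{R}^{2d}\times((\mathbb{R}^d\setminus\{0\})\times\{0\})\big)=\emptyset\}$. The short-time Fourier transform of $f\in\mathscr{S}'(\mathbb{R}^d)$ with window $\varphi\in\mathscr{S}(\mathbb{R}^d)$ is $V_\varphi f(t,\xi)=(f,M_\xi T_t\varphi)$. $V_{\rm con}(\mathbb{R}^d)$ is the space of $f\in\mathscr{S}'(\mathbb{R}^d)$ for which there is $B>0$ such that $\sup_{|\eta|>B|x|}\langle(x,\eta)\rangle^n|V_\varphi f(x,\eta)|<\infty$ for all $n>0$, where $\varphi\in\mathscr{S}(\mathbb{R}^d)\setminus\{0\}$ is arbitrary (the space does not depend on the choice of $\varphi$). *)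

theory Defs
  imports "HOL-Analysis.Analysis"
begin

definition jbracket :: "'a::euclidean_space \<Rightarrow> real"
  where "jbracket x = sqrt (1 + (norm x)\<^sup>2)"

definition partial1 :: "'a::euclidean_space \<Rightarrow> ('a \<Rightarrow> complex) \<Rightarrow> 'a \<Rightarrow> complex"
  where "partial1 b f x = vector_derivative (\<lambda>t::real. f (x + t *\<^sub>R b)) (at 0)"

text \<open>A partial derivative is indexed by the list of basis vectors along which one
  differentiates. For smooth functions the order in the list is irrelevant, so lists of length
  \<open>k\<close> over \<open>Basis\<close> play the role of the multi-indices of order \<open>k\<close>.\<close>

definition partials :: "'a::euclidean_space list \<Rightarrow> ('a \<Rightarrow> complex) \<Rightarrow> 'a \<Rightarrow> complex"
  where "partials bs f = foldr partial1 bs f"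

definition smooth :: "('a::euclidean_space \<Rightarrow> complex) \<Rightarrow> bool"
  where "smooth f \<longleftrightarrow> (\<forall>bs\<in>lists Basis. \<forall>x. partials bs f differentiable (at x))"

definition test_functions :: "('a::euclidean_space \<Rightarrow> complex) set"
  where "test_functions = {\<phi>. smooth \<phi> \<and> compact (closure {x. \<phi> x \<noteq> 0})}"

definition schwartz :: "('a::euclidean_space \<Rightarrow> complex) set"
  where "schwartz = {\<phi>. smooth \<phi> \<and>
    (\<forall>bs\<in>lists Basis. \<forall>N::nat. bounded (range (\<lambda>x. jbracket x ^ N * norm (partials bs \<phi> x))))}"

definition schwartz_norm :: "nat \<Rightarrow> ('a::euclidean_space \<Rightarrow> complex) \<Rightarrow> real"
  where "schwartz_norm N \<phi> =
    (SUP (bs, x) \<in> {bs \<in> lists Basis. length bs \<le> N} \<times> UNIV. jbracket x ^ N * norm (partials bs \<phi> x))"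

text \<open>A tempered distribution \<open>u\<close> is a complex linear functional, so \<open>u \<phi>\<close> is the bilinear
  pairing \<open>\<langle>u, \<phi>\<rangle>\<close>. Functionals are \<open>undefined\<close> outside \<open>schwartz\<close>, so that equality in
  \<open>tempered\<close> is equality of distributions.\<close>

type_synonym 'a distribution = "('a \<Rightarrow> complex) \<Rightarrow> complex"

definition tempered :: "'a::euclidean_space distribution set"
  where "tempered = {u \<in> extensional schwartz.
    (\<forall>\<phi>\<in>schwartz. \<forall>\<psi>\<in>schwartz. u (\<lambda>x. \<phi> x + \<psi> x) = u \<phi> + u \<psi>) \<and>
    (\<forall>c. \<forall>\<phi>\<in>schwartz. u (\<lambda>x. c * \<phi> x) = c * u \<phi>) \<and>
    (\<exists>C N. \<forall>\<phi>\<in>schwartz. norm (u \<phi>) \<le> C * schwartz_norm N \<phi>)}"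

text \<open>The pairing \<open>(u, \<phi>)\<close> that is conjugate linear in the second argument.\<close>

definition sesq :: "'a::euclidean_space distribution \<Rightarrow> ('a \<Rightarrow> complex) \<Rightarrow> complex"
  where "sesq u \<phi> = u (\<lambda>x. cnj (\<phi> x))"

definition distribution_of :: "('a::euclidean_space \<Rightarrow> complex) \<Rightarrow> 'a distribution"
  where "distribution_of f = (\<lambda>\<phi>\<in>schwartz. \<integral>x. f x * \<phi> x \<partial>lborel)"

definition slow_function :: "('a::euclidean_space \<Rightarrow> complex) \<Rightarrow> bool"
  where "slow_function f \<longleftrightarrow> smooth f \<and>
    (\<exists>N>0::real. \<forall>bs\<in>lists Basis. \<exists>C>0. \<forall>x. norm (partials bs f x) \<le> C * jbracket x powr N)"

definition C_slow :: "'a::euclidean_space distribution set"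
  where "C_slow = distribution_of ` {f. slow_function f}"

definition translate :: "'a::euclidean_space \<Rightarrow> ('a \<Rightarrow> complex) \<Rightarrow> 'a \<Rightarrow> complex"
  where "translate y f x = f (x - y)"

definition modulate :: "'a::euclidean_space \<Rightarrow> ('a \<Rightarrow> complex) \<Rightarrow> 'a \<Rightarrow> complex"
  where "modulate \<xi> f x = cis (2 * pi * (x \<bullet> \<xi>)) * f x"

definition stft :: "('a::euclidean_space \<Rightarrow> complex) \<Rightarrow> 'a distribution \<Rightarrow> 'a \<Rightarrow> 'a \<Rightarrow> complex"
  where "stft \<phi> f t \<xi> = sesq f (modulate \<xi> (translate t \<phi>))"

definition V_con :: "('a::euclidean_space \<Rightarrow> complex) \<Rightarrow> 'a distribution set"
  where "V_con \<phi> = {f \<in> tempered. \<exists>B>0. \<forall>n>0::nat.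
    bdd_above ((\<lambda>(x, \<eta>). jbracket (x, \<eta>) ^ n * norm (stft \<phi> f x \<eta>)) `
      {(x, \<eta>). norm \<eta> > B * norm x})}"

text \<open>The Fourier transform of the compactly supported distribution \<open>\<phi> u\<close>, that is, \<open>\<phi> u\<close>
  evaluated at the exponential \<open>e\<^bsup>-2\<pi>i x \<cdot> \<zeta>\<^esup>\<close>.\<close>

definition localized_fourier ::
    "('a::euclidean_space \<Rightarrow> complex) \<Rightarrow> 'a distribution \<Rightarrow> 'a \<Rightarrow> complex"
  where "localized_fourier \<phi> u \<zeta> = u (\<lambda>x. \<phi> x * cis (- (2 * pi * (x \<bullet> \<zeta>))))"

text \<open>The library's \<open>conic\<close> allows the factor \<open>0\<close>, which would make an open cone everything.\<close>

definition open_cone :: "'a::euclidean_space set \<Rightarrow> bool"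
  where "open_cone \<Gamma> \<longleftrightarrow> open \<Gamma> \<and> (\<forall>\<zeta>\<in>\<Gamma>. \<forall>c>0. c *\<^sub>R \<zeta> \<in> \<Gamma>)"

definition WF :: "'a::euclidean_space distribution \<Rightarrow> ('a \<times> 'a) set"
  where "WF u = {(z, \<zeta>). \<zeta> \<noteq> 0 \<and>
    \<not> (\<exists>\<phi>\<in>test_functions. \<exists>\<Gamma>. \<phi> z \<noteq> 0 \<and> open_cone \<Gamma> \<and> \<zeta> \<in> \<Gamma> \<and>
        (\<forall>N::nat. bdd_above ((\<lambda>\<theta>. jbracket \<theta> ^ N * norm (localized_fourier \<phi> u \<theta>)) ` \<Gamma>)))}"

definition cnj_distribution :: "'a::euclidean_space distribution \<Rightarrow> 'a distribution"
  where "cnj_distribution u = (\<lambda>\<phi>\<in>schwartz. cnj (u (\<lambda>x. cnj (\<phi> x))))"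

definition tensor ::
    "'a::euclidean_space distribution \<Rightarrow> 'b::euclidean_space distribution \<Rightarrow> ('a \<times> 'b) distribution"
  where "tensor u v = (\<lambda>\<Phi>\<in>schwartz. u (\<lambda>x. v (\<lambda>y. \<Phi> (x, y))))"

definition kappa :: "'a::euclidean_space \<times> 'a \<Rightarrow> 'a \<times> 'a"
  where "kappa = (\<lambda>(x, y). (x + y /\<^sub>R 2, x - y /\<^sub>R 2))"

lemma bij_kappa: "bij (kappa :: 'a::euclidean_space \<times> 'a \<Rightarrow> _)"
proof (rule o_bij)
  let ?g = "\<lambda>(a, b). ((a + b) /\<^sub>R 2, a - b) :: 'a \<times> 'a"
  show "?g \<circ> kappa = id"
    by (auto simp: kappa_def fun_eq_iff simp flip: scaleR_2)
  have half: "(1 / 2) *\<^sub>R z + (1 / 2) *\<^sub>R z = z" for z :: 'a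
    by (simp flip: scaleR_add_left)
  show "kappa \<circ> ?g = id"
    using half by (auto simp: kappa_def fun_eq_iff scaleR_add_right scaleR_diff_right algebra_simps)
qed

lemma nn_integral_kappa:
  fixes F :: "'a::euclidean_space \<times> 'a \<Rightarrow> ennreal"
  assumes [measurable]: "F \<in> borel_measurable borel"
  shows "(\<integral>\<^sup>+p. F (kappa p) \<partial>lborel) = (\<integral>\<^sup>+p. F p \<partial>lborel)"
proof -
  have shift: "(\<integral>\<^sup>+x. g (c + x) \<partial>lborel) = (\<integral>\<^sup>+x. g x \<partial>lborel)"
    if [measurable]: "g \<in> borel_measurable borel" for g :: "'a \<Rightarrow> ennreal" and c
  proof -
    have "(\<integral>\<^sup>+x. g x \<partial>lborel) = (\<integral>\<^sup>+x. g x \<partial>distr lborel borel ((+) c))"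
      by (simp add: lborel_distr_plus)
    then show ?thesis by (simp add: nn_integral_distr)
  qed
  have [measurable]: "F \<in> borel_measurable (borel \<Otimes>\<^sub>M borel)"
    by (simp add: borel_prod)
  have "(\<integral>\<^sup>+p. F (kappa p) \<partial>lborel)
      = (\<integral>\<^sup>+y. \<integral>\<^sup>+x. F (x + y /\<^sub>R 2, x - y /\<^sub>R 2) \<partial>lborel \<partial>lborel)"
    by (subst lborel_prod[symmetric], subst lborel_pair.nn_integral_snd[symmetric])
       (auto simp: kappa_def)
  also have "\<dots> = (\<integral>\<^sup>+y. \<integral>\<^sup>+x. F (x + y, x) \<partial>lborel \<partial>lborel)"
  proof (rule nn_integral_cong)
    fix y :: 'a
    have half: "y /\<^sub>R 2 + y /\<^sub>R 2 = y" by (simp flip: scaleR_add_left)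
    have "y /\<^sub>R 2 + x + y /\<^sub>R 2 = x + y" for x
      by (metis half add.assoc add.commute)
    then have shifted: "(y /\<^sub>R 2 + x + y /\<^sub>R 2, y /\<^sub>R 2 + x - y /\<^sub>R 2) = (x + y, x)" for x
      by (simp only: add_diff_cancel_left')
    show "(\<integral>\<^sup>+x. F (x + y /\<^sub>R 2, x - y /\<^sub>R 2) \<partial>lborel) = (\<integral>\<^sup>+x. F (x + y, x) \<partial>lborel)"
      by (subst shift[of "\<lambda>x. F (x + y /\<^sub>R 2, x - y /\<^sub>R 2)" "y /\<^sub>R 2", symmetric])
         (measurable, simp only: shifted)
  qed
  also have "\<dots> = (\<integral>\<^sup>+x. \<integral>\<^sup>+y. F (x + y, x) \<partial>lborel \<partial>lborel)"
    by (rule lborel_pair.Fubini') auto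
  also have "\<dots> = (\<integral>\<^sup>+x. \<integral>\<^sup>+y. F (y, x) \<partial>lborel \<partial>lborel)"
    by (intro nn_integral_cong shift) auto
  also have "\<dots> = (\<integral>\<^sup>+p. F p \<partial>lborel)"
    by (subst lborel_prod[symmetric], subst lborel_pair.nn_integral_snd[symmetric]) auto
  finally show ?thesis .
qed

text \<open>Pullback by \<open>kappa\<close>: no Jacobian factor appears since \<open>kappa\<close> preserves Lebesgue
  measure (\<open>nn_integral_kappa\<close>).\<close>

definition pullback_kappa ::
    "('a::euclidean_space \<times> 'a) distribution \<Rightarrow> ('a \<times> 'a) distribution"
  where "pullback_kappa u = (\<lambda>\<Phi>\<in>schwartz. u (\<Phi> \<circ> inv kappa))"

definition fourier2 ::
    "('a::euclidean_space \<times> 'b::euclidean_space \<Rightarrow> complex) \<Rightarrow> 'a \<times> 'b \<Rightarrow> complex"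
  where "fourier2 \<Phi> = (\<lambda>(x, \<xi>). \<integral>y. \<Phi> (x, y) * cis (- (2 * pi * (y \<bullet> \<xi>))) \<partial>lborel)"

definition fourier2_distribution ::
    "('a::euclidean_space \<times> 'b::euclidean_space) distribution \<Rightarrow> ('a \<times> 'b) distribution"
  where "fourier2_distribution u = (\<lambda>\<Phi>\<in>schwartz. u (fourier2 \<Phi>))"

definition wigner :: "'a::euclidean_space distribution \<Rightarrow> ('a \<times> 'a) distribution"
  where "wigner f = fourier2_distribution (pullback_kappa (tensor f (cnj_distribution f)))"

text \<open>Points of \<open>WF (wigner f)\<close> have the form \<open>((t, \<xi>), (\<eta>, x))\<close>, with \<open>\<eta>\<close> dual to \<open>t\<close> and
  \<open>x\<close> dual to \<open>\<xi>\<close>.\<close>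

definition WFW_perp :: "'a::euclidean_space distribution set"
  where "WFW_perp = {f \<in> tempered. WF (wigner f) \<subseteq> UNIV \<times> ({0} \<times> (UNIV - {0}))}"

definition WFW_neq :: "'a::euclidean_space distribution set"
  where "WFW_neq = {f \<in> tempered. WF (wigner f) \<inter> (UNIV \<times> ((UNIV - {0}) \<times> {0})) = {}}"

end

theory Submission
  imports Defs
begin

text \<open>For \<open>f\<close> of slow growth, the localized Fourier transform of the Wigner distribution at
  \<open>(\<eta>, x)\<close> and the short-time Fourier transform at \<open>(x, \<eta>)\<close> are both Fourier transforms in
  \<open>\<eta>\<close> of a translate by \<open>x\<close> of a slow function times a fixed Schwartz function. Integration by
  parts gains any power of \<open>\<eta>\<close> at the price of a power of \<open>x\<close> that does not depend on the
  number of integrations, which yields rapid decay on every cone \<open>|x| < R |\<eta>|\<close>.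

  For \<open>f\<close> in \<open>V_con\<close> the localized Fourier transform at \<open>(\<eta>, x)\<close> is \<open>f \<otimes> cnj f\<close> applied to a
  fixed Schwartz function \<open>\<Psi>\<close> on the doubled space, translated by \<open>(-x/2, x/2)\<close> and modulated by
  \<open>-(\<eta>/2, \<eta>/2)\<close>. Expanding \<open>\<Psi>\<close> by the reproducing formula for the window
  \<open>cnj \<phi> \<otimes> \<phi>\<close> turns this into an integral over \<open>((p1, p2), (a1, a2))\<close> of
  \<open>V(p1 - x/2, \<eta>/2 - a1) * cnj (V(p2 + x/2, a2 - \<eta>/2))\<close> against a Schwartz
  function, \<open>V\<close> being the short-time Fourier transform of \<open>f\<close>. When \<open>|x|\<close> is small compared to
  \<open>|\<eta>|\<close>, the first factor decays rapidly in \<open>\<eta>\<close> unless \<open>(p1, a1)\<close> is comparable to \<open>\<eta>\<close>, in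
  which case the Schwartz function does.\<close>

section \<open>Calculus of iterated partial derivatives\<close>

text \<open>A tempered distribution is here an abstract functional bounded by one Schwartz seminorm,
  not a derivative of a function. Moving it past an integral, as the reproducing formula requires,
  is therefore a theorem of its own (\<open>tempered_integral\<close>); its counterpart for
  derivatives is \<open>pairing_has_derivative\<close>. Lebesgue integration is itself treated as
  the distribution of the constant 1, so that differentiation under the integral sign and the
  exchange of integrals of Schwartz functions become instances of these facts.

  The two inclusions into wave front classes differ by the slope of the cone. A slow function gives
  decay on \<open>|x| < R |eta|\<close> for every \<open>R\<close>, which excludes all directions
  with nonzero \<open>eta\<close>. For \<open>V_con\<close> the slope is the fixed number
  \<open>1 / (8 (1 + B))\<close>, which guarantees a cone around each \<open>(eta, 0)\<close>.

  Of the two short-time Fourier transforms in the product only the first is made to decay. The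
  second may grow like \<open><eta>^m\<close>, with \<open>m\<close> determined before the decay
  order is chosen, so the first factor is asked for \<open>m\<close> additional powers.\<close>

lemma partials_Nil [simp]: "partials [] f = f"
  by (simp add: partials_def)

lemma partials_Cons: "partials (b # bs) f = partial1 b (partials bs f)"
  by (simp add: partials_def)

lemma partials_append: "partials (bs @ cs) f = partials bs (partials cs f)"
  by (simp add: partials_def)

text \<open>\<open>partial1\<close> is defined through \<open>vector_derivative\<close>, which picks
  some value even where no derivative exists. A Frechet derivative makes the value the expected
  one.\<close>

lemma partial1_eq:
  assumes "(f has_derivative f') (at x)"
  shows "partial1 b f x = f' b"
proof -
  have "((\<lambda>t. f (x + t *\<^sub>R b)) has_derivative (\<lambda>t. f' (t *\<^sub>R b))) (at 0)"
    by (rule has_derivative_compose[where g=f and f="\<lambda>t. x + t *\<^sub>R b"])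
       (auto intro!: derivative_eq_intros assms)
  then have "((\<lambda>t. f (x + t *\<^sub>R b)) has_vector_derivative f' b) (at 0)"
    by (simp add: has_vector_derivative_def linear_cmul[OF has_derivative_linear[OF assms]])
  then show ?thesis
    by (simp add: partial1_def vector_derivative_at)
qed

lemma differentiable_has_derivative_partial1:
  fixes f :: "'a::euclidean_space \<Rightarrow> complex"
  assumes "f differentiable (at x)"
  shows "(f has_derivative (\<lambda>h. \<Sum>b\<in>Basis. (h \<bullet> b) *\<^sub>R partial1 b f x)) (at x)"
proof -
  obtain f' where f': "(f has_derivative f') (at x)"
    using assms by (auto simp: differentiable_def)
  interpret linear f' by (rule has_derivative_linear[OF f'])
  have "f' = (\<lambda>h. \<Sum>b\<in>Basis. (h \<bullet> b) *\<^sub>R partial1 b f x)"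
  proof
    fix h
    have "f' h = f' (\<Sum>b\<in>Basis. (h \<bullet> b) *\<^sub>R b)"
      by (simp add: euclidean_representation)
    then show "f' h = (\<Sum>b\<in>Basis. (h \<bullet> b) *\<^sub>R partial1 b f x)"
      by (simp add: sum scale partial1_eq[OF f'])
  qed
  then show ?thesis using f' by simp
qed

lemma smooth_differentiable: "smooth f \<Longrightarrow> f differentiable (at x)"
  by (auto simp: smooth_def dest!: bspec[where x="[]"])

lemmas smooth_has_derivative =
  differentiable_has_derivative_partial1[OF smooth_differentiable]

lemma smooth_continuous_on: "smooth f \<Longrightarrow> continuous_on A f"
  by (meson continuous_at_imp_continuous_on differentiable_imp_continuous_within smooth_differentiable)

lemma smooth_borel_measurable: "smooth f \<Longrightarrow> f \<in> borel_measurable borel"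
  by (intro borel_measurable_continuous_onI smooth_continuous_on)

section \<open>Derivatives along lines and the symmetry of mixed partial derivatives\<close>

lemma smooth_has_vector_derivative:
  fixes f :: "'a::euclidean_space \<Rightarrow> complex"
  assumes "smooth f"
  shows "((\<lambda>t. f (x + t *\<^sub>R h)) has_vector_derivative
    (\<Sum>b\<in>Basis. (h \<bullet> b) *\<^sub>R partial1 b f (x + t *\<^sub>R h))) (at t)"
proof -
  have "((\<lambda>t. f (x + t *\<^sub>R h)) has_derivative
     (\<lambda>s. \<Sum>b\<in>Basis. ((s *\<^sub>R h) \<bullet> b) *\<^sub>R partial1 b f (x + t *\<^sub>R h))) (at t)"
    by (rule has_derivative_compose[where g=f and f="\<lambda>t. x + t *\<^sub>R h", OF _ smooth_has_derivative[OF assms]])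
       (auto intro!: derivative_eq_intros)
  then show ?thesis
    by (simp add: has_vector_derivative_def scaleR_sum_right mult.assoc)
qed

lemma smooth_has_vector_derivative_Basis:
  fixes f :: "'a::euclidean_space \<Rightarrow> complex"
  assumes "smooth f" "a \<in> Basis"
  shows "((\<lambda>t. f (x + t *\<^sub>R a)) has_vector_derivative partial1 a f (x + t *\<^sub>R a)) (at t)"
proof -
  have "(\<Sum>b\<in>Basis. (a \<bullet> b) *\<^sub>R partial1 b f (x + t *\<^sub>R a)) = partial1 a f (x + t *\<^sub>R a)"
    using assms(2) by (simp add: inner_Basis if_distrib[of "\<lambda>c. c *\<^sub>R _"] cong: if_cong)
  then show ?thesis using smooth_has_vector_derivative[OF assms(1), of x a t] by simp
qed

text \<open>The mean value inequality for \<open>g u - u c\<close>. With \<open>c\<close> a mixed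
  derivative it controls second differences, with \<open>c = 0\<close> plain increments, and with
  \<open>c\<close> the linear part of an increment it gives Taylor remainders.\<close>

lemma increment_bound:
  fixes g :: "real \<Rightarrow> complex"
  assumes "0 \<le> s"
    and "\<And>u. u \<in> {0..s} \<Longrightarrow> (g has_vector_derivative g' u) (at u)"
    and "\<And>u. u \<in> {0..s} \<Longrightarrow> norm (g' u - c) \<le> e"
  shows "norm (g s - g 0 - s *\<^sub>R c) \<le> s * e"
proof -
  have "norm ((\<lambda>u. g u - u *\<^sub>R c) s - (\<lambda>u. g u - u *\<^sub>R c) 0) \<le> e * norm (s - 0)"
  proof (rule differentiable_bound[where f'="\<lambda>u h. h *\<^sub>R (g' u - c)"])
    fix u assume u: "u \<in> {0..s}"
    have "((\<lambda>u. g u - u *\<^sub>R c) has_vector_derivative g' u - 1 *\<^sub>R c) (at u within {0..s})"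
      by (rule has_vector_derivative_at_within)
         (intro derivative_intros assms u has_vector_derivative_diff, auto intro!: derivative_eq_intros)
    then show "((\<lambda>u. g u - u *\<^sub>R c) has_derivative (\<lambda>h. h *\<^sub>R (g' u - c))) (at u within {0..s})"
      by (simp add: has_vector_derivative_def)
    show "onorm (\<lambda>h. h *\<^sub>R (g' u - c)) \<le> e"
      using mult_right_mono[OF assms(3)[OF u] abs_ge_zero] by (intro onorm_le) (simp add: mult.commute)
  qed (use assms(1) in auto)
  then show ?thesis using assms(1) by (simp add: algebra_simps)
qed

lemma smooth_partials: "smooth f \<Longrightarrow> bs \<in> lists Basis \<Longrightarrow> smooth (partials bs f)"
  unfolding smooth_def by (metis append_in_lists_conv partials_append)

lemma smooth_partial1: "smooth f \<Longrightarrow> b \<in> Basis \<Longrightarrow> smooth (partial1 b f)"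
  using smooth_partials[of f "[b]"] by (simp add: partials_Cons)

text \<open>Two applications of the mean value inequality: along \<open>b\<close> to
  \<open>partial1 a f\<close>, then along \<open>a\<close> to the increment of \<open>f\<close> in
  direction \<open>b\<close>. Continuity of the mixed derivative at \<open>x\<close> identifies the
  limit.\<close>

lemma second_difference_bound:
  fixes f :: "'a::euclidean_space \<Rightarrow> complex"
  assumes f: "smooth f" and a: "a \<in> Basis" and b: "b \<in> Basis" and "e > 0"
  shows "\<exists>r>0. \<forall>s\<in>{0<..<r}. norm (f (x + s *\<^sub>R a + s *\<^sub>R b) - f (x + s *\<^sub>R a) - f (x + s *\<^sub>R b) + f x
           - s\<^sup>2 *\<^sub>R partial1 b (partial1 a f) x) \<le> s\<^sup>2 * e"
proof -
  let ?g = "partial1 a f" let ?c = "partial1 b ?g x"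
  have g: "smooth ?g" "smooth (partial1 b ?g)" by (intro smooth_partial1 f a b)+
  have "isCont (partial1 b ?g) x"
    using smooth_continuous_on[OF g(2), of UNIV] by (simp add: continuous_on_eq_continuous_at)
  then obtain r where r: "r > 0" "\<And>y. dist y x < r \<Longrightarrow> dist (partial1 b ?g y) ?c < e"
    using \<open>e > 0\<close> unfolding continuous_at_eps_delta by blast
  show ?thesis
  \<comment> \<open>Half of \<open>r\<close>, since points of the parallelogram are displaced by up
    to \<open>u + v\<close>, which can reach \<open>2 s\<close>.\<close>
  proof (intro exI[of _ "r / 2"] conjI ballI)
    fix s assume s: "s \<in> {0<..<r/2}"
    have near: "norm (partial1 b ?g (x + u *\<^sub>R a + v *\<^sub>R b) - ?c) \<le> e"
      if "u \<in> {0..s}" "v \<in> {0..s}" for u v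
    proof -
      have "norm (u *\<^sub>R a + v *\<^sub>R b) \<le> \<bar>u\<bar> + \<bar>v\<bar>"
        using norm_triangle_ineq[of "u *\<^sub>R a" "v *\<^sub>R b"] a b by simp
      also have "\<dots> < r" using that s by auto
      finally have "dist (x + u *\<^sub>R a + v *\<^sub>R b) x < r"
        by (simp add: dist_norm add.assoc)
      from r(2)[OF this] show ?thesis by (simp add: dist_norm)
    qed
    have inner: "norm (?g (x + u *\<^sub>R a + s *\<^sub>R b) - ?g (x + u *\<^sub>R a) - s *\<^sub>R ?c) \<le> s * e"
      if "u \<in> {0..s}" for u
      using increment_bound[of s "\<lambda>v. ?g (x + u *\<^sub>R a + v *\<^sub>R b)" "\<lambda>v. partial1 b ?g (x + u *\<^sub>R a + v *\<^sub>R b)" ?c e]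
        s near[OF that] smooth_has_vector_derivative_Basis[OF g(1) b] by auto
    have "norm ((f (x + s *\<^sub>R b + s *\<^sub>R a) - f (x + s *\<^sub>R a)) - (f (x + s *\<^sub>R b + 0 *\<^sub>R a) - f (x + 0 *\<^sub>R a))
         - s *\<^sub>R (s *\<^sub>R ?c)) \<le> s * (s * e)"
    proof (rule increment_bound)
      fix u assume u: "u \<in> {0..s}"
      show "((\<lambda>u. f (x + s *\<^sub>R b + u *\<^sub>R a) - f (x + u *\<^sub>R a)) has_vector_derivative
          ?g (x + s *\<^sub>R b + u *\<^sub>R a) - ?g (x + u *\<^sub>R a)) (at u)"
        by (intro has_vector_derivative_diff smooth_has_vector_derivative_Basis f a)
      show "norm (?g (x + s *\<^sub>R b + u *\<^sub>R a) - ?g (x + u *\<^sub>R a) - s *\<^sub>R ?c) \<le> s * e"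
        using inner[OF u] by (simp add: algebra_simps)
    qed (use s in auto)
    then show "norm (f (x + s *\<^sub>R a + s *\<^sub>R b) - f (x + s *\<^sub>R a) - f (x + s *\<^sub>R b) + f x
           - s\<^sup>2 *\<^sub>R partial1 b (partial1 a f) x) \<le> s\<^sup>2 * e"
      by (simp add: algebra_simps power2_eq_square)
  qed (use r in auto)
qed

text \<open>The second difference of \<open>f\<close> along \<open>a\<close> and \<open>b\<close> is
  symmetric in the two directions, and divided by \<open>s^2\<close> it approximates either mixed
  derivative.\<close>

lemma partial1_commute:
  fixes f :: "'a::euclidean_space \<Rightarrow> complex"
  assumes f: "smooth f" and a: "a \<in> Basis" and b: "b \<in> Basis"
  shows "partial1 a (partial1 b f) = partial1 b (partial1 a f)"
proof
  fix x
  let ?p = "partial1 a (partial1 b f) x" and ?q = "partial1 b (partial1 a f) x"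
  have "norm (?p - ?q) \<le> 2 * e" if e: "e > 0" for e
  proof -
    obtain r where r: "r > 0" "\<forall>s\<in>{0<..<r}. norm (f (x + s *\<^sub>R a + s *\<^sub>R b) - f (x + s *\<^sub>R a) - f (x + s *\<^sub>R b) + f x
           - s\<^sup>2 *\<^sub>R ?q) \<le> s\<^sup>2 * e"
      using second_difference_bound[OF f a b e] by blast
    obtain r' where r': "r' > 0" "\<forall>s\<in>{0<..<r'}. norm (f (x + s *\<^sub>R b + s *\<^sub>R a) - f (x + s *\<^sub>R b) - f (x + s *\<^sub>R a) + f x
           - s\<^sup>2 *\<^sub>R ?p) \<le> s\<^sup>2 * e"
      using second_difference_bound[OF f b a e] by blast
    define s where "s = min r r' / 2"
    have s: "s > 0" "s \<in> {0<..<r}" "s \<in> {0<..<r'}" using r(1) r'(1) by (auto simp: s_def)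
    let ?D = "f (x + s *\<^sub>R a + s *\<^sub>R b) - f (x + s *\<^sub>R a) - f (x + s *\<^sub>R b) + f x"
    have 1: "norm (?D - s\<^sup>2 *\<^sub>R ?q) \<le> s\<^sup>2 * e" using r(2) s by blast
    have 2: "norm (?D - s\<^sup>2 *\<^sub>R ?p) \<le> s\<^sup>2 * e"
      using r'(2) s by (simp add: algebra_simps)
    have "s\<^sup>2 * norm (?p - ?q) = norm ((?D - s\<^sup>2 *\<^sub>R ?q) - (?D - s\<^sup>2 *\<^sub>R ?p))"
      by (simp flip: scaleR_diff_right)
    also have "\<dots> \<le> s\<^sup>2 * (2 * e)" using norm_triangle_ineq4[of "?D - s\<^sup>2 *\<^sub>R ?q"  "?D - s\<^sup>2 *\<^sub>R ?p"] 1 2 by linarith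
    finally show ?thesis using s(1) by simp
  qed
  then have "norm (?p - ?q) \<le> 0 + e" if "e > 0" for e
    using that by (metis add_0 field_sum_of_halves half_gt_zero mult_2)
  then have "norm (?p - ?q) \<le> 0" by (rule field_le_epsilon)
  then show "?p = ?q" by simp
qed

lemma partials_partial1_commute:
  fixes f :: "'a::euclidean_space \<Rightarrow> complex"
  assumes "smooth f" "bs \<in> lists Basis" "a \<in> Basis"
  shows "partials bs (partial1 a f) = partial1 a (partials bs f)"
  using assms(2)
proof (induction bs)
  case (Cons b bs)
  then show ?case
    using assms(1,3) by (simp add: partials_Cons partial1_commute smooth_partials)
qed simp

subsection \<open>Functions all of whose derivatives satisfy a growth condition\<close>

text \<open>The growth class \<open>B\<close> is a parameter, so that sums, products, conjugates and
  affine substitutions are treated once. The instances are all smooth functions, Schwartz functions,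
  multipliers, kernels depending on a parameter, and functions bounded with a fixed weight.\<close>

definition derivs_in :: "('a::euclidean_space \<Rightarrow> complex) set \<Rightarrow> ('a \<Rightarrow> complex) set"
  where "derivs_in B = {f. smooth f \<and> (\<forall>bs\<in>lists Basis. partials bs f \<in> B)}"

lemma derivs_in_smooth: "f \<in> derivs_in B \<Longrightarrow> smooth f"
  by (simp add: derivs_in_def)

lemma derivs_in_UNIV: "derivs_in UNIV = Collect smooth"
  by (auto simp: derivs_in_def)

lemma derivs_in_partials: "f \<in> derivs_in B \<Longrightarrow> bs \<in> lists Basis \<Longrightarrow> partials bs f \<in> derivs_in B"
  by (auto simp: derivs_in_def smooth_partials simp flip: partials_append)

lemma derivs_in_partial1: "f \<in> derivs_in B \<Longrightarrow> b \<in> Basis \<Longrightarrow> partial1 b f \<in> derivs_in B"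
  using derivs_in_partials[of f B "[b]"] by (simp add: partials_Cons)

lemma derivs_in_subset: "derivs_in B \<subseteq> B"
  by (force simp: derivs_in_def dest: bspec[where x="[]"])

lemma derivs_inD: "f \<in> derivs_in B \<Longrightarrow> f \<in> B"
  using derivs_in_subset by blast

lemma derivs_in_mono: "B \<subseteq> B' \<Longrightarrow> derivs_in B \<subseteq> derivs_in B'"
  by (auto simp: derivs_in_def)

text \<open>Coinduction: a class \<open>X\<close> stable under every \<open>partial1 b\<close>, with
  differentiable members that lie in \<open>B\<close>, takes the place of explicit formulas for
  higher derivatives.\<close>

lemma derivs_in_coinduct:
  assumes "f \<in> X"
    and B: "\<And>g. g \<in> X \<Longrightarrow> g \<in> B"
    and d: "\<And>g x. g \<in> X \<Longrightarrow> g differentiable (at x)"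
    and p: "\<And>g b. g \<in> X \<Longrightarrow> b \<in> Basis \<Longrightarrow> partial1 b g \<in> X"
  shows "f \<in> derivs_in B"
proof -
  have "partials bs f \<in> X" if "bs \<in> lists Basis" for bs
    using that
  proof (induction bs)
    case (Cons b bs)
    then show ?case by (simp add: partials_Cons p)
  qed (simp add: assms(1))
  then show ?thesis using B d by (auto simp: derivs_in_def smooth_def)
qed

definition lin_closed :: "('a \<Rightarrow> complex) set \<Rightarrow> bool"
  where "lin_closed B \<longleftrightarrow> (\<lambda>x. 0) \<in> B \<and> (\<forall>f\<in>B. \<forall>g\<in>B. (\<lambda>x. f x + g x) \<in> B)
    \<and> (\<forall>c. \<forall>f\<in>B. (\<lambda>x. c * f x) \<in> B)"

lemma lin_closed_UNIV: "lin_closed UNIV"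
  by (simp add: lin_closed_def)

text \<open>By the product and chain rules a derivative of one product or composite is a sum of
  several. The set of such functions is not stable under \<open>partial1\<close>, but its linear
  span is.\<close>

inductive_set lin_span :: "('a \<Rightarrow> complex) set \<Rightarrow> ('a \<Rightarrow> complex) set" for Y
  where
    lin_span_base: "f \<in> Y \<Longrightarrow> f \<in> lin_span Y"
  | lin_span_zero: "(\<lambda>x. 0) \<in> lin_span Y"
  | lin_span_add: "f \<in> lin_span Y \<Longrightarrow> g \<in> lin_span Y \<Longrightarrow> (\<lambda>x. f x + g x) \<in> lin_span Y"
  | lin_span_cmult: "f \<in> lin_span Y \<Longrightarrow> (\<lambda>x. c * f x) \<in> lin_span Y"

lemma lin_span_sum:
  assumes "\<And>i. i \<in> I \<Longrightarrow> f i \<in> lin_span Y"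
  shows "(\<lambda>x. \<Sum>i\<in>I. f i x) \<in> lin_span Y"
  using assms
  by (induction I rule: infinite_finite_induct) (auto intro: lin_span.intros)

section \<open>Differentiation rules and closure properties\<close>

lemma partial1_const: "partial1 b (\<lambda>x. c) = (\<lambda>x. 0)"
  by (auto simp: fun_eq_iff intro: partial1_eq)

lemma partial1_add:
  assumes "\<And>x. f differentiable (at x)" "\<And>x. g differentiable (at x)"
  shows "partial1 b (\<lambda>x. f x + g x) = (\<lambda>x. partial1 b f x + partial1 b g x)"
proof
  fix x
  obtain f' g' where d: "(f has_derivative f') (at x)" "(g has_derivative g') (at x)"
    using assms by (metis differentiable_def)
  show "partial1 b (\<lambda>x. f x + g x) x = partial1 b f x + partial1 b g x"
    by (simp add: d[THEN partial1_eq] has_derivative_add[OF d, THEN partial1_eq])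
qed

lemma partial1_mult:
  assumes "\<And>x. f differentiable (at x)" "\<And>x. g differentiable (at x)"
  shows "partial1 b (\<lambda>x. f x * g x) = (\<lambda>x. partial1 b f x * g x + f x * partial1 b g x)"
proof
  fix x
  obtain f' g' where d: "(f has_derivative f') (at x)" "(g has_derivative g') (at x)"
    using assms by (metis differentiable_def)
  show "partial1 b (\<lambda>x. f x * g x) x = partial1 b f x * g x + f x * partial1 b g x"
    by (simp add: d[THEN partial1_eq] has_derivative_mult[OF d, THEN partial1_eq])
qed

lemma partial1_cmult:
  assumes "\<And>x. f differentiable (at x)"
  shows "partial1 b (\<lambda>x. c * f x) = (\<lambda>x. c * partial1 b f x)"
  using partial1_mult[of "\<lambda>x. c" f b] assms by (simp add: partial1_const)

lemma partial1_sum: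
  assumes "\<And>i x. i \<in> I \<Longrightarrow> f i differentiable (at x)"
  shows "partial1 b (\<lambda>x. \<Sum>i\<in>I. f i x) = (\<lambda>x. \<Sum>i\<in>I. partial1 b (f i) x)"
  using assms
proof (induction I rule: infinite_finite_induct)
  case (insert i I)
  then have "\<And>x. (\<lambda>x. \<Sum>i\<in>I. f i x) differentiable (at x)"
    by (intro differentiable_sum) auto
  then show ?case using insert by (simp add: partial1_add)
qed (auto simp: partial1_const)

lemma partial1_cnj:
  assumes "\<And>x. f differentiable (at x)"
  shows "partial1 b (\<lambda>x. cnj (f x)) = (\<lambda>x. cnj (partial1 b f x))"
proof
  fix x
  obtain f' where d: "(f has_derivative f') (at x)"
    using assms by (metis differentiable_def)
  show "partial1 b (\<lambda>x. cnj (f x)) x = cnj (partial1 b f x)"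
    by (simp add: partial1_eq[OF d] partial1_eq[OF has_derivative_cnj[OF d]])
qed

lemma partial1_affine:
  fixes A :: "'a::euclidean_space \<Rightarrow> 'b::euclidean_space"
  assumes f: "\<And>x. f differentiable (at x)" and A: "linear A"
  shows "partial1 b (\<lambda>x. f (A x + c)) = (\<lambda>x. \<Sum>b'\<in>Basis. of_real (A b \<bullet> b') * partial1 b' f (A x + c))"
    and "(\<lambda>x. f (A x + c)) differentiable (at x)"
proof -
  have d: "((\<lambda>x. f (A x + c)) has_derivative (\<lambda>h. \<Sum>b\<in>Basis. (A h \<bullet> b) *\<^sub>R partial1 b f (A x + c))) (at x)" for x
    by (rule has_derivative_compose[where g=f and f="\<lambda>x. A x + c", OF _ differentiable_has_derivative_partial1[OF f]])
       (auto intro!: derivative_eq_intros linear_imp_has_derivative A)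
  show "(\<lambda>x. f (A x + c)) differentiable (at x)"
    using d by (auto simp: differentiable_def)
  show "partial1 b (\<lambda>x. f (A x + c)) = (\<lambda>x. \<Sum>b'\<in>Basis. of_real (A b \<bullet> b') * partial1 b' f (A x + c))"
    by (rule ext, subst partial1_eq[OF d]) (simp add: scaleR_conv_of_real)
qed

text \<open>Since \<open>partial1 b\<close> is linear on differentiable functions and
  \<open>B\<close> is a linear space, the conditions of the coinduction pass from the generators
  \<open>Y\<close> to their span.\<close>

lemma derivs_in_lin_span:
  assumes B: "lin_closed B" and f: "f \<in> lin_span Y"
    and Y: "\<And>g. g \<in> Y \<Longrightarrow> g \<in> B" "\<And>g x. g \<in> Y \<Longrightarrow> g differentiable (at x)"
      "\<And>g b. g \<in> Y \<Longrightarrow> b \<in> Basis \<Longrightarrow> partial1 b g \<in> lin_span Y"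
  shows "f \<in> derivs_in B"
proof -
  have *: "g \<in> B \<and> (\<forall>x. g differentiable (at x)) \<and> (\<forall>b\<in>Basis. partial1 b g \<in> lin_span Y)"
    if "g \<in> lin_span Y" for g
    using that
  proof induction
    case (lin_span_base f)
    then show ?case using Y by blast
  next
    case lin_span_zero
    then show ?case using B by (auto simp: lin_closed_def partial1_const intro: lin_span.intros)
  next
    case (lin_span_add f g)
    then show ?case using B by (auto simp: lin_closed_def partial1_add intro: lin_span.intros)
  next
    case (lin_span_cmult f c)
    then show ?case using B by (auto simp: lin_closed_def partial1_cmult intro: lin_span.intros)
  qed
  show ?thesis
    by (rule derivs_in_coinduct[OF f]) (use * in auto)
qed

text \<open>The generators are all products of a member of \<open>derivs_in B1\<close> with one of
  \<open>derivs_in B2\<close>, so the growth assumption concerns undifferentiated products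
  only.\<close>

lemma derivs_in_mult:
  assumes "lin_closed B" "f1 \<in> derivs_in B1" "f2 \<in> derivs_in B2"
    and "\<And>g1 g2. g1 \<in> B1 \<Longrightarrow> g2 \<in> B2 \<Longrightarrow> (\<lambda>x. g1 x * g2 x) \<in> B"
  shows "(\<lambda>x. f1 x * f2 x) \<in> derivs_in B"
proof (rule derivs_in_lin_span[where Y="{\<lambda>x. g1 x * g2 x | g1 g2. g1 \<in> derivs_in B1 \<and> g2 \<in> derivs_in B2}"])
  let ?Y = "{\<lambda>x. g1 x * g2 x | g1 g2. g1 \<in> derivs_in B1 \<and> g2 \<in> derivs_in B2}"
  show "(\<lambda>x. f1 x * f2 x) \<in> lin_span ?Y"
    using assms by (intro lin_span_base) auto
  fix g b assume "g \<in> ?Y" "b \<in> (Basis::'a set)"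
  then obtain g1 g2 where g: "g = (\<lambda>x. g1 x * g2 x)" "g1 \<in> derivs_in B1" "g2 \<in> derivs_in B2"
    by blast
  have "partial1 b g = (\<lambda>x. partial1 b g1 x * g2 x + g1 x * partial1 b g2 x)"
    unfolding g(1) using g(2,3)
    by (intro partial1_mult) (auto dest: derivs_in_smooth smooth_differentiable)
  also have "\<dots> \<in> lin_span ?Y"
    using g \<open>b \<in> Basis\<close> by (intro lin_span_add lin_span_base) (auto intro: derivs_in_partial1)
  finally show "partial1 b g \<in> lin_span ?Y" .
qed (use assms in \<open>auto dest: derivs_in_smooth derivs_inD intro: smooth_differentiable intro!: differentiable_mult\<close>)

lemma derivs_in_add:
  assumes "lin_closed B" "f \<in> derivs_in B" "g \<in> derivs_in B"
  shows "(\<lambda>x. f x + g x) \<in> derivs_in B"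
  by (rule derivs_in_lin_span[where Y="derivs_in B"])
     (use assms in \<open>auto intro: lin_span.intros derivs_in_partial1 smooth_differentiable dest: derivs_inD derivs_in_smooth\<close>)

lemma derivs_in_cmult:
  assumes "lin_closed B" "f \<in> derivs_in B"
  shows "(\<lambda>x. c * f x) \<in> derivs_in B"
  by (rule derivs_in_lin_span[where Y="derivs_in B"])
     (use assms in \<open>auto intro: lin_span.intros derivs_in_partial1 smooth_differentiable dest: derivs_inD derivs_in_smooth\<close>)

lemma derivs_in_sum:
  assumes "lin_closed B" "\<And>i. i \<in> I \<Longrightarrow> f i \<in> derivs_in B"
  shows "(\<lambda>x. \<Sum>i\<in>I. f i x) \<in> derivs_in B"
  by (rule derivs_in_lin_span[where Y="derivs_in B"])
     (use assms in \<open>auto intro: lin_span_sum lin_span.intros derivs_in_partial1 smooth_differentiable dest: derivs_inD derivs_in_smooth\<close>)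

lemma derivs_in_const:
  assumes "lin_closed B" "(\<lambda>x. c) \<in> B"
  shows "(\<lambda>x. c) \<in> derivs_in B"
  by (rule derivs_in_lin_span[where Y="{\<lambda>x. c}"])
     (use assms in \<open>auto intro: lin_span.intros simp: partial1_const\<close>)

lemma derivs_in_cnj:
  assumes "f \<in> derivs_in B" "\<And>g. g \<in> B \<Longrightarrow> (\<lambda>x. cnj (g x)) \<in> B"
  shows "(\<lambda>x. cnj (f x)) \<in> derivs_in B"
proof (rule derivs_in_coinduct[where X="{\<lambda>x. cnj (g x) | g. g \<in> derivs_in B}"])
  fix g x assume "g \<in> {\<lambda>x. cnj (g x) | g. g \<in> derivs_in B}"
  then obtain h where h: "g = (\<lambda>x. cnj (h x))" "h \<in> derivs_in B" by blast
  then have d: "\<And>x. h differentiable (at x)" by (auto dest: derivs_in_smooth smooth_differentiable)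
  then show "g differentiable (at x)"
    unfolding h(1) differentiable_def by (fast intro: has_derivative_cnj)
  show "partial1 b g \<in> {\<lambda>x. cnj (g x) | g. g \<in> derivs_in B}" if "b \<in> Basis" for b
    using h(2) d that by (auto simp: h(1) partial1_cnj intro: derivs_in_partial1)
qed (use assms in \<open>auto dest: derivs_inD\<close>)

lemma derivs_in_affine:
  fixes A :: "'a::euclidean_space \<Rightarrow> 'b::euclidean_space"
  assumes "lin_closed B'" "f \<in> derivs_in B" "linear A"
    and "\<And>g. g \<in> B \<Longrightarrow> (\<lambda>x. g (A x + c)) \<in> B'"
  shows "(\<lambda>x. f (A x + c)) \<in> derivs_in B'"
proof (rule derivs_in_lin_span[where Y="{\<lambda>x. g (A x + c) | g. g \<in> derivs_in B}"])
  let ?Y = "{\<lambda>x. g (A x + c) | g. g \<in> derivs_in B}"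
  fix g x assume "g \<in> ?Y"
  then obtain h where h: "g = (\<lambda>x. h (A x + c))" "h \<in> derivs_in B" by blast
  then have d: "\<And>x. h differentiable (at x)" by (auto dest: derivs_in_smooth smooth_differentiable)
  show "g differentiable (at x)"
    unfolding h(1) by (intro partial1_affine d assms)
  show "partial1 b g \<in> lin_span ?Y" for b
    unfolding h(1) partial1_affine(1)[OF d assms(3)]
    using h(2) by (intro lin_span_sum lin_span_cmult lin_span_base) (auto intro: derivs_in_partial1)
qed (use assms in \<open>auto dest: derivs_inD intro!: lin_span_base\<close>)

section \<open>Growth conditions and Schwartz functions\<close>

lemma jbracket_ge_1: "1 \<le> jbracket x"
  by (simp add: jbracket_def)

lemma jbracket_pos [simp]: "0 < jbracket x"
  using jbracket_ge_1[of x] by linarith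

lemma jbracket_nonneg [simp]: "0 \<le> jbracket x"
  using jbracket_ge_1[of x] by linarith

lemma jbracket_nonzero [simp]: "jbracket x \<noteq> 0"
  using jbracket_pos[of x] by linarith

lemma jbracket_not_less_0 [simp]: "\<not> jbracket x < 0" "\<not> jbracket x \<le> 0"
  using jbracket_pos[of x] by linarith+

lemma jbracket_square: "(jbracket x)\<^sup>2 = 1 + (norm x)\<^sup>2"
  by (simp add: jbracket_def add_nonneg_nonneg)

lemma jbracket_power_ge_1: "1 \<le> jbracket x ^ n"
  by (simp add: jbracket_ge_1)

lemma jbracket_power_mono: "m \<le> n \<Longrightarrow> jbracket x ^ m \<le> jbracket x ^ n"
  by (intro power_increasing jbracket_ge_1)

lemma norm_le_jbracket: "norm x \<le> jbracket x"
  by (rule power2_le_imp_le) (auto simp: jbracket_square)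

lemma jbracket_le: "jbracket x \<le> 1 + norm x"
  by (rule power2_le_imp_le) (auto simp: jbracket_square power2_sum)

lemma jbracket_mono: "norm x \<le> norm y \<Longrightarrow> jbracket x \<le> jbracket y"
  by (simp add: jbracket_def power_mono)

lemma jbracket_uminus [simp]: "jbracket (- x) = jbracket x"
  by (simp add: jbracket_def)

text \<open>Peetre's inequality: a power of the bracket moves across a translation at the cost of
  the same power of the bracket of the shift.\<close>

lemma jbracket_add: "jbracket (x + y) \<le> 2 * jbracket x * jbracket y"
proof (rule power2_le_imp_le)
  have "(norm (x + y))\<^sup>2 \<le> (norm x + norm y)\<^sup>2"
    by (simp add: norm_triangle_ineq power_mono)
  also have "\<dots> \<le> 2 * (norm x)\<^sup>2 + 2 * (norm y)\<^sup>2"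
    using zero_le_power2[of "norm x - norm y"] by (simp add: power2_eq_square algebra_simps)
  finally have "(norm (x + y))\<^sup>2 \<le> 2 * (norm x)\<^sup>2 + 2 * (norm y)\<^sup>2" .
  moreover have "0 \<le> (norm x)\<^sup>2 * (norm y)\<^sup>2" "0 \<le> (norm x)\<^sup>2" "0 \<le> (norm y)\<^sup>2" by simp_all
  ultimately have "1 + (norm (x + y))\<^sup>2
      \<le> 4 + (4 * (norm x)\<^sup>2 + (4 * (norm y)\<^sup>2 + 4 * ((norm x)\<^sup>2 * (norm y)\<^sup>2)))"
    by linarith
  then have "1 + (norm (x + y))\<^sup>2 \<le> 4 * ((1 + (norm x)\<^sup>2) * (1 + (norm y)\<^sup>2))"
    by (simp add: algebra_simps)
  then show "(jbracket (x + y))\<^sup>2 \<le> (2 * jbracket x * jbracket y)\<^sup>2"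
    by (simp add: jbracket_square power_mult_distrib algebra_simps)
qed simp

lemma jbracket_diff: "jbracket (x - y) \<le> 2 * jbracket x * jbracket y"
  using jbracket_add[of x "- y"] by simp

lemma jbracket_Pair_le: "jbracket (x, y) \<le> jbracket x * jbracket y"
  by (rule power2_le_imp_le) (auto simp: jbracket_square power_mult_distrib norm_Pair algebra_simps)

lemma jbracket_fst_le: "jbracket x \<le> jbracket (x, y)"
  by (rule jbracket_mono) (simp add: norm_Pair real_le_rsqrt)

lemma jbracket_snd_le: "jbracket y \<le> jbracket (x, y)"
  by (rule jbracket_mono) (simp add: norm_Pair real_le_rsqrt)

lemma jbracket_affine:
  assumes "linear A"
  shows "\<exists>K\<ge>1. \<forall>x. jbracket (A x + c) \<le> K * jbracket x"
proof -
  interpret bounded_linear A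
    using assms by (simp add: linear_conv_bounded_linear)
  obtain K where K: "K \<ge> 0" "\<And>x. norm (A x) \<le> norm x * K"
    using nonneg_bounded by blast
  have "jbracket (A x + c) \<le> (1 + K + norm c) * jbracket x" for x
  proof -
    have "jbracket (A x + c) \<le> 1 + norm x * K + norm c"
      using jbracket_le[of "A x + c"] norm_triangle_ineq[of "A x" c] K(2)[of x] by linarith
    also have "\<dots> \<le> 1 * jbracket x + K * jbracket x + norm c * jbracket x"
      using K(1) jbracket_ge_1[of x] norm_le_jbracket[of x]
      by (intro add_mono) (auto simp: mult.commute[of _ K] mult_left_mono mult_le_cancel_left1)
    finally show ?thesis by (simp add: algebra_simps)
  qed
  moreover have "1 + K + norm c \<ge> 1" using K(1) by simp
  ultimately show ?thesis by blast
qed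

lemma product_bound:
  fixes a b :: real
  assumes "a \<le> C * w" "b \<le> D * v" "0 \<le> a" "0 \<le> b"
  shows "a * b \<le> (C * D) * (w * v)"
  using mult_mono[OF assms(1,2)] assms by (simp add: ac_simps)

text \<open>With one fixed weight, \<open>derivs_in (bdd_by w)\<close> gives all derivatives the
  same growth. This is the uniformity demanded by \<open>slow_function\<close>, which
  \<open>poly_bdd\<close> forgets.\<close>

definition bdd_by :: "('a \<Rightarrow> real) \<Rightarrow> ('a \<Rightarrow> complex) set"
  where "bdd_by \<omega> = {g. \<exists>C. \<forall>x. norm (g x) \<le> C * \<omega> x}"

definition rapid :: "('a::euclidean_space \<Rightarrow> complex) set"
  where "rapid = {g. \<forall>N::nat. \<exists>C. \<forall>x. jbracket x ^ N * norm (g x) \<le> C}"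

definition poly_bdd :: "('a::euclidean_space \<Rightarrow> complex) set"
  where "poly_bdd = {g. \<exists>C. \<exists>N::nat. \<forall>x. norm (g x) \<le> C * jbracket x ^ N}"

text \<open>Kernels with a parameter \<open>x\<close> that decrease rapidly in \<open>y\<close>,
  each weighted bound growing polynomially in \<open>x\<close> with a degree that may depend on the
  weight. When all derivatives are of this kind, pairing in \<open>y\<close> with a tempered
  distribution yields a member of \<open>slow\<close>.\<close>

definition poly_rapid :: "('a::euclidean_space \<times> 'b::euclidean_space \<Rightarrow> complex) set"
  where "poly_rapid = {g. \<forall>M::nat. \<exists>C. \<exists>N::nat. \<forall>x y. jbracket y ^ M * norm (g (x, y)) \<le> C * jbracket x ^ N}"

lemma rapidD: "g \<in> rapid \<Longrightarrow> \<exists>C\<ge>0. \<forall>x. jbracket x ^ N * norm (g x) \<le> C"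
proof -
  assume "g \<in> rapid"
  then obtain C where C: "\<And>x. jbracket x ^ N * norm (g x) \<le> C" by (auto simp: rapid_def)
  then show ?thesis by (intro exI[of _ "\<bar>C\<bar>"]) (meson abs_ge_self abs_ge_zero order_trans)
qed

lemma poly_bddD: "g \<in> poly_bdd \<Longrightarrow> \<exists>C\<ge>0. \<exists>N::nat. \<forall>x. norm (g x) \<le> C * jbracket x ^ N"
proof -
  assume "g \<in> poly_bdd"
  then obtain C N where "\<And>x. norm (g x) \<le> C * jbracket x ^ N" by (auto simp: poly_bdd_def)
  moreover have "C * jbracket x ^ N \<le> \<bar>C\<bar> * jbracket x ^ N" for x :: 'a
    by (simp add: mult_right_mono)
  ultimately show ?thesis by (meson abs_ge_zero order_trans)
qed

lemma poly_rapidD: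
  "g \<in> poly_rapid \<Longrightarrow> \<exists>C\<ge>0. \<exists>N::nat. \<forall>x y. jbracket y ^ M * norm (g (x, y)) \<le> C * jbracket x ^ N"
proof -
  assume "g \<in> poly_rapid"
  then obtain C N where "\<And>x y. jbracket y ^ M * norm (g (x, y)) \<le> C * jbracket x ^ N"
    by (fastforce simp: poly_rapid_def)
  moreover have "C * jbracket x ^ N \<le> \<bar>C\<bar> * jbracket x ^ N" for x :: 'a
    by (simp add: mult_right_mono)
  ultimately show ?thesis by (meson abs_ge_zero order_trans)
qed

lemma add_growth_bound:
  fixes v :: real
  assumes "a \<le> C * v ^ N" "b \<le> D * v ^ M" "C \<ge> 0" "D \<ge> 0" "v \<ge> 1"
  shows "a + b \<le> (C + D) * v ^ (N + M)"
proof -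
  have "C * v ^ N \<le> C * v ^ (N + M)" "D * v ^ M \<le> D * v ^ (N + M)"
    using assms by (auto intro!: mult_left_mono power_increasing)
  then show ?thesis using assms(1,2) by (simp add: algebra_simps)
qed

lemma weighted_norm_add:
  fixes f g :: complex
  assumes "w \<ge> 0" "w * norm f \<le> a" "w * norm g \<le> b"
  shows "w * norm (f + g) \<le> a + b"
  using mult_left_mono[OF norm_triangle_ineq assms(1), of f g] assms by (simp add: algebra_simps)

lemma weighted_norm_mult:
  fixes c g :: complex
  assumes "w * norm g \<le> a"
  shows "w * norm (c * g) \<le> norm c * a"
  using mult_left_mono[OF assms norm_ge_zero[of c]] by (simp add: norm_mult algebra_simps)

lemma lin_closed_bdd_by: "lin_closed (bdd_by \<omega>)"
  unfolding lin_closed_def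
proof (intro conjI ballI allI)
  fix f g :: "'a \<Rightarrow> complex" and c :: complex assume "f \<in> bdd_by \<omega>"
  then obtain C where C: "\<And>x. norm (f x) \<le> C * \<omega> x" by (auto simp: bdd_by_def)
  show "(\<lambda>x. c * f x) \<in> bdd_by \<omega>"
    unfolding bdd_by_def mem_Collect_eq
    by (intro exI[of _ "norm c * C"]) (simp add: norm_mult mult.assoc mult_left_mono C)
  assume "g \<in> bdd_by \<omega>"
  then obtain D where D: "\<And>x. norm (g x) \<le> D * \<omega> x" by (auto simp: bdd_by_def)
  show "(\<lambda>x. f x + g x) \<in> bdd_by \<omega>"
    unfolding bdd_by_def mem_Collect_eq
    by (intro exI[of _ "C + D"] allI order_trans[OF norm_triangle_ineq])
       (use C D in \<open>simp add: distrib_right add_mono\<close>)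
qed (auto simp: bdd_by_def intro!: exI[of _ 0])

lemma rapid_eq: "rapid = (\<Inter>N. bdd_by (\<lambda>x. 1 / jbracket x ^ N))"
  by (auto simp: rapid_def bdd_by_def field_simps)

lemma lin_closed_rapid: "lin_closed rapid"
  using lin_closed_bdd_by unfolding rapid_eq lin_closed_def by blast

lemma lin_closed_poly_bdd: "lin_closed poly_bdd"
  unfolding lin_closed_def
proof (intro conjI ballI allI)
  fix f g :: "'a \<Rightarrow> complex" and c :: complex assume f: "f \<in> poly_bdd"
  then obtain C N where C: "C \<ge> 0" "\<And>x. norm (f x) \<le> C * jbracket x ^ N" using poly_bddD by blast
  show "(\<lambda>x. c * f x) \<in> poly_bdd"
    unfolding poly_bdd_def mem_Collect_eq
    by (intro exI[of _ "norm c * C"] exI[of _ N]) (simp add: norm_mult mult.assoc mult_left_mono C)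
  assume g: "g \<in> poly_bdd"
  then obtain D M where D: "D \<ge> 0" "\<And>x. norm (g x) \<le> D * jbracket x ^ M" using poly_bddD by blast
  show "(\<lambda>x. f x + g x) \<in> poly_bdd"
    unfolding poly_bdd_def mem_Collect_eq
    by (intro exI[of _ "C + D"] exI[of _ "N + M"] allI order_trans[OF norm_triangle_ineq]
        add_growth_bound C D jbracket_ge_1)
qed (auto simp: poly_bdd_def intro!: exI[of _ 0])

lemma lin_closed_poly_rapid: "lin_closed poly_rapid"
  unfolding lin_closed_def
proof (intro conjI ballI allI)
  fix f g :: "'a \<times> 'b \<Rightarrow> complex" and c :: complex assume f: "f \<in> poly_rapid"
  show "(\<lambda>x. c * f x) \<in> poly_rapid"
    unfolding poly_rapid_def mem_Collect_eq
  proof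
    fix m
    obtain C N where "\<And>x y. jbracket y ^ m * norm (f (x, y)) \<le> C * jbracket x ^ N"
      using poly_rapidD[OF f] by meson
    then show "\<exists>C N. \<forall>x y. jbracket y ^ m * norm (c * f (x, y)) \<le> C * jbracket x ^ N"
      by (intro exI[of _ "norm c * C"] exI[of _ N]) (simp add: weighted_norm_mult mult.assoc)
  qed
  assume g: "g \<in> poly_rapid"
  show "(\<lambda>x. f x + g x) \<in> poly_rapid"
    unfolding poly_rapid_def mem_Collect_eq
  proof
    fix m
    obtain C N where "C \<ge> 0" "\<And>x y. jbracket y ^ m * norm (f (x, y)) \<le> C * jbracket x ^ N"
      using poly_rapidD[OF f] by meson
    moreover obtain D M where "D \<ge> 0" "\<And>x y. jbracket y ^ m * norm (g (x, y)) \<le> D * jbracket x ^ M"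
      using poly_rapidD[OF g] by meson
    ultimately show "\<exists>C N. \<forall>x y. jbracket y ^ m * norm (f (x, y) + g (x, y)) \<le> C * jbracket x ^ N"
      by (intro exI[of _ "C + D"] exI[of _ "N + M"] allI
           order_trans[OF weighted_norm_add[OF _ order_refl order_refl]]
           add_growth_bound jbracket_ge_1) auto
  qed
qed (auto simp: poly_rapid_def intro!: exI[of _ 0])

lemma schwartz_eq: "schwartz = derivs_in rapid"
proof -
  have "bounded (range (\<lambda>x. jbracket x ^ N * norm (g x))) \<longleftrightarrow> (\<exists>C. \<forall>x. jbracket x ^ N * norm (g x) \<le> C)"
    for N and g :: "'a \<Rightarrow> complex"
    by (simp add: bounded_iff abs_mult)
  then show ?thesis by (auto simp: schwartz_def derivs_in_def rapid_def)
qed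

lemma schwartz_rapidD:
  assumes "\<phi> \<in> schwartz" shows "\<exists>C\<ge>0. \<forall>x. jbracket x ^ N * norm (\<phi> x) \<le> C"
proof (rule rapidD)
  show "\<phi> \<in> rapid" using assms unfolding schwartz_eq by (rule derivs_inD)
qed

text \<open>The space \<open>O_M\<close> of multipliers of the Schwartz space: the degree of the polynomial bound may
  depend on the derivative, unlike in \<open>slow_function\<close>.\<close>

definition slow :: "('a::euclidean_space \<Rightarrow> complex) set"
  where "slow = derivs_in poly_bdd"

lemma slow_smooth: "f \<in> slow \<Longrightarrow> smooth f"
  by (simp add: slow_def derivs_in_smooth)

lemma schwartz_smooth: "f \<in> schwartz \<Longrightarrow> smooth f"
  by (simp add: schwartz_def)

lemma rapid_subset_poly_bdd: "rapid \<subseteq> poly_bdd"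
proof
  fix g :: "'a \<Rightarrow> complex" assume "g \<in> rapid"
  from rapidD[OF this, of 0] show "g \<in> poly_bdd"
    unfolding poly_bdd_def mem_Collect_eq
    by (elim exE conjE) (rule exI, rule exI[of _ 0], simp)
qed

lemma schwartz_subset_slow: "schwartz \<subseteq> slow"
  unfolding schwartz_eq slow_def by (intro derivs_in_mono rapid_subset_poly_bdd)

lemma schwartz_in_slow: "f \<in> schwartz \<Longrightarrow> f \<in> slow"
  using schwartz_subset_slow by blast

section \<open>Multipliers and Schwartz functions: algebra, affine substitution, sections\<close>

lemma slow_partial1: "f \<in> slow \<Longrightarrow> b \<in> Basis \<Longrightarrow> partial1 b f \<in> slow"
  by (simp add: slow_def derivs_in_partial1)

lemma schwartz_partial1: "f \<in> schwartz \<Longrightarrow> b \<in> Basis \<Longrightarrow> partial1 b f \<in> schwartz"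
  by (simp add: schwartz_eq derivs_in_partial1)

lemma schwartz_partials: "f \<in> schwartz \<Longrightarrow> bs \<in> lists Basis \<Longrightarrow> partials bs f \<in> schwartz"
  by (simp add: schwartz_eq derivs_in_partials)

lemma slow_const: "(\<lambda>x. c) \<in> slow"
  unfolding slow_def
  by (intro derivs_in_const lin_closed_poly_bdd)
     (unfold poly_bdd_def mem_Collect_eq, rule exI[of _ "norm c"], rule exI[of _ 0], simp)

lemma slow_add: "f \<in> slow \<Longrightarrow> g \<in> slow \<Longrightarrow> (\<lambda>x. f x + g x) \<in> slow"
  unfolding slow_def by (intro derivs_in_add lin_closed_poly_bdd)

lemma slow_cmult: "f \<in> slow \<Longrightarrow> (\<lambda>x. c * f x) \<in> slow"
  unfolding slow_def by (intro derivs_in_cmult lin_closed_poly_bdd)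

lemma slow_sum: "(\<And>i. i \<in> I \<Longrightarrow> f i \<in> slow) \<Longrightarrow> (\<lambda>x. \<Sum>i\<in>I. f i x) \<in> slow"
  unfolding slow_def by (intro derivs_in_sum lin_closed_poly_bdd)

lemma poly_bdd_mult:
  assumes "f \<in> poly_bdd" "g \<in> poly_bdd" shows "(\<lambda>x. f x * g x) \<in> poly_bdd"
proof -
  obtain C N D M where "\<And>x. norm (f x) \<le> C * jbracket x ^ N" "\<And>x. norm (g x) \<le> D * jbracket x ^ M"
    using assms by (auto simp: poly_bdd_def)
  then show ?thesis
    unfolding poly_bdd_def mem_Collect_eq
    by (intro exI[of _ "C * D"] exI[of _ "N + M"]) (simp add: norm_mult power_add product_bound)
qed

lemma slow_mult: "f \<in> slow \<Longrightarrow> g \<in> slow \<Longrightarrow> (\<lambda>x. f x * g x) \<in> slow"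
  unfolding slow_def by (rule derivs_in_mult[OF lin_closed_poly_bdd]) (auto intro: poly_bdd_mult)

lemma slow_power: "f \<in> slow \<Longrightarrow> (\<lambda>x. f x ^ n) \<in> slow"
  by (induction n) (auto intro: slow_const slow_mult)

lemma slow_cnj: "f \<in> slow \<Longrightarrow> (\<lambda>x. cnj (f x)) \<in> slow"
  unfolding slow_def by (intro derivs_in_cnj) (auto simp: poly_bdd_def)

lemma schwartz_cnj: "f \<in> schwartz \<Longrightarrow> (\<lambda>x. cnj (f x)) \<in> schwartz"
  unfolding schwartz_eq by (intro derivs_in_cnj) (auto simp: rapid_def)

lemma schwartz_add: "f \<in> schwartz \<Longrightarrow> g \<in> schwartz \<Longrightarrow> (\<lambda>x. f x + g x) \<in> schwartz"
  unfolding schwartz_eq by (intro derivs_in_add lin_closed_rapid)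

lemma schwartz_cmult: "f \<in> schwartz \<Longrightarrow> (\<lambda>x. c * f x) \<in> schwartz"
  unfolding schwartz_eq by (intro derivs_in_cmult lin_closed_rapid)

lemma schwartz_diff: "f \<in> schwartz \<Longrightarrow> g \<in> schwartz \<Longrightarrow> (\<lambda>x. f x - g x) \<in> schwartz"
  using schwartz_add[of f "\<lambda>x. - 1 * g x"] schwartz_cmult[of g "- 1"] by simp

lemma schwartz_sum: "(\<And>i. i \<in> I \<Longrightarrow> f i \<in> schwartz) \<Longrightarrow> (\<lambda>x. \<Sum>i\<in>I. f i x) \<in> schwartz"
  unfolding schwartz_eq by (intro derivs_in_sum lin_closed_rapid)

lemma slow_mult_schwartz:
  assumes "f \<in> slow" "g \<in> schwartz" shows "(\<lambda>x. f x * g x) \<in> schwartz"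
  using assms unfolding slow_def schwartz_eq
proof (rule derivs_in_mult[OF lin_closed_rapid])
  fix f g :: "'a \<Rightarrow> complex" assume f: "f \<in> poly_bdd" and g: "g \<in> rapid"
  obtain C N where C: "C \<ge> 0" "\<And>x. norm (f x) \<le> C * jbracket x ^ N" using poly_bddD[OF f] by blast
  show "(\<lambda>x. f x * g x) \<in> rapid"
    unfolding rapid_def mem_Collect_eq
  proof
    fix M
    obtain D where D: "\<And>x. jbracket x ^ (M + N) * norm (g x) \<le> D" using rapidD[OF g] by meson
    have "jbracket x ^ M * norm (f x * g x) \<le> C * D" for x
    proof -
      have "jbracket x ^ M * norm (f x * g x) \<le> jbracket x ^ M * (C * jbracket x ^ N * norm (g x))"
        by (simp add: norm_mult C(2) mult_mono mult_right_mono)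
      also have "\<dots> = C * (jbracket x ^ (M + N) * norm (g x))" by (simp add: power_add)
      also have "\<dots> \<le> C * D" using D C(1) by (simp add: mult_left_mono)
      finally show ?thesis .
    qed
    then show "\<exists>C. \<forall>x. jbracket x ^ M * norm (f x * g x) \<le> C" by blast
  qed
qed

lemma schwartz_mult_slow:
  assumes "f \<in> schwartz" "g \<in> slow" shows "(\<lambda>x. f x * g x) \<in> schwartz"
  using slow_mult_schwartz[OF assms(2,1)] by (simp add: mult.commute)

text \<open>The polynomial bound in \<open>(x, y)\<close> splits into powers of \<open><x>\<close>
  and of \<open><y>\<close>. The former may remain in the result; the latter is paid for by asking
  \<open>g\<close> for \<open>N\<close> more powers of decay.\<close>

lemma slow_mult_poly_rapid:
  assumes "f \<in> slow" "g \<in> derivs_in poly_rapid" shows "(\<lambda>x. f x * g x) \<in> derivs_in poly_rapid"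
  using assms unfolding slow_def
proof (rule derivs_in_mult[OF lin_closed_poly_rapid])
  fix f g :: "'a \<times> 'b \<Rightarrow> complex" assume f: "f \<in> poly_bdd" and g: "g \<in> poly_rapid"
  obtain C N where C: "C \<ge> 0" "\<And>x. norm (f x) \<le> C * jbracket x ^ N" using poly_bddD[OF f] by blast
  show "(\<lambda>x. f x * g x) \<in> poly_rapid"
    unfolding poly_rapid_def mem_Collect_eq
  proof
    fix M
    obtain D K where D: "\<And>x y. jbracket y ^ (M + N) * norm (g (x, y)) \<le> D * jbracket x ^ K"
      using poly_rapidD[OF g] by meson
    have "jbracket y ^ M * norm (f (x, y) * g (x, y)) \<le> C * D * jbracket x ^ (N + K)" for x y
    proof -
      have "norm (f (x, y)) \<le> C * (jbracket x * jbracket y) ^ N"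
        by (rule order_trans[OF C(2)]) (intro mult_left_mono power_mono jbracket_Pair_le C(1); simp)
      then have "jbracket y ^ M * norm (f (x, y) * g (x, y))
          \<le> jbracket y ^ M * (C * (jbracket x * jbracket y) ^ N * norm (g (x, y)))"
        by (simp add: norm_mult mult_mono mult_right_mono)
      also have "\<dots> = C * jbracket x ^ N * (jbracket y ^ (M + N) * norm (g (x, y)))"
        by (simp add: power_add power_mult_distrib)
      also have "\<dots> \<le> C * jbracket x ^ N * (D * jbracket x ^ K)"
        using D C(1) by (intro mult_left_mono) auto
      finally show ?thesis by (simp add: power_add ac_simps)
    qed
    then show "\<exists>C K. \<forall>x y. jbracket y ^ M * norm (f (x, y) * g (x, y)) \<le> C * jbracket x ^ K" by blast
  qed
qed

lemma slow_affine:
  fixes A :: "'a::euclidean_space \<Rightarrow> 'b::euclidean_space"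
  assumes "f \<in> slow" "linear A" shows "(\<lambda>x. f (A x + c)) \<in> slow"
  unfolding slow_def
proof (rule derivs_in_affine[OF lin_closed_poly_bdd _ assms(2)])
  show "f \<in> derivs_in poly_bdd" using assms(1) by (simp add: slow_def)
  fix g :: "'b \<Rightarrow> complex" assume "g \<in> poly_bdd"
  then obtain C N where C: "C \<ge> 0" "\<And>x. norm (g x) \<le> C * jbracket x ^ N" using poly_bddD by blast
  obtain K where K: "\<And>x. jbracket (A x + c) \<le> K * jbracket x" using jbracket_affine[OF assms(2)] by meson
  have "norm (g (A x + c)) \<le> C * K ^ N * jbracket x ^ N" for x
    using order_trans[OF C(2)[of "A x + c"] mult_left_mono[OF power_mono[OF K[of x] jbracket_nonneg, of N] C(1)]]
    by (simp add: power_mult_distrib)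
  then show "(\<lambda>x. g (A x + c)) \<in> poly_bdd"
    unfolding poly_bdd_def by blast
qed

text \<open>The hypothesis on \<open>K\<close> says that for fixed \<open>x\<close> the affine map
  tends to infinity at least linearly in \<open>y\<close>. It covers kernels such as
  \<open>g (x + y)\<close>, which decay in \<open>y\<close> but not jointly in
  \<open>(x, y)\<close>.\<close>

lemma schwartz_affine_poly_rapid:
  fixes A :: "'a::euclidean_space \<times> 'b::euclidean_space \<Rightarrow> 'c::euclidean_space"
  assumes "f \<in> schwartz" "linear A"
    and K: "\<And>x y. jbracket y \<le> K * jbracket x ^ k * jbracket (A (x, y) + c)"
  shows "(\<lambda>z. f (A z + c)) \<in> derivs_in poly_rapid"
proof (rule derivs_in_affine[OF lin_closed_poly_rapid _ assms(2)])
  show "f \<in> derivs_in rapid" using assms(1) by (simp add: schwartz_eq)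
  fix g :: "'c \<Rightarrow> complex" assume g: "g \<in> rapid"
  show "(\<lambda>z. g (A z + c)) \<in> poly_rapid"
    unfolding poly_rapid_def mem_Collect_eq
  proof
    fix M
    obtain D where D: "\<And>x. jbracket x ^ M * norm (g x) \<le> D" using rapidD[OF g] by meson
    \<comment> \<open>The sign of \<open>K\<close> follows from the hypothesis itself, whose left
      side is positive at the origin.\<close>
    have "K * jbracket (0::'a) ^ k * jbracket (A (0, 0) + c) > 0"
      using K[of 0 0] jbracket_pos less_le_trans by blast
    then have "K \<ge> 0" by (auto simp: zero_less_mult_iff)
    have "jbracket y ^ M * norm (g (A (x, y) + c)) \<le> K ^ M * D * jbracket x ^ (k * M)" for x y
    proof -
      have "jbracket y ^ M * norm (g (A (x, y) + c)) \<le> (K * jbracket x ^ k * jbracket (A (x, y) + c)) ^ M * norm (g (A (x, y) + c))"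
        by (intro mult_right_mono power_mono K) auto
      also have "\<dots> = K ^ M * jbracket x ^ (k * M) * (jbracket (A (x, y) + c) ^ M * norm (g (A (x, y) + c)))"
        by (simp add: power_mult_distrib power_mult)
      also have "\<dots> \<le> K ^ M * jbracket x ^ (k * M) * D"
        using D \<open>K \<ge> 0\<close> by (intro mult_left_mono) auto
      finally show ?thesis by (simp add: ac_simps)
    qed
    then show "\<exists>C N. \<forall>x y. jbracket y ^ M * norm (g (A (x, y) + c)) \<le> C * jbracket x ^ N" by blast
  qed
qed

text \<open>The lower bound turns decay in \<open>A x + c\<close> into decay in \<open>x\<close>.
  For an invertible \<open>A\<close> it comes from the boundedness of the inverse, through
  \<open>jbracket_affine\<close>.\<close>

lemma schwartz_affine:
  fixes A :: "'a::euclidean_space \<Rightarrow> 'b::euclidean_space"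
  assumes "f \<in> schwartz" "linear A" and K: "\<And>x. jbracket x \<le> K * jbracket (A x + c)"
  shows "(\<lambda>x. f (A x + c)) \<in> schwartz"
  unfolding schwartz_eq
proof (rule derivs_in_affine[OF lin_closed_rapid _ assms(2)])
  show "f \<in> derivs_in rapid" using assms(1) by (simp add: schwartz_eq)
  fix g :: "'b \<Rightarrow> complex" assume g: "g \<in> rapid"
  show "(\<lambda>z. g (A z + c)) \<in> rapid"
    unfolding rapid_def mem_Collect_eq
  proof
    fix M
    obtain D where D: "\<And>x. jbracket x ^ M * norm (g x) \<le> D" using rapidD[OF g] by meson
    have "K * jbracket (A 0 + c) > 0" using K[of 0] jbracket_pos less_le_trans by blast
    then have "K \<ge> 0" by (auto simp: zero_less_mult_iff)
    have "jbracket x ^ M * norm (g (A x + c)) \<le> K ^ M * D" for x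
    proof -
      have "jbracket x ^ M * norm (g (A x + c)) \<le> (K * jbracket (A x + c)) ^ M * norm (g (A x + c))"
        by (intro mult_right_mono power_mono K) auto
      also have "\<dots> = K ^ M * (jbracket (A x + c) ^ M * norm (g (A x + c)))"
        by (simp add: power_mult_distrib)
      also have "\<dots> \<le> K ^ M * D"
        using D \<open>K \<ge> 0\<close> by (intro mult_left_mono) auto
      finally show ?thesis .
    qed
    then show "\<exists>C. \<forall>x. jbracket x ^ M * norm (g (A x + c)) \<le> C" by blast
  qed
qed

lemma schwartz_translate:
  assumes "f \<in> schwartz" shows "(\<lambda>x. f (x + c)) \<in> schwartz"
proof (rule schwartz_affine[OF assms, where A="\<lambda>x. x"])
  show "jbracket x \<le> (2 * jbracket c) * jbracket (x + c)" for x
    using jbracket_diff[of "x + c" c] by (simp add: ac_simps)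
qed (auto intro: linearI)

lemma schwartz_subset_poly_rapid: "schwartz \<subseteq> derivs_in poly_rapid"
  using schwartz_affine_poly_rapid[where A="\<lambda>x. x" and c=0 and K=1 and k=0]
  by (auto simp: jbracket_snd_le intro: linearI)

lemma schwartz_in_poly_rapid: "f \<in> schwartz \<Longrightarrow> f \<in> derivs_in poly_rapid"
  using schwartz_subset_poly_rapid by blast

lemma poly_rapid_section:
  assumes "f \<in> derivs_in poly_rapid" shows "(\<lambda>y. f (x, y)) \<in> schwartz"
proof -
  have "(\<lambda>y. f ((0, y) + (x, 0))) \<in> derivs_in rapid"
  proof (rule derivs_in_affine[OF lin_closed_rapid assms])
    fix g :: "'a \<times> 'b \<Rightarrow> complex" assume "g \<in> poly_rapid"
    then show "(\<lambda>y. g ((0, y) + (x, 0))) \<in> rapid"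
      unfolding rapid_def poly_rapid_def by simp metis
  qed (auto intro: linearI)
  then show ?thesis by (simp add: schwartz_eq)
qed

lemma schwartz_section: "f \<in> schwartz \<Longrightarrow> (\<lambda>y. f (x, y)) \<in> schwartz"
  by (intro poly_rapid_section schwartz_in_poly_rapid)

lemma partials_section:
  assumes "smooth f" "bs \<in> lists Basis"
  shows "partials bs (\<lambda>y. f (x, y)) = (\<lambda>y. partials (map (Pair 0) bs) f (x, y))"
  using assms(2)
proof (induction bs)
  case (Cons b bs)
  have sm: "smooth (partials (map (Pair 0) bs) f)"
    using Cons.hyps assms(1) by (intro smooth_partials) (auto simp: Basis_prod_def in_lists_conv_set)
  have "partial1 b (\<lambda>y. partials (map (Pair 0) bs) f (x, y)) = (\<lambda>y. partial1 (0, b) (partials (map (Pair 0) bs) f) (x, y))"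
    by (auto simp: partial1_def fun_eq_iff)
  then show ?case using Cons by (simp add: partials_Cons)
qed simp

subsection \<open>Polynomials and exponentials\<close>

lemma slow_coordinate: "(\<lambda>x. of_real (x \<bullet> a)) \<in> slow"
proof -
  have "(\<lambda>x. of_real (x \<bullet> a)) \<in> derivs_in poly_bdd"
  proof (rule derivs_in_coinduct[where X="insert (\<lambda>x. of_real (x \<bullet> a)) (range (\<lambda>c x. c))"])
    have d: "((\<lambda>x::'a. of_real (x \<bullet> a) :: complex) has_derivative (\<lambda>h. of_real (h \<bullet> a))) (at x)" for x
      by (auto intro!: derivative_eq_intros)
    fix g :: "'a \<Rightarrow> complex" assume "g \<in> insert (\<lambda>x. of_real (x \<bullet> a)) (range (\<lambda>c x. c))"
    then consider "g = (\<lambda>x. of_real (x \<bullet> a))" | c where "g = (\<lambda>x. c)" by auto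
    note g = this
    show "g \<in> poly_bdd"
      using g
    proof cases
      case 1
      have "norm (of_real (x \<bullet> a) :: complex) \<le> norm a * jbracket x ^ 1" for x
        using Cauchy_Schwarz_ineq2[of x a] mult_left_mono[OF norm_le_jbracket[of x] norm_ge_zero[of a]]
        by (simp add: mult.commute)
      then show ?thesis unfolding 1 poly_bdd_def by blast
    next
      case 2
      then show ?thesis using derivs_inD[OF slow_const[unfolded slow_def]] by auto
    qed
    show "g differentiable (at x)" for x
      using g d by cases (auto simp: differentiable_def)
    show "partial1 b g \<in> insert (\<lambda>x. of_real (x \<bullet> a)) (range (\<lambda>c x. c))" for b
      using g
    proof cases
      case 1
      have "partial1 b g = (\<lambda>x. of_real (b \<bullet> a))" unfolding 1 using partial1_eq[OF d] by blast
      then show ?thesis by blast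
    next
      case 2
      then show ?thesis by (auto simp: partial1_const)
    qed
  qed simp
  then show ?thesis by (simp add: slow_def)
qed

lemma slow_linear_coordinate:
  fixes A :: "'a::euclidean_space \<Rightarrow> 'b::euclidean_space"
  assumes "linear A" shows "(\<lambda>x. of_real (A x \<bullet> b)) \<in> slow"
proof -
  have "(\<lambda>x. of_real ((A x + 0) \<bullet> b)) \<in> slow"
    by (rule slow_affine[where f="\<lambda>y. of_real (y \<bullet> b)"]) (rule slow_coordinate assms)+
  then show ?thesis by simp
qed

lemma slow_inner:
  fixes F G :: "'a::euclidean_space \<Rightarrow> 'b::euclidean_space"
  assumes "\<And>b. b \<in> Basis \<Longrightarrow> (\<lambda>x. of_real (F x \<bullet> b)) \<in> slow" "\<And>b. b \<in> Basis \<Longrightarrow> (\<lambda>x. of_real (G x \<bullet> b)) \<in> slow"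
  shows "(\<lambda>x. of_real (F x \<bullet> G x)) \<in> slow"
proof -
  have *: "of_real (F x \<bullet> G x) = (\<Sum>b\<in>Basis. of_real (F x \<bullet> b) * of_real (G x \<bullet> b) :: complex)" for x
    by (subst euclidean_inner) simp
  show ?thesis
    unfolding * by (intro slow_sum slow_mult assms)
qed

lemma slow_inner_linear:
  fixes A :: "'a::euclidean_space \<Rightarrow> 'b::euclidean_space"
  assumes "linear A" "linear B" shows "(\<lambda>x. of_real (A x \<bullet> B x)) \<in> slow"
  by (rule slow_inner; rule slow_linear_coordinate; rule assms)

text \<open>Even powers are polynomials in the coordinates, and the weight in
  \<open>tempered_integral\<close> has an even exponent for this reason.\<close>

lemma slow_jbracket_even: "(\<lambda>x. of_real (jbracket x ^ (2 * k))) \<in> slow"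
proof -
  have "(\<lambda>x. (of_real 1 + of_real (x \<bullet> x)) ^ k) \<in> slow"
    by (intro slow_power slow_add slow_const slow_inner_linear linearI) auto
  then show ?thesis by (simp add: power_mult jbracket_square power2_norm_eq_inner)
qed

text \<open>The functions \<open>p x * cis (\<theta> x)\<close> with \<open>p\<close> slow form a
  class stable under differentiation, and the unimodular factor leaves their bounds unchanged. Slow
  growth is the right setting because quadratic phases have unbounded derivatives.\<close>

lemma slow_cis:
  assumes "(\<lambda>x. of_real (\<theta> x)) \<in> slow"
  shows "(\<lambda>x. cis (\<theta> x)) \<in> slow"
    and "partial1 b (\<lambda>x. cis (\<theta> x)) = (\<lambda>x. \<i> * partial1 b (\<lambda>x. of_real (\<theta> x)) x * cis (\<theta> x))"
proof -
  let ?g = "\<lambda>x. complex_of_real (\<theta> x)"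
  have g: "?g differentiable (at x)" for x using assms slow_smooth smooth_differentiable by blast
  have d: "((\<lambda>x. cis (\<theta> x)) has_derivative (\<lambda>h. cis (\<theta> x) * (\<i> * frechet_derivative ?g (at x) h))) (at x)" for x
  proof -
    have "((\<lambda>x. exp (\<i> * ?g x)) has_derivative (\<lambda>h. exp (\<i> * ?g x) * (\<i> * frechet_derivative ?g (at x) h))) (at x)"
      by (rule has_derivative_compose[where f="\<lambda>x. \<i> * ?g x" and g=exp])
         (use g in \<open>auto intro!: has_derivative_mult_right has_field_derivative_imp_has_derivative DERIV_exp simp: frechet_derivative_works\<close>)
    then show ?thesis by (simp add: cis_conv_exp)
  qed
  have p: "partial1 b (\<lambda>x. cis (\<theta> x)) = (\<lambda>x. \<i> * partial1 b ?g x * cis (\<theta> x))" for b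
  proof
    fix x
    have "partial1 b ?g x = frechet_derivative ?g (at x) b"
      using g[of x] by (intro partial1_eq) (simp add: frechet_derivative_works)
    then show "partial1 b (\<lambda>x. cis (\<theta> x)) x = \<i> * partial1 b ?g x * cis (\<theta> x)"
      by (simp add: partial1_eq[OF d])
  qed
  then show "partial1 b (\<lambda>x. cis (\<theta> x)) = (\<lambda>x. \<i> * partial1 b ?g x * cis (\<theta> x))" .
  have "(\<lambda>x. 1 * cis (\<theta> x)) \<in> derivs_in poly_bdd"
  proof (rule derivs_in_coinduct[where X="{\<lambda>x. p x * cis (\<theta> x) | p. p \<in> slow}"])
    fix h assume "h \<in> {\<lambda>x. p x * cis (\<theta> x) | p. p \<in> slow}"
    then obtain q where q: "h = (\<lambda>x. q x * cis (\<theta> x))" "q \<in> slow" by blast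
    have dq: "q differentiable (at x)" for x using q(2) slow_smooth smooth_differentiable by blast
    have dc: "(\<lambda>x. cis (\<theta> x)) differentiable (at x)" for x using d by (auto simp: differentiable_def)
    show "h \<in> poly_bdd"
      using derivs_inD[OF q(2)[unfolded slow_def]] by (simp add: q(1) poly_bdd_def norm_mult)
    show "h differentiable (at x)" for x
      unfolding q(1) using dq dc by (intro differentiable_mult)
    fix b :: 'a assume b: "b \<in> Basis"
    have "partial1 b h = (\<lambda>x. (partial1 b q x + \<i> * (q x * partial1 b ?g x)) * cis (\<theta> x))"
      unfolding q(1) partial1_mult[OF dq dc] p by (simp add: algebra_simps)
    moreover have "(\<lambda>x. partial1 b q x + \<i> * (q x * partial1 b ?g x)) \<in> slow"
      by (intro slow_add slow_cmult slow_mult slow_partial1 q assms b)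
    ultimately show "partial1 b h \<in> {\<lambda>x. p x * cis (\<theta> x) | p. p \<in> slow}"
      unfolding mem_Collect_eq by (intro exI conjI)
  qed (use slow_const[of 1] in \<open>unfold mem_Collect_eq, intro exI conjI, auto\<close>)
  then show "(\<lambda>x. cis (\<theta> x)) \<in> slow" by (simp add: slow_def)
qed

lemma slow_cis_inner_linear:
  fixes A :: "'a::euclidean_space \<Rightarrow> 'b::euclidean_space"
  assumes "linear A" "linear B" shows "(\<lambda>x. cis (r * (A x \<bullet> B x))) \<in> slow"
  using slow_cmult[OF slow_inner_linear[OF assms], of "of_real r"] by (intro slow_cis) simp

lemma slow_cis_inner: "(\<lambda>x. cis (r * (x \<bullet> a))) \<in> slow"
  using slow_cmult[OF slow_coordinate, of "of_real r" a] by (intro slow_cis) simp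

lemma partial1_cis_inner:
  "partial1 b (\<lambda>x. cis (r * (x \<bullet> a))) = (\<lambda>x. \<i> * of_real (r * (b \<bullet> a)) * cis (r * (x \<bullet> a)))"
proof -
  have "partial1 b (\<lambda>x. of_real (r * (x \<bullet> a))) = (\<lambda>x. of_real (r * (b \<bullet> a)))"
    by (rule ext, rule partial1_eq) (auto intro!: derivative_eq_intros)
  moreover have "(\<lambda>x. of_real (r * (x \<bullet> a))) \<in> slow"
    using slow_cmult[OF slow_coordinate, of "of_real r" a] by simp
  ultimately show ?thesis using slow_cis(2) by metis
qed

subsection \<open>Seminorms\<close>

lemma finite_multiindices: "finite {bs \<in> lists (Basis :: 'a::euclidean_space set). length bs \<le> N}"
  using finite_lists_length_le[of "Basis :: 'a set" N]
  by (simp add: lists_eq_set)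

text \<open>\<open>schwartz_norm\<close> is a supremum of reals, which bounds its elements only once
  they are known to be bounded above. Finitely many derivatives have order at most \<open>N\<close>,
  and the sum of their individual bounds serves.\<close>

lemma schwartz_norm_upper:
  assumes "\<phi> \<in> schwartz" "bs \<in> lists Basis" "length bs \<le> N"
  shows "jbracket x ^ N * norm (partials bs \<phi> x) \<le> schwartz_norm N \<phi>"
proof -
  let ?L = "{bs \<in> lists (Basis :: 'a set). length bs \<le> N}"
  have "\<forall>bs\<in>?L. \<exists>C. C \<ge> 0 \<and> (\<forall>x. jbracket x ^ N * norm (partials bs \<phi> x) \<le> C)"
  proof
    fix bs assume "bs \<in> ?L"
    then have "partials bs \<phi> \<in> rapid"
      using assms(1) by (simp add: schwartz_eq derivs_in_def)
    from rapidD[OF this, of N]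
    show "\<exists>C. C \<ge> 0 \<and> (\<forall>x. jbracket x ^ N * norm (partials bs \<phi> x) \<le> C)" .
  qed
  from bchoice[OF this] obtain C where C: "\<And>bs. bs \<in> ?L \<Longrightarrow> C bs \<ge> 0"
      "\<And>bs x. bs \<in> ?L \<Longrightarrow> jbracket x ^ N * norm (partials bs \<phi> x) \<le> C bs"
    by blast
  have "bdd_above ((\<lambda>(bs, x). jbracket x ^ N * norm (partials bs \<phi> x)) ` (?L \<times> UNIV))"
  proof (rule bdd_aboveI2)
    fix i assume "i \<in> ?L \<times> (UNIV::'a set)"
    then obtain bs x where i: "i = (bs, x)" and bs: "bs \<in> ?L" by blast
    have "C bs \<le> sum C ?L"
      using C(1) by (intro member_le_sum finite_multiindices bs) blast
    then show "(\<lambda>(bs, x). jbracket x ^ N * norm (partials bs \<phi> x)) i \<le> sum C ?L"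
      using C(2)[OF bs, of x] by (simp add: i)
  qed
  then have "(\<lambda>(bs, x). jbracket x ^ N * norm (partials bs \<phi> x)) (bs, x)
      \<le> (SUP i \<in> ?L \<times> UNIV. (\<lambda>(bs, x). jbracket x ^ N * norm (partials bs \<phi> x)) i)"
    by (rule cSUP_upper[rotated]) (use assms in auto)
  then show ?thesis
    by (simp add: schwartz_norm_def)
qed

lemma schwartz_norm_least:
  fixes \<phi> :: "'a::euclidean_space \<Rightarrow> complex"
  assumes "\<And>bs x. bs \<in> lists Basis \<Longrightarrow> length bs \<le> N \<Longrightarrow> jbracket x ^ N * norm (partials bs \<phi> x) \<le> B"
  shows "schwartz_norm N \<phi> \<le> B"
  unfolding schwartz_norm_def
proof (rule cSUP_least)
  show "{bs \<in> lists (Basis::'a set). length bs \<le> N} \<times> (UNIV::'a set) \<noteq> {}"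
    by (auto intro: exI[of _ "[]"])
qed (use assms in auto)

lemma schwartz_norm_nonneg:
  fixes \<phi> :: "'a::euclidean_space \<Rightarrow> complex"
  assumes "\<phi> \<in> schwartz" shows "0 \<le> schwartz_norm N \<phi>"
proof (rule order_trans)
  show "0 \<le> jbracket (0 :: 'a) ^ N * norm (partials [] \<phi> 0)" by simp
  show "jbracket (0 :: 'a) ^ N * norm (partials [] \<phi> 0) \<le> schwartz_norm N \<phi>"
    by (rule schwartz_norm_upper) (use assms in auto)
qed

lemma schwartz_norm_bound:
  assumes "\<phi> \<in> schwartz" "bs \<in> lists Basis" "length bs \<le> N" "M \<le> N"
  shows "jbracket x ^ M * norm (partials bs \<phi> x) \<le> schwartz_norm N \<phi>"
  using order_trans[OF mult_right_mono[OF jbracket_power_mono[OF assms(4)] norm_ge_zero] schwartz_norm_upper[OF assms(1-3)]] .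

lemma schwartz_norm_mono:
  assumes "\<phi> \<in> schwartz" "M \<le> N" shows "schwartz_norm M \<phi> \<le> schwartz_norm N \<phi>"
  using assms by (intro schwartz_norm_least schwartz_norm_bound) auto

text \<open>Constants and degrees may depend on the derivative \<open>bs\<close>. Only finitely many
  derivatives enter the seminorm, so sums of constants and of degrees work for all of them,
  \<open>1 \<le> w i\<close> permitting a higher degree. The factor \<open>q\<close> stands outside
  this process and keeps an exact dependence on the index, such as the square of an increment or a
  fixed power of a bracket.\<close>

lemma schwartz_norm_family:
  fixes k :: "'i \<Rightarrow> 'a::euclidean_space \<Rightarrow> complex"
  assumes k: "\<And>bs. bs \<in> lists Basis \<Longrightarrow>
      \<exists>C m. \<forall>i\<in>I. \<forall>y. jbracket y ^ N * norm (partials bs (k i) y) \<le> C * w i ^ m * q i"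
    and w: "\<And>i. i \<in> I \<Longrightarrow> 1 \<le> w i" and q: "\<And>i. i \<in> I \<Longrightarrow> 0 \<le> q i"
  shows "\<exists>C\<ge>0. \<exists>m::nat. \<forall>i\<in>I. schwartz_norm N (k i) \<le> C * w i ^ m * q i"
proof -
  let ?L = "{bs \<in> lists (Basis :: 'a set). length bs \<le> N}"
  obtain C and m :: "'a list \<Rightarrow> nat" where C: "\<And>bs i y. bs \<in> lists Basis \<Longrightarrow> i \<in> I \<Longrightarrow>
      jbracket y ^ N * norm (partials bs (k i) y) \<le> C bs * w i ^ m bs * q i"
    using k by metis
  let ?C = "\<Sum>bs\<in>?L. \<bar>C bs\<bar>" and ?m = "\<Sum>bs\<in>?L. m bs"
  have "schwartz_norm N (k i) \<le> ?C * w i ^ ?m * q i" if i: "i \<in> I" for i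
  proof (rule schwartz_norm_least)
    fix bs y assume bs: "bs \<in> lists (Basis::'a set)" "length bs \<le> N"
    have "C bs \<le> ?C" "m bs \<le> ?m"
      using bs finite_multiindices[where 'a='a, of N]
        member_le_sum[of bs ?L "\<lambda>bs. \<bar>C bs\<bar>"] member_le_sum[of bs ?L m] by simp_all
    then have "C bs * w i ^ m bs * q i \<le> ?C * w i ^ ?m * q i"
      using w[OF i] q[OF i] by (intro mult_right_mono mult_mono power_increasing) (auto intro!: sum_nonneg)
    then show "jbracket y ^ N * norm (partials bs (k i) y) \<le> ?C * w i ^ ?m * q i"
      using C[OF bs(1) i] by (rule order_trans[rotated])
  qed
  moreover have "?C \<ge> 0" by (intro sum_nonneg) auto
  ultimately show ?thesis by blast
qed

section \<open>Tempered distributions\<close>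

lemma temperedD:
  assumes "u \<in> tempered"
  shows "\<And>\<phi> \<psi>. \<phi> \<in> schwartz \<Longrightarrow> \<psi> \<in> schwartz \<Longrightarrow> u (\<lambda>x. \<phi> x + \<psi> x) = u \<phi> + u \<psi>"
    and "\<And>\<phi> c. \<phi> \<in> schwartz \<Longrightarrow> u (\<lambda>x. c * \<phi> x) = c * u \<phi>"
    and "\<exists>C\<ge>0. \<exists>N. \<forall>\<phi>\<in>schwartz. norm (u \<phi>) \<le> C * schwartz_norm N \<phi>"
proof -
  obtain C N where C: "\<forall>\<phi>\<in>schwartz. norm (u \<phi>) \<le> C * schwartz_norm N \<phi>"
    using assms by (auto simp: tempered_def)
  have "norm (u \<phi>) \<le> \<bar>C\<bar> * schwartz_norm N \<phi>" if "\<phi> \<in> schwartz" for \<phi>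
    using C[rule_format, OF that] mult_right_mono[OF abs_ge_self schwartz_norm_nonneg[OF that], of C N]
    by linarith
  then show "\<exists>C\<ge>0. \<exists>N. \<forall>\<phi>\<in>schwartz. norm (u \<phi>) \<le> C * schwartz_norm N \<phi>"
    by (meson abs_ge_zero)
qed (use assms in \<open>auto simp: tempered_def\<close>)

lemma schwartz_zero: "(\<lambda>x. 0) \<in> schwartz"
  using lin_closed_rapid by (auto simp: schwartz_eq lin_closed_def intro!: derivs_in_const)

lemma tempered_zero: "u \<in> tempered \<Longrightarrow> u (\<lambda>x. 0) = 0"
  using temperedD(2)[OF _ schwartz_zero, of u 0] by simp

lemma tempered_sum:
  assumes u: "u \<in> tempered" and "\<And>i. i \<in> I \<Longrightarrow> \<phi> i \<in> schwartz"
  shows "u (\<lambda>x. \<Sum>i\<in>I. c i * \<phi> i x) = (\<Sum>i\<in>I. c i * u (\<phi> i))"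
  using assms(2)
proof (induction I rule: infinite_finite_induct)
  case (insert i I)
  then show ?case
    by (simp add: temperedD(1,2)[OF u] schwartz_cmult schwartz_sum)
qed (simp_all add: tempered_zero[OF u])

lemma tempered_diff:
  assumes u: "u \<in> tempered" and "\<phi> \<in> schwartz" "\<psi> \<in> schwartz"
  shows "u (\<lambda>x. \<phi> x - \<psi> x) = u \<phi> - u \<psi>"
  using temperedD(1)[OF u assms(2) schwartz_cmult[OF assms(3), of "-1"]] temperedD(2)[OF u assms(3), of "-1"]
  by simp

text \<open>Where \<open>k <= norm x <= k + 1\<close> the integrand is at most
  \<open>(2 / (k + 1)) ^ M\<close>, and the ball of radius \<open>k + 1\<close> has volume
  proportional to \<open>(k + 1) ^ DIM('a)\<close>. The two exponents in excess of the dimension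
  leave the convergent series of inverse squares.\<close>

lemma integrable_jbracket:
  assumes "DIM('a) + 2 \<le> M"
  shows "integrable lborel (\<lambda>x::'a::euclidean_space. 1 / jbracket x ^ M)"
proof (rule integrableI_nonneg)
  have cont: "continuous_on UNIV (\<lambda>x::'a. 1 / jbracket x ^ M)"
    using jbracket_nonzero unfolding jbracket_def by (intro continuous_intros) auto
  show meas: "(\<lambda>x::'a. 1 / jbracket x ^ M) \<in> borel_measurable lborel"
    using borel_measurable_continuous_onI[OF cont] by simp
  define c where "c k = 2 ^ M * unit_ball_vol (DIM('a)) * (1 / (real (Suc k))\<^sup>2)" for k
  define g where "g k x = ennreal (2 ^ M / real (Suc k) ^ M) * indicator (cball (0::'a) (real (Suc k))) x" for k x
  have "ennreal (1 / jbracket x ^ M) \<le> (\<Sum>k. g k x)" for x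
  proof -
    define k where "k = nat \<lfloor>norm x\<rfloor>"
    have k: "real k \<le> norm x" "norm x \<le> real (Suc k)" by (auto simp: k_def) linarith
    \<comment> \<open>The left side is the average of \<open>k\<close> and \<open>1\<close>, both at
      most \<open>jbracket x\<close>.\<close>
    have "real (Suc k) / 2 \<le> jbracket x"
      using k(1) norm_le_jbracket[of x] jbracket_ge_1[of x] by simp
    then have "(real (Suc k) / 2) ^ M \<le> jbracket x ^ M" by (intro power_mono) auto
    then have "1 / jbracket x ^ M \<le> 1 / (real (Suc k) / 2) ^ M"
      by (intro divide_left_mono) auto
    then have "1 / jbracket x ^ M \<le> 2 ^ M / real (Suc k) ^ M" by (simp only: power_divide divide_divide_eq_right mult_1)
    then have "ennreal (1 / jbracket x ^ M) \<le> g k x"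
      using k(2) by (auto simp: g_def intro!: ennreal_leI)
    also have "\<dots> \<le> (\<Sum>k. g k x)" using sum_le_suminf[of "\<lambda>k. g k x" "{k}"] by simp
    finally show ?thesis .
  qed
  then have "(\<integral>\<^sup>+x. ennreal (1 / jbracket x ^ M) \<partial>(lborel :: 'a measure)) \<le> (\<integral>\<^sup>+x. (\<Sum>k. g k x) \<partial>(lborel :: 'a measure))"
    by (intro nn_integral_mono)
  also have "\<dots> = (\<Sum>k. \<integral>\<^sup>+x. g k x \<partial>lborel)"
    unfolding g_def by (rule nn_integral_suminf) (intro borel_measurable_times_ennreal borel_measurable_const borel_measurable_indicator, simp)
  also have "\<dots> \<le> (\<Sum>k. ennreal (c k))"
  proof (intro suminf_le summableI)
    fix k
    have "(\<integral>\<^sup>+x. g k x \<partial>lborel) = ennreal (2 ^ M / real (Suc k) ^ M) * ennreal (unit_ball_vol DIM('a) * real (Suc k) ^ DIM('a))"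
      unfolding g_def by (subst nn_integral_cmult_indicator) (auto simp: emeasure_cball)
    also have "\<dots> = ennreal (2 ^ M * unit_ball_vol DIM('a) * (real (Suc k) ^ DIM('a) / real (Suc k) ^ M))"
      by (subst ennreal_mult'[symmetric]) (auto simp: ac_simps)
    also have "\<dots> \<le> ennreal (c k)"
    proof (intro ennreal_leI)
      have "real (Suc k) ^ DIM('a) * (real (Suc k))\<^sup>2 \<le> real (Suc k) ^ M"
        using assms by (subst power_add[symmetric], intro power_increasing) auto
      then have "real (Suc k) ^ DIM('a) / real (Suc k) ^ M \<le> 1 / (real (Suc k))\<^sup>2"
        by (simp add: field_simps)
      then show "2 ^ M * unit_ball_vol DIM('a) * (real (Suc k) ^ DIM('a) / real (Suc k) ^ M) \<le> c k"
        unfolding c_def by (intro mult_left_mono) auto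
    qed
    finally show "(\<integral>\<^sup>+x. g k x \<partial>lborel) \<le> ennreal (c k)" .
  qed
  also have "\<dots> < \<infinity>"
  proof -
    have "summable (\<lambda>k. 1 / (real (Suc k))\<^sup>2)"
      using inverse_squares_sums by (simp add: sums_iff add.commute)
    then have "summable c" unfolding c_def by (rule summable_mult)
    moreover have "c k \<ge> 0" for k by (simp add: c_def)
    ultimately show ?thesis by (simp add: ennreal_suminf_neq_top less_top)
  qed
  finally show "(\<integral>\<^sup>+x. ennreal (1 / jbracket x ^ M) \<partial>(lborel :: 'a measure)) < \<infinity>" .
qed auto

text \<open>Of the \<open>N + DIM('a) + 2\<close> powers in the seminorm, \<open>N\<close> cancel
  the growth of \<open>g\<close> and the others leave an integrable weight. The constant is
  independent of \<open>\<phi>\<close>, which is the continuity of the distribution given by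
  \<open>g\<close>.\<close>

lemma
  fixes g :: "'a::euclidean_space \<Rightarrow> complex"
  assumes g: "g \<in> borel_measurable borel" and C: "C \<ge> 0" "\<And>x. norm (g x) \<le> C * jbracket x ^ N"
    and \<phi>: "\<phi> \<in> schwartz"
  shows poly_times_schwartz_integrable: "integrable lborel (\<lambda>x. g x * \<phi> x)"
    and poly_times_schwartz_bound: "norm (\<integral>x. g x * \<phi> x \<partial>lborel)
      \<le> C * (\<integral>x. 1 / jbracket x ^ (DIM('a) + 2) \<partial>(lborel :: 'a measure)) * schwartz_norm (N + DIM('a) + 2) \<phi>"
proof -
  let ?M = "DIM('a) + 2" and ?s = "schwartz_norm (N + DIM('a) + 2) \<phi>"
  have le: "norm (g x * \<phi> x) \<le> C * ?s * (1 / jbracket x ^ ?M)" for x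
  proof -
    have "jbracket x ^ (N + DIM('a) + 2) * norm (partials [] \<phi> x) \<le> ?s"
      by (rule schwartz_norm_upper[OF \<phi>]) auto
    then have s: "jbracket x ^ N * norm (\<phi> x) \<le> ?s * (1 / jbracket x ^ ?M)"
      by (simp add: power_add field_simps)
    have "norm (g x * \<phi> x) \<le> C * jbracket x ^ N * norm (\<phi> x)"
      by (simp add: norm_mult mult_right_mono C)
    also have "\<dots> \<le> C * (?s * (1 / jbracket x ^ ?M))"
      using mult_left_mono[OF s C(1)] by (simp add: mult.assoc)
    finally show ?thesis by (simp add: mult.assoc)
  qed
  have int: "integrable lborel (\<lambda>x::'a. C * ?s * (1 / jbracket x ^ ?M))"
    by (intro integrable_mult_right integrable_jbracket) simp
  have [measurable]: "\<phi> \<in> borel_measurable borel" "g \<in> borel_measurable borel"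
    using g \<phi> by (auto intro: smooth_borel_measurable schwartz_smooth)
  show *: "integrable lborel (\<lambda>x. g x * \<phi> x)"
    by (rule Bochner_Integration.integrable_bound[OF int])
       (measurable, rule AE_I2, rule order_trans[OF le], simp only: real_norm_def abs_ge_self)
  have "norm (\<integral>x. g x * \<phi> x \<partial>lborel) \<le> (\<integral>x. norm (g x * \<phi> x) \<partial>lborel)"
    by (rule integral_norm_bound)
  also have "\<dots> \<le> (\<integral>x. C * ?s * (1 / jbracket x ^ ?M) \<partial>(lborel :: 'a measure))"
    by (rule integral_mono) (use * int le in auto)
  also have "\<dots> = C * ?s * (\<integral>x. 1 / jbracket x ^ ?M \<partial>(lborel :: 'a measure))" by (rule integral_mult_right_zero)
  finally show "norm (\<integral>x. g x * \<phi> x \<partial>lborel)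
      \<le> C * (\<integral>x. 1 / jbracket x ^ ?M \<partial>(lborel :: 'a measure)) * ?s"
    by (simp only: ac_simps)
qed

lemma schwartz_integrable: "\<phi> \<in> schwartz \<Longrightarrow> integrable lborel \<phi>"
  using poly_times_schwartz_integrable[of "\<lambda>x. 1" 1 0 \<phi>] by simp

lemma distribution_of_tempered:
  assumes "g \<in> borel_measurable borel" "g \<in> poly_bdd"
  shows "distribution_of g \<in> tempered"
proof -
  obtain C N where C: "C \<ge> 0" "\<And>x. norm (g x) \<le> C * jbracket x ^ N" using poly_bddD[OF assms(2)] by blast
  note int = poly_times_schwartz_integrable[OF assms(1) C]
  show ?thesis
    unfolding tempered_def mem_Collect_eq
  proof (intro conjI ballI allI)
    show "distribution_of g \<in> extensional schwartz" by (simp add: distribution_of_def)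
    show "\<exists>C N. \<forall>\<phi>\<in>schwartz. norm (distribution_of g \<phi>) \<le> C * schwartz_norm N \<phi>"
      using poly_times_schwartz_bound[OF assms(1) C] by (auto simp: distribution_of_def)
  qed (auto simp: distribution_of_def schwartz_add schwartz_cmult distrib_left int mult.left_commute
        Bochner_Integration.integral_add)
qed

lemma slow_distribution_tempered: "g \<in> slow \<Longrightarrow> distribution_of g \<in> tempered"
  by (intro distribution_of_tempered smooth_borel_measurable slow_smooth)
     (auto simp: slow_def dest: derivs_inD)

text \<open>Integration is the pairing with the constant 1. Through this identity, differentiation
  under the integral and Fubini for Schwartz functions follow from general facts on tempered
  distributions.\<close>

lemma integral_eq_distribution:
  "\<phi> \<in> schwartz \<Longrightarrow> (\<integral>x. \<phi> x \<partial>lborel) = distribution_of (\<lambda>x. 1) \<phi>"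
  by (simp add: distribution_of_def)

lemmas tempered_one = slow_distribution_tempered[OF slow_const[of 1]]

subsection \<open>Pairing a distribution with a parametrised family\<close>

lemma finite_growth_uniform:
  fixes a :: "'b \<Rightarrow> 'i \<Rightarrow> real"
  assumes "finite B" "\<And>b. b \<in> B \<Longrightarrow> \<exists>C. \<exists>m::nat. \<forall>i. a b i \<le> C * w i ^ m" "\<And>i. 1 \<le> w i"
  shows "\<exists>C\<ge>0. \<exists>m::nat. \<forall>b\<in>B. \<forall>i. a b i \<le> C * w i ^ m"
proof -
  obtain C and m :: "'b \<Rightarrow> nat" where C: "\<And>b i. b \<in> B \<Longrightarrow> a b i \<le> C b * w i ^ m b"
    using assms(2) by metis
  let ?C = "\<Sum>b\<in>B. \<bar>C b\<bar>" and ?m = "\<Sum>b\<in>B. m b"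
  have "a b i \<le> ?C * w i ^ ?m" if b: "b \<in> B" for b i
  proof (rule order_trans[OF C[OF b]])
    have "C b \<le> ?C" "m b \<le> ?m"
      using b assms(1) member_le_sum[of b B "\<lambda>b. \<bar>C b\<bar>"] member_le_sum[of b B m] by simp_all
    then show "C b * w i ^ m b \<le> ?C * w i ^ ?m"
      using assms(3)[of i] by (intro mult_mono power_increasing) (auto intro!: sum_nonneg)
  qed
  moreover have "?C \<ge> 0" by (intro sum_nonneg) auto
  ultimately show ?thesis by blast
qed

section \<open>Taylor bounds in the parameter and differentiation under the pairing\<close>

lemma sum_Basis_prod:
  fixes f :: "'a::euclidean_space \<times> 'b::euclidean_space \<Rightarrow> 'c::comm_monoid_add"
  shows "(\<Sum>b\<in>Basis. f b) = (\<Sum>b\<in>Basis. f (b, 0)) + (\<Sum>b\<in>Basis. f (0, b))"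
proof -
  have "inj_on (\<lambda>u. (u, 0::'b)) (Basis::'a set)" "inj_on (\<lambda>u. (0::'a, u)) (Basis::'b set)"
    by (auto intro!: inj_onI)
  then show ?thesis
    unfolding Basis_prod_def
    by (subst sum.union_disjoint) (auto simp: sum.reindex)
qed

lemma derivative_first_variable:
  fixes J :: "'a::euclidean_space \<times> 'b::euclidean_space \<Rightarrow> complex"
  assumes "smooth J"
  shows "((\<lambda>t. J (x + t *\<^sub>R h, y)) has_vector_derivative
    (\<Sum>b\<in>Basis. (h \<bullet> b) *\<^sub>R partial1 (b, 0) J (x + t *\<^sub>R h, y))) (at t)"
proof -
  have "(\<Sum>b\<in>Basis. ((h, 0) \<bullet> b) *\<^sub>R partial1 b J ((x, y) + t *\<^sub>R (h, 0)))
      = (\<Sum>b\<in>Basis. (h \<bullet> b) *\<^sub>R partial1 (b, 0) J (x + t *\<^sub>R h, y))"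
    by (simp add: sum_Basis_prod)
  then show ?thesis using smooth_has_vector_derivative[OF assms, of "(x, y)" "(h, 0)" t] by simp
qed

lemma norm_directional_sum:
  fixes z :: "'a::euclidean_space \<Rightarrow> complex" and e :: real
  assumes "\<And>b. b \<in> Basis \<Longrightarrow> norm (z b) \<le> e"
  shows "norm (\<Sum>b\<in>Basis. (h \<bullet> b) *\<^sub>R z b) \<le> norm h * (DIM('a) * e)"
proof -
  have "norm (\<Sum>b\<in>Basis. (h \<bullet> b) *\<^sub>R z b) \<le> (\<Sum>b\<in>(Basis::'a set). norm h * e)"
    using assms by (intro sum_norm_le) (auto intro!: mult_mono simp: Basis_le_norm)
  then show ?thesis by (simp add: algebra_simps)
qed

text \<open>The mean value inequality in the first variable, with the weight in \<open>y\<close>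
  carried along. Peetre's inequality bounds the growth at the intermediate points.\<close>

lemma first_order_bound:
  fixes J :: "'a::euclidean_space \<times> 'b::euclidean_space \<Rightarrow> complex"
  assumes J: "smooth J" and "C \<ge> 0"
    and C: "\<And>b x y. b \<in> Basis \<Longrightarrow> jbracket y ^ N * norm (partial1 (b, 0) J (x, y)) \<le> C * jbracket x ^ m"
  shows "jbracket y ^ N * norm (J (x + h, y) - J (x, y)) \<le> norm h * (DIM('a) * (C * (2 * jbracket x * jbracket h) ^ m))"
proof -
  let ?e = "C * (2 * jbracket x * jbracket h) ^ m / jbracket y ^ N"
  have "norm (J (x + 1 *\<^sub>R h, y) - J (x + 0 *\<^sub>R h, y) - 1 *\<^sub>R 0) \<le> 1 * (norm h * (DIM('a) * ?e))"
  proof (rule increment_bound)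
    fix t :: real assume t: "t \<in> {0..1}"
    show "((\<lambda>t. J (x + t *\<^sub>R h, y)) has_vector_derivative
        (\<Sum>b\<in>Basis. (h \<bullet> b) *\<^sub>R partial1 (b, 0) J (x + t *\<^sub>R h, y))) (at t)"
      by (rule derivative_first_variable[OF J])
    have "norm (\<Sum>b\<in>Basis. (h \<bullet> b) *\<^sub>R partial1 (b, 0) J (x + t *\<^sub>R h, y)) \<le> norm h * (DIM('a) * ?e)"
    proof (rule norm_directional_sum)
      fix b :: 'a assume b: "b \<in> Basis"
      have "norm (t *\<^sub>R h) \<le> norm h" using t by (simp add: mult_left_le_one_le)
      then have "2 * jbracket x * jbracket (t *\<^sub>R h) \<le> 2 * jbracket x * jbracket h"
        by (intro mult_left_mono jbracket_mono) auto
      then have "jbracket (x + t *\<^sub>R h) \<le> 2 * jbracket x * jbracket h"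
        using jbracket_add[of x "t *\<^sub>R h"] by linarith
      then have "C * jbracket (x + t *\<^sub>R h) ^ m \<le> C * (2 * jbracket x * jbracket h) ^ m"
        using \<open>C \<ge> 0\<close> by (intro mult_left_mono power_mono) auto
      with C[OF b, of y "x + t *\<^sub>R h"] show "norm (partial1 (b, 0) J (x + t *\<^sub>R h, y)) \<le> ?e"
        by (simp add: field_simps)
    qed
    then show "norm ((\<Sum>b\<in>Basis. (h \<bullet> b) *\<^sub>R partial1 (b, 0) J (x + t *\<^sub>R h, y)) - 0) \<le> norm h * (DIM('a) * ?e)"
      by simp
  qed auto
  then have "jbracket y ^ N * norm (J (x + h, y) - J (x, y)) \<le> jbracket y ^ N * (norm h * (DIM('a) * ?e))"
    by (intro mult_left_mono) auto
  then show ?thesis by simp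
qed

text \<open>The Taylor remainder is of second order in \<open>h\<close>, uniformly in
  \<open>y\<close> after weighting. Applied to the \<open>y\<close>-derivatives of a kernel, this
  makes its difference quotients converge in every Schwartz seminorm.\<close>

lemma second_order_bound:
  fixes J :: "'a::euclidean_space \<times> 'b::euclidean_space \<Rightarrow> complex"
  assumes J: "J \<in> derivs_in poly_rapid"
  shows "\<exists>C. \<exists>m::nat. \<forall>x y h. norm h \<le> 1 \<longrightarrow>
    jbracket y ^ N * norm (J (x + h, y) - J (x, y) - (\<Sum>b\<in>Basis. (h \<bullet> b) *\<^sub>R partial1 (b, 0) J (x, y)))
      \<le> C * jbracket x ^ m * (norm h)\<^sup>2"
proof -
  have B: "(b, 0) \<in> (Basis :: ('a \<times> 'b) set)" if "b \<in> Basis" for b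
    using that by (simp add: Basis_prod_def)
  have "\<exists>C\<ge>0. \<exists>m::nat. \<forall>c\<in>Basis \<times> Basis. \<forall>z.
      jbracket (snd z) ^ N * norm (partial1 (fst c, 0) (partial1 (snd c, 0) J) z) \<le> C * jbracket (fst z) ^ m"
  proof (rule finite_growth_uniform)
    fix c :: "'a \<times> 'a" assume c: "c \<in> Basis \<times> Basis"
    have "partial1 (fst c, 0) (partial1 (snd c, 0) J) \<in> poly_rapid"
      using c by (intro derivs_inD[of _ poly_rapid] derivs_in_partial1 J B) auto
    from poly_rapidD[OF this, of N]
    show "\<exists>C m. \<forall>z. jbracket (snd z) ^ N * norm (partial1 (fst c, 0) (partial1 (snd c, 0) J) z)
        \<le> C * jbracket (fst z) ^ m"
      unfolding split_paired_All fst_conv snd_conv by blast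
  qed (simp_all add: jbracket_ge_1)
  then obtain C and m :: nat where C0: "C \<ge> 0" and C1: "\<forall>c\<in>Basis \<times> Basis. \<forall>z.
      jbracket (snd z) ^ N * norm (partial1 (fst c, 0) (partial1 (snd c, 0) J) z) \<le> C * jbracket (fst z) ^ m"
    by blast
  have C: "jbracket y ^ N * norm (partial1 (a, 0) (partial1 (b, 0) J) (x, y)) \<le> C * jbracket x ^ m"
    if "a \<in> Basis" "b \<in> Basis" for a b x y
    using C1[rule_format, of "(a, b)" "(x, y)"] that by simp
  have smJ: "smooth J" using J derivs_in_smooth by blast
  let ?D = "DIM('a) * (DIM('a) * (C * 4 ^ m))"
  have "jbracket y ^ N * norm (J (x + h, y) - J (x, y) - (\<Sum>b\<in>Basis. (h \<bullet> b) *\<^sub>R partial1 (b, 0) J (x, y)))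
      \<le> ?D * jbracket x ^ m * (norm h)\<^sup>2" if h: "norm h \<le> 1" for x h y
  proof -
    let ?e = "norm h * (DIM('a) * (C * (4 * jbracket x) ^ m)) / jbracket y ^ N"
    let ?c = "\<Sum>b\<in>Basis. (h \<bullet> b) *\<^sub>R partial1 (b, 0) J (x, y)"
    have "norm (J (x + 1 *\<^sub>R h, y) - J (x + 0 *\<^sub>R h, y) - 1 *\<^sub>R ?c) \<le> 1 * (norm h * (DIM('a) * ?e))"
    proof (rule increment_bound)
      fix t :: real assume t: "t \<in> {0..1}"
      show "((\<lambda>t. J (x + t *\<^sub>R h, y)) has_vector_derivative
          (\<Sum>b\<in>Basis. (h \<bullet> b) *\<^sub>R partial1 (b, 0) J (x + t *\<^sub>R h, y))) (at t)"
        by (rule derivative_first_variable[OF smJ])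
      have "norm (\<Sum>b\<in>Basis. (h \<bullet> b) *\<^sub>R (partial1 (b, 0) J (x + t *\<^sub>R h, y) - partial1 (b, 0) J (x, y)))
        \<le> norm h * (DIM('a) * ?e)"
      proof (rule norm_directional_sum)
        fix b :: 'a assume b: "b \<in> Basis"
        have th: "norm (t *\<^sub>R h) \<le> norm h" using t by (simp add: mult_left_le_one_le)
        have "jbracket y ^ N * norm (partial1 (b, 0) J (x + t *\<^sub>R h, y) - partial1 (b, 0) J (x, y))
            \<le> norm (t *\<^sub>R h) * (DIM('a) * (C * (2 * jbracket x * jbracket (t *\<^sub>R h)) ^ m))"
          by (rule first_order_bound[OF smooth_partial1[OF smJ B[OF b]] C0]) (rule C[OF _ b])
        also have "\<dots> \<le> norm h * (DIM('a) * (C * (4 * jbracket x) ^ m))"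
        proof -
          \<comment> \<open>Since \<open>norm h \<le> 1\<close>, this bracket contributes a factor
            2, which together with the 2 of Peetre's inequality gives the 4.\<close>
          have "jbracket (t *\<^sub>R h) \<le> 2" using jbracket_le[of "t *\<^sub>R h"] th h by linarith
          then have "2 * jbracket x * jbracket (t *\<^sub>R h) \<le> 4 * jbracket x"
            using mult_left_mono[of "jbracket (t *\<^sub>R h)" 2 "2 * jbracket x"] by simp
          then have "(2 * jbracket x * jbracket (t *\<^sub>R h)) ^ m \<le> (4 * jbracket x) ^ m"
            by (intro power_mono) auto
          then have "DIM('a) * (C * (2 * jbracket x * jbracket (t *\<^sub>R h)) ^ m) \<le> DIM('a) * (C * (4 * jbracket x) ^ m)"
            using C0 by (intro mult_left_mono) auto
          then show ?thesis by (rule mult_mono[OF th]) (use C0 in auto)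
        qed
        finally show "norm (partial1 (b, 0) J (x + t *\<^sub>R h, y) - partial1 (b, 0) J (x, y)) \<le> ?e"
          by (simp add: field_simps)
      qed
      then show "norm ((\<Sum>b\<in>Basis. (h \<bullet> b) *\<^sub>R partial1 (b, 0) J (x + t *\<^sub>R h, y)) - ?c) \<le> norm h * (DIM('a) * ?e)"
        by (simp add: scaleR_diff_right sum_subtractf)
    qed auto
    then have "jbracket y ^ N * norm (J (x + h, y) - J (x, y) - ?c) \<le> jbracket y ^ N * (norm h * (DIM('a) * ?e))"
      by (intro mult_left_mono) auto
    then show ?thesis by (simp add: power2_eq_square power_mult_distrib ac_simps)
  qed
  then show ?thesis by blast
qed

lemma partial1_diff:
  assumes "\<And>x. f differentiable (at x)" "\<And>x. g differentiable (at x)"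
  shows "partial1 b (\<lambda>x. f x - g x) = (\<lambda>x. partial1 b f x - partial1 b g x)"
proof
  fix x
  obtain f' g' where d: "(f has_derivative f') (at x)" "(g has_derivative g') (at x)"
    using assms by (metis differentiable_def)
  show "partial1 b (\<lambda>x. f x - g x) x = partial1 b f x - partial1 b g x"
    by (simp add: d[THEN partial1_eq] has_derivative_diff[OF d, THEN partial1_eq])
qed

lemma partials_diff:
  assumes "smooth f" "smooth g" "bs \<in> lists Basis"
  shows "partials bs (\<lambda>x. f x - g x) = (\<lambda>x. partials bs f x - partials bs g x)"
  using assms(3)
proof (induction bs)
  case (Cons b bs)
  have "partial1 b (\<lambda>x. partials bs f x - partials bs g x)
      = (\<lambda>x. partial1 b (partials bs f) x - partial1 b (partials bs g) x)"
    using assms Cons.hyps by (intro partial1_diff) (auto simp: smooth_def)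
  then show ?case
    using Cons.IH by (simp add: partials_Cons)
qed simp

lemma partials_lincomb:
  assumes "\<And>i. i \<in> I \<Longrightarrow> smooth (f i)" "bs \<in> lists Basis"
  shows "partials bs (\<lambda>x. \<Sum>i\<in>I. c i * f i x) = (\<lambda>x. \<Sum>i\<in>I. c i * partials bs (f i) x)"
  using assms(2)
proof (induction bs)
  case (Cons b bs)
  have d: "\<And>i x. i \<in> I \<Longrightarrow> partials bs (f i) differentiable (at x)"
    using assms Cons.hyps by (auto simp: smooth_def)
  have "partials (b # bs) (\<lambda>x. \<Sum>i\<in>I. c i * f i x) = partial1 b (\<lambda>x. \<Sum>i\<in>I. c i * partials bs (f i) x)"
    using Cons by (simp add: partials_Cons)
  also have "\<dots> = (\<lambda>x. \<Sum>i\<in>I. partial1 b (\<lambda>x. c i * partials bs (f i) x) x)"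
    by (intro partial1_sum differentiable_mult d) auto
  also have "\<dots> = (\<lambda>x. \<Sum>i\<in>I. c i * partials (b # bs) (f i) x)"
    using d by (auto simp: partial1_cmult partials_Cons intro!: sum.cong ext)
  finally show ?case .
qed simp

text \<open>The functional is continuous for a single seminorm of order \<open>N\<close>. So it
  suffices that the Taylor remainder of the kernel in \<open>x\<close>, as a function of
  \<open>y\<close>, is of second order in \<open>h\<close> for this seminorm.\<close>

lemma pairing_has_derivative:
  fixes K :: "'a::euclidean_space \<times> 'b::euclidean_space \<Rightarrow> complex"
  assumes v: "v \<in> tempered" and K: "K \<in> derivs_in poly_rapid"
  shows "((\<lambda>x. v (\<lambda>y. K (x, y))) has_derivative
    (\<lambda>h. \<Sum>b\<in>Basis. (h \<bullet> b) *\<^sub>R v (\<lambda>y. partial1 (b, 0) K (x, y)))) (at x)"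
proof -
  have B: "(b, 0) \<in> (Basis :: ('a \<times> 'b) set)" if "b \<in> Basis" for b
    using that by (simp add: Basis_prod_def)
  have KS: "(\<lambda>y. K (x, y)) \<in> schwartz" for x by (rule poly_rapid_section[OF K])
  have KbS: "(\<lambda>y. partial1 (b, 0) K (x, y)) \<in> schwartz" if "b \<in> Basis" for b x
    by (intro poly_rapid_section derivs_in_partial1 K B that)
  have smK: "smooth K" using K derivs_in_smooth by blast
  \<comment> \<open>Indexing by pairs fits \<open>schwartz_norm_family\<close>, with
    \<open><x>\<close> as the growing parameter and the square of \<open>norm h\<close> as the exact
    factor.\<close>
  define R where "R = (\<lambda>(x, h) y. K (x + h, y) - K (x, y) - (\<Sum>b\<in>Basis. of_real (h \<bullet> b) * partial1 (b, 0) K (x, y)))"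
  have RS: "R (x, h) \<in> schwartz" for x h
    unfolding R_def prod.case by (intro schwartz_diff KS schwartz_sum schwartz_cmult KbS)
  obtain C0 N where C0: "C0 \<ge> 0" "\<And>\<phi>. \<phi> \<in> schwartz \<Longrightarrow> norm (v \<phi>) \<le> C0 * schwartz_norm N \<phi>"
    using temperedD(3)[OF v] by blast
  have "\<exists>C\<ge>0. \<exists>m::nat. \<forall>i\<in>{(x, h). norm h \<le> 1}. schwartz_norm N (R i) \<le> C * jbracket (fst i) ^ m * (norm (snd i))\<^sup>2"
  proof (rule schwartz_norm_family)
    fix bs assume bs: "bs \<in> lists (Basis :: 'b set)"
    let ?bs = "map (Pair 0) bs :: ('a \<times> 'b) list"
    have bs': "?bs \<in> lists Basis" using bs by (auto simp: in_lists_conv_set Basis_prod_def)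
    let ?J = "partials ?bs K"
    have "partials bs (R (x, h)) y = ?J (x + h, y) - ?J (x, y) - (\<Sum>b\<in>Basis. (h \<bullet> b) *\<^sub>R partial1 (b, 0) ?J (x, y))" for x h y
    proof -
      have "partials bs (\<lambda>y. \<Sum>b\<in>Basis. of_real (h \<bullet> b) * partial1 (b, 0) K (x, y))
          = (\<lambda>y. \<Sum>b\<in>Basis. of_real (h \<bullet> b) * partials bs (\<lambda>y. partial1 (b, 0) K (x, y)) y)"
        by (intro partials_lincomb bs schwartz_smooth KbS)
      also have "\<dots> = (\<lambda>y. \<Sum>b\<in>Basis. (h \<bullet> b) *\<^sub>R partial1 (b, 0) ?J (x, y))"
        by (intro ext sum.cong refl)
           (simp add: partials_section[OF smooth_partial1[OF smK B] bs] partials_partial1_commute[OF smK bs' B] scaleR_conv_of_real)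
      finally have sum: "partials bs (\<lambda>y. \<Sum>b\<in>Basis. of_real (h \<bullet> b) * partial1 (b, 0) K (x, y))
          = (\<lambda>y. \<Sum>b\<in>Basis. (h \<bullet> b) *\<^sub>R partial1 (b, 0) ?J (x, y))" .
      have "smooth (\<lambda>y. K (x + h, y) - K (x, y))" "smooth (\<lambda>y. K (x + h, y))" "smooth (\<lambda>y. K (x, y))"
        "smooth (\<lambda>y. \<Sum>b\<in>Basis. of_real (h \<bullet> b) * partial1 (b, 0) K (x, y))"
        by (intro schwartz_smooth schwartz_diff KS schwartz_sum schwartz_cmult KbS; assumption)+
      then show ?thesis
        by (simp add: R_def partials_diff[OF _ _ bs] sum partials_section[OF smK bs])
    qed
    moreover have "?J \<in> derivs_in poly_rapid" by (rule derivs_in_partials[OF K bs'])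
    moreover obtain C m where "\<forall>x y h. norm h \<le> 1 \<longrightarrow> jbracket y ^ N * norm (?J (x + h, y) - ?J (x, y)
        - (\<Sum>b\<in>Basis. (h \<bullet> b) *\<^sub>R partial1 (b, 0) ?J (x, y))) \<le> C * jbracket x ^ m * (norm h)\<^sup>2"
      using second_order_bound[OF \<open>?J \<in> derivs_in poly_rapid\<close>, of N] by blast
    ultimately show "\<exists>C m. \<forall>i\<in>{(x, h). norm h \<le> 1}. \<forall>y. jbracket y ^ N * norm (partials bs (R i) y)
        \<le> C * jbracket (fst i) ^ m * (norm (snd i))\<^sup>2"
      by (intro exI[of _ C] exI[of _ m]) auto
  qed (auto simp: jbracket_ge_1)
  then obtain C m where C: "C \<ge> 0" "\<And>x h. norm h \<le> 1 \<Longrightarrow> schwartz_norm N (R (x, h)) \<le> C * jbracket x ^ m * (norm h)\<^sup>2"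
    by fastforce
  let ?g = "\<lambda>x. v (\<lambda>y. K (x, y))" and ?D = "\<lambda>x h. \<Sum>b\<in>Basis. (h \<bullet> b) *\<^sub>R v (\<lambda>y. partial1 (b, 0) K (x, y))"
  have "v (R (x, h)) = ?g (x + h) - ?g x - ?D x h" for x h
  proof -
    have "(\<lambda>y. \<Sum>b\<in>Basis. of_real (h \<bullet> b) * partial1 (b, 0) K (x, y)) \<in> schwartz"
      by (intro schwartz_sum schwartz_cmult KbS)
    then have "v (R (x, h)) = ?g (x + h) - ?g x - v (\<lambda>y. \<Sum>b\<in>Basis. of_real (h \<bullet> b) * partial1 (b, 0) K (x, y))"
      by (simp add: R_def tempered_diff[OF v] schwartz_diff KS)
    also have "v (\<lambda>y. \<Sum>b\<in>Basis. of_real (h \<bullet> b) * partial1 (b, 0) K (x, y)) = ?D x h"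
      by (subst tempered_sum[OF v]) (auto intro: KbS simp: scaleR_conv_of_real)
    finally show ?thesis .
  qed
  then have rem: "norm (?g (x + h) - ?g x - ?D x h) \<le> C0 * (C * jbracket x ^ m * (norm h)\<^sup>2)" if "norm h \<le> 1" for x h
    using C0(2)[OF RS[of x h]] mult_left_mono[OF C(2)[OF that, of x] C0(1)] by simp
  show ?thesis
    unfolding has_derivative_at
  proof
    show "bounded_linear (?D x)"
      by (intro bounded_linear_sum bounded_linear_scaleR_const bounded_linear_inner_left)
    show "(\<lambda>h. norm (?g (x + h) - ?g x - ?D x h) / norm h) \<midarrow>0\<rightarrow> 0"
    proof (rule tendsto_sandwich[where f="\<lambda>_. 0" and h="\<lambda>h. C0 * (C * jbracket x ^ m) * norm h"])
      show "((\<lambda>h::'a. C0 * (C * jbracket x ^ m) * norm h) \<longlongrightarrow> 0) (at 0)"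
        by (auto intro!: tendsto_eq_intros)
      have "norm (?g (x + h) - ?g x - ?D x h) / norm h \<le> C0 * (C * jbracket x ^ m) * norm h"
        if "norm h < 1" "h \<noteq> 0" for h
        using rem[of h x] that by (simp add: divide_le_eq power2_eq_square mult.assoc)
      then show "\<forall>\<^sub>F h in at 0. norm (?g (x + h) - ?g x - ?D x h) / norm h \<le> C0 * (C * jbracket x ^ m) * norm h"
        unfolding eventually_at by (intro exI[of _ 1]) auto
    qed auto
  qed
qed

lemma pairing_bound:
  fixes K :: "'a::euclidean_space \<times> 'b::euclidean_space \<Rightarrow> complex"
  assumes K: "K \<in> derivs_in poly_rapid"
  shows "\<exists>C\<ge>0. \<exists>m::nat. \<forall>x. schwartz_norm N (\<lambda>y. K (x, y)) \<le> C * jbracket x ^ m"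
proof -
  have "\<exists>C\<ge>0. \<exists>m::nat. \<forall>x\<in>UNIV. schwartz_norm N (\<lambda>y. K (x, y)) \<le> C * jbracket x ^ m * 1"
  proof (rule schwartz_norm_family[where w=jbracket and q="\<lambda>_. 1"])
    fix bs assume bs: "bs \<in> lists (Basis :: 'b set)"
    let ?bs = "map (Pair 0) bs :: ('a \<times> 'b) list"
    have bs': "?bs \<in> lists Basis" using bs by (auto simp: in_lists_conv_set Basis_prod_def)
    have "partials ?bs K \<in> poly_rapid" by (rule derivs_inD[OF derivs_in_partials[OF K bs']])
    from poly_rapidD[OF this, of N] obtain C m where
      C: "\<And>x y. jbracket y ^ N * norm (partials ?bs K (x, y)) \<le> C * jbracket x ^ m" by blast
    show "\<exists>C m. \<forall>x\<in>UNIV. \<forall>y. jbracket y ^ N * norm (partials bs (\<lambda>y. K (x, y)) y) \<le> C * jbracket x ^ m * 1"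
      unfolding partials_section[OF derivs_in_smooth[OF K] bs]
      by (intro exI[of _ C] exI[of _ m]) (use C in simp)
  qed (auto simp: jbracket_ge_1)
  then show ?thesis by simp
qed

text \<open>Pairings with kernels of class \<open>derivs_in poly_rapid\<close> are stable under
  differentiation, because a derivative in \<open>x\<close> moves onto the kernel.\<close>

lemma
  fixes K :: "'a::euclidean_space \<times> 'b::euclidean_space \<Rightarrow> complex"
  assumes v: "v \<in> tempered" and K: "K \<in> derivs_in poly_rapid"
  shows pairing_slow: "(\<lambda>x. v (\<lambda>y. K (x, y))) \<in> slow"
    and partial1_pairing: "b \<in> Basis \<Longrightarrow> partial1 b (\<lambda>x. v (\<lambda>y. K (x, y))) = (\<lambda>x. v (\<lambda>y. partial1 (b, 0) K (x, y)))"
proof -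
  have B: "(b, 0) \<in> (Basis :: ('a \<times> 'b) set)" if "b \<in> Basis" for b
    using that by (simp add: Basis_prod_def)
  have p: "partial1 b (\<lambda>x. v (\<lambda>y. K (x, y))) = (\<lambda>x. v (\<lambda>y. partial1 (b, 0) K (x, y)))"
    if "b \<in> Basis" "K \<in> derivs_in poly_rapid" for b and K :: "'a \<times> 'b \<Rightarrow> complex"
    using that(1) by (intro ext, subst partial1_eq[OF pairing_has_derivative[OF v that(2)]])
      (simp add: inner_Basis if_distrib[of "\<lambda>c. c *\<^sub>R _"] cong: if_cong)
  show "b \<in> Basis \<Longrightarrow> partial1 b (\<lambda>x. v (\<lambda>y. K (x, y))) = (\<lambda>x. v (\<lambda>y. partial1 (b, 0) K (x, y)))"
    using p K by blast
  show "(\<lambda>x. v (\<lambda>y. K (x, y))) \<in> slow"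
    unfolding slow_def
  proof (rule derivs_in_coinduct[where X="{\<lambda>x. v (\<lambda>y. K (x, y)) | K. K \<in> derivs_in poly_rapid}"])
    fix g assume "g \<in> {\<lambda>x. v (\<lambda>y. K (x, y)) | K. K \<in> derivs_in (poly_rapid :: ('a \<times> 'b \<Rightarrow> complex) set)}"
    then obtain L :: "'a \<times> 'b \<Rightarrow> complex" where g: "g = (\<lambda>x. v (\<lambda>y. L (x, y)))" and L: "L \<in> derivs_in poly_rapid" by blast
    show "g differentiable (at x)" for x
      using pairing_has_derivative[OF v L] unfolding g differentiable_def by blast
    show "partial1 b g \<in> {\<lambda>x. v (\<lambda>y. K (x, y)) | K. K \<in> derivs_in poly_rapid}" if "b \<in> Basis" for b
      unfolding g p[OF that L] using derivs_in_partial1[OF L B[OF that]] by blast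
    obtain C0 N where C0: "C0 \<ge> 0" "\<And>\<phi>. \<phi> \<in> schwartz \<Longrightarrow> norm (v \<phi>) \<le> C0 * schwartz_norm N \<phi>"
      using temperedD(3)[OF v] by blast
    obtain C m where C: "\<And>x. schwartz_norm N (\<lambda>y. L (x, y)) \<le> C * jbracket x ^ m"
      using pairing_bound[OF L, of N] by blast
    have "norm (g x) \<le> C0 * C * jbracket x ^ m" for x
      using order_trans[OF C0(2)[OF poly_rapid_section[OF L, of x]] mult_left_mono[OF C[of x] C0(1)]]
      by (simp add: g mult.assoc)
    then show "g \<in> poly_bdd" unfolding poly_bdd_def by blast
  qed (use K in blast)
qed

lemma partials_pairing:
  fixes K :: "'a::euclidean_space \<times> 'b::euclidean_space \<Rightarrow> complex"
  assumes v: "v \<in> tempered" and K: "K \<in> derivs_in poly_rapid" and bs: "bs \<in> lists Basis"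
  shows "partials bs (\<lambda>x. v (\<lambda>y. K (x, y))) = (\<lambda>x. v (\<lambda>y. partials (map (\<lambda>b. (b, 0)) bs) K (x, y)))"
  using bs
proof (induction bs)
  case (Cons b bs)
  have "map (\<lambda>b. (b, 0)) bs \<in> lists (Basis :: ('a \<times> 'b) set)"
    using Cons.hyps by (auto simp: in_lists_conv_set Basis_prod_def)
  then show ?case
    using Cons by (simp add: partials_Cons partial1_pairing[OF v derivs_in_partials[OF K]])
qed simp

subsection \<open>Tensor products\<close>

lemma Basis_Pair: "b \<in> Basis \<Longrightarrow> (b, 0) \<in> Basis" "b \<in> Basis \<Longrightarrow> (0, b) \<in> Basis"
  by (simp_all add: Basis_prod_def)

lemma lists_Basis_Pair:
  "bs \<in> lists Basis \<Longrightarrow> map (Pair 0) bs \<in> lists Basis"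
  "bs \<in> lists Basis \<Longrightarrow> map (\<lambda>b. (b, 0)) bs \<in> lists Basis"
  by (auto simp: in_lists_conv_set Basis_prod_def)

text \<open>Both \<open><x>\<close> and \<open><y>\<close> are at most \<open><(x, y)>\<close>, so
  the exponents \<open>n\<close> and \<open>N\<close> add up. The derivatives already applied raise
  the order by \<open>length as\<close>.\<close>

lemma schwartz_norm_section:
  fixes \<Psi> :: "'a::euclidean_space \<times> 'b::euclidean_space \<Rightarrow> complex"
  assumes \<Psi>: "\<Psi> \<in> schwartz" and as: "as \<in> lists Basis"
  shows "jbracket x ^ n * schwartz_norm N (\<lambda>y. partials as \<Psi> (x, y)) \<le> schwartz_norm (N + n + length as) \<Psi>"
proof -
  let ?S = "schwartz_norm (N + n + length as) \<Psi>"
  have "schwartz_norm N (\<lambda>y. partials as \<Psi> (x, y)) \<le> ?S / jbracket x ^ n"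
  proof (rule schwartz_norm_least)
    fix bs y assume bs: "bs \<in> lists (Basis :: 'b set)" "length bs \<le> N"
    let ?d = "norm (partials (map (Pair 0) bs @ as) \<Psi> (x, y))"
    have "jbracket x ^ n * (jbracket y ^ N * ?d) \<le> jbracket (x, y) ^ n * (jbracket (x, y) ^ N * ?d)"
      by (intro mult_mono power_mono jbracket_fst_le jbracket_snd_le) auto
    also have "\<dots> = jbracket (x, y) ^ (n + N) * ?d" by (simp add: power_add)
    also have "\<dots> \<le> ?S"
      by (rule schwartz_norm_bound[OF \<Psi>]) (use as bs lists_Basis_Pair(1)[OF bs(1)] in auto)
    finally have "jbracket x ^ n * (jbracket y ^ N * ?d) \<le> ?S" .
    moreover have "partials bs (\<lambda>y. partials as \<Psi> (x, y)) y = partials (map (Pair 0) bs @ as) \<Psi> (x, y)"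
      by (simp add: partials_section smooth_partials schwartz_smooth[OF \<Psi>] as bs partials_append)
    ultimately show "jbracket y ^ N * norm (partials bs (\<lambda>y. partials as \<Psi> (x, y)) y) \<le> ?S / jbracket x ^ n"
      by (simp add: field_simps)
  qed
  then show ?thesis by (simp add: field_simps)
qed

text \<open>This makes \<open>tensor\<close> meaningful: the inner pairing is again a Schwartz
  function. Its decay in \<open>x\<close> comes from the decay of the seminorms of the
  sections.\<close>

lemma pairing_schwartz:
  fixes \<Psi> :: "'a::euclidean_space \<times> 'b::euclidean_space \<Rightarrow> complex"
  assumes v: "v \<in> tempered" and \<Psi>: "\<Psi> \<in> schwartz"
  shows "(\<lambda>x. v (\<lambda>y. \<Psi> (x, y))) \<in> schwartz"
  unfolding schwartz_eq
proof (rule derivs_in_coinduct[where X="{\<lambda>x. v (\<lambda>y. \<Psi> (x, y)) | \<Psi>. \<Psi> \<in> schwartz}"])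
  show "(\<lambda>x. v (\<lambda>y. \<Psi> (x, y))) \<in> {\<lambda>x. v (\<lambda>y. \<Psi> (x, y)) | \<Psi>. \<Psi> \<in> schwartz}"
    using \<Psi> by blast
  fix g assume "g \<in> {\<lambda>x. v (\<lambda>y. \<Psi> (x, y)) | \<Psi>. \<Psi> \<in> (schwartz :: ('a \<times> 'b \<Rightarrow> complex) set)}"
  then obtain L :: "'a \<times> 'b \<Rightarrow> complex" where g: "g = (\<lambda>x. v (\<lambda>y. L (x, y)))" and L: "L \<in> schwartz" by blast
  show "g differentiable (at x)" for x
    using pairing_has_derivative[OF v schwartz_in_poly_rapid[OF L]] unfolding g differentiable_def by blast
  show "partial1 b g \<in> {\<lambda>x. v (\<lambda>y. \<Psi> (x, y)) | \<Psi>. \<Psi> \<in> schwartz}" if "b \<in> Basis" for b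
    unfolding g partial1_pairing[OF v schwartz_in_poly_rapid[OF L] that]
    using schwartz_partial1[OF L Basis_Pair(1)[OF that]] by blast
  obtain C0 N where C0: "C0 \<ge> 0" "\<And>\<phi>. \<phi> \<in> schwartz \<Longrightarrow> norm (v \<phi>) \<le> C0 * schwartz_norm N \<phi>"
    using temperedD(3)[OF v] by blast
  have "jbracket x ^ n * norm (g x) \<le> C0 * schwartz_norm (N + n) L" for x n
  proof -
    have "jbracket x ^ n * norm (g x) \<le> jbracket x ^ n * (C0 * schwartz_norm N (\<lambda>y. L (x, y)))"
      unfolding g by (intro mult_left_mono C0 schwartz_section L) auto
    also have "\<dots> = C0 * (jbracket x ^ n * schwartz_norm N (\<lambda>y. partials [] L (x, y)))" by simp
    also have "\<dots> \<le> C0 * schwartz_norm (N + n) L"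
      using schwartz_norm_section[OF L, of "[]" x n N] by (intro mult_left_mono C0) auto
    finally show ?thesis .
  qed
  then show "g \<in> rapid" unfolding rapid_def by blast
qed

lemma tensor_tempered:
  fixes u :: "'a::euclidean_space distribution" and v :: "'b::euclidean_space distribution"
  assumes u: "u \<in> tempered" and v: "v \<in> tempered"
  shows "tensor u v \<in> tempered"
  unfolding tempered_def mem_Collect_eq
proof (intro conjI ballI allI)
  show "tensor u v \<in> extensional schwartz" by (simp add: tensor_def)
  note S = schwartz_section pairing_schwartz[OF v]
  show "tensor u v (\<lambda>x. \<phi> x + \<psi> x) = tensor u v \<phi> + tensor u v \<psi>" if "\<phi> \<in> schwartz" "\<psi> \<in> schwartz" for \<phi> \<psi>
    using that by (simp add: tensor_def schwartz_add S temperedD(1)[OF v] temperedD(1)[OF u])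
  show "tensor u v (\<lambda>x. c * \<phi> x) = c * tensor u v \<phi>" if "\<phi> \<in> schwartz" for \<phi> c
    using that by (simp add: tensor_def schwartz_cmult S temperedD(2)[OF v] temperedD(2)[OF u])
  obtain C N where C: "C \<ge> 0" "\<And>\<phi>. \<phi> \<in> schwartz \<Longrightarrow> norm (u \<phi>) \<le> C * schwartz_norm N \<phi>"
    using temperedD(3)[OF u] by blast
  obtain D M where D: "D \<ge> 0" "\<And>\<phi>. \<phi> \<in> schwartz \<Longrightarrow> norm (v \<phi>) \<le> D * schwartz_norm M \<phi>"
    using temperedD(3)[OF v] by blast
  \<comment> \<open>The order is \<open>M\<close> for \<open>v\<close>, plus \<open>N\<close> powers
    of the bracket and up to \<open>N\<close> derivatives for \<open>u\<close>.\<close>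
  have "norm (tensor u v \<Psi>) \<le> C * D * schwartz_norm (M + N + N) \<Psi>" if \<Psi>: "\<Psi> \<in> schwartz" for \<Psi>
  proof -
    let ?g = "\<lambda>x. v (\<lambda>y. \<Psi> (x, y))"
    have "schwartz_norm N ?g \<le> D * schwartz_norm (M + N + N) \<Psi>"
    proof (rule schwartz_norm_least)
      fix bs x assume bs: "bs \<in> lists (Basis :: 'a set)" "length bs \<le> N"
      let ?bs = "map (\<lambda>b. (b, 0 :: 'b)) bs"
      have "jbracket x ^ N * norm (partials bs ?g x) = jbracket x ^ N * norm (v (\<lambda>y. partials ?bs \<Psi> (x, y)))"
        by (simp add: partials_pairing[OF v schwartz_in_poly_rapid[OF \<Psi>] bs(1)])
      also have "\<dots> \<le> jbracket x ^ N * (D * schwartz_norm M (\<lambda>y. partials ?bs \<Psi> (x, y)))"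
        by (intro mult_left_mono D schwartz_section schwartz_partials \<Psi> lists_Basis_Pair bs) auto
      also have "\<dots> = D * (jbracket x ^ N * schwartz_norm M (\<lambda>y. partials ?bs \<Psi> (x, y)))" by simp
      also have "\<dots> \<le> D * schwartz_norm (M + N + length ?bs) \<Psi>"
        by (intro mult_left_mono schwartz_norm_section \<Psi> lists_Basis_Pair bs D)
      also have "\<dots> \<le> D * schwartz_norm (M + N + N) \<Psi>"
        using bs by (intro mult_left_mono schwartz_norm_mono \<Psi> D) auto
      finally show "jbracket x ^ N * norm (partials bs ?g x) \<le> D * schwartz_norm (M + N + N) \<Psi>" .
    qed
    then have "C * schwartz_norm N ?g \<le> C * (D * schwartz_norm (M + N + N) \<Psi>)"
      using C(1) by (rule mult_left_mono)
    then show ?thesis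
      using C(2)[OF S(2)[OF \<Psi>]] by (simp add: tensor_def \<Psi> mult.assoc)
  qed
  then show "\<exists>C N. \<forall>\<phi>\<in>schwartz. norm (tensor u v \<phi>) \<le> C * schwartz_norm N \<phi>" by blast
qed

lemma partials_cnj:
  assumes "smooth f" "bs \<in> lists Basis"
  shows "partials bs (\<lambda>x. cnj (f x)) = (\<lambda>x. cnj (partials bs f x))"
  using assms(2)
proof (induction bs)
  case (Cons b bs)
  then show ?case
    using assms(1) by (simp add: partials_Cons partial1_cnj smooth_def)
qed simp

lemma schwartz_norm_cnj:
  assumes "\<phi> \<in> schwartz" shows "schwartz_norm N (\<lambda>x. cnj (\<phi> x)) \<le> schwartz_norm N \<phi>"
  using assms by (intro schwartz_norm_least) (simp add: partials_cnj schwartz_smooth schwartz_norm_upper)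

lemma cnj_distribution_tempered:
  assumes u: "u \<in> tempered" shows "cnj_distribution u \<in> tempered"
  unfolding tempered_def mem_Collect_eq
proof (intro conjI ballI allI)
  show "cnj_distribution u \<in> extensional schwartz" by (simp add: cnj_distribution_def)
  show "cnj_distribution u (\<lambda>x. \<phi> x + \<psi> x) = cnj_distribution u \<phi> + cnj_distribution u \<psi>"
    if "\<phi> \<in> schwartz" "\<psi> \<in> schwartz" for \<phi> \<psi>
    using that by (simp add: cnj_distribution_def schwartz_add schwartz_cnj temperedD(1)[OF u])
  show "cnj_distribution u (\<lambda>x. c * \<phi> x) = c * cnj_distribution u \<phi>" if "\<phi> \<in> schwartz" for \<phi> c
    using that by (simp add: cnj_distribution_def schwartz_cmult schwartz_cnj temperedD(2)[OF u])
  obtain C N where C: "C \<ge> 0" "\<And>\<phi>. \<phi> \<in> schwartz \<Longrightarrow> norm (u \<phi>) \<le> C * schwartz_norm N \<phi>"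
    using temperedD(3)[OF u] by blast
  have "norm (cnj_distribution u \<phi>) \<le> C * schwartz_norm N \<phi>" if "\<phi> \<in> schwartz" for \<phi>
    using order_trans[OF C(2)[OF schwartz_cnj[OF that]] mult_left_mono[OF schwartz_norm_cnj[OF that] C(1)]] that
    by (simp add: cnj_distribution_def)
  then show "\<exists>C N. \<forall>\<phi>\<in>schwartz. norm (cnj_distribution u \<phi>) \<le> C * schwartz_norm N \<phi>" by blast
qed

section \<open>The Fourier transform on Schwartz functions\<close>

definition fourier :: "('a::euclidean_space \<Rightarrow> complex) \<Rightarrow> 'a \<Rightarrow> complex"
  where "fourier h \<zeta> = (\<integral>y. h y * cis (- (2 * pi * (y \<bullet> \<zeta>))) \<partial>lborel)"

lemma lborel_integral_translate:
  fixes g :: "'a::euclidean_space \<Rightarrow> complex"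
  assumes [measurable]: "g \<in> borel_measurable borel"
  shows "(\<integral>x. g (c + x) \<partial>lborel) = (\<integral>x. g x \<partial>lborel)"
proof -
  have "(\<integral>x. g x \<partial>lborel) = (\<integral>x. g x \<partial>distr lborel borel ((+) c))"
    by (simp add: lborel_distr_plus)
  also have "\<dots> = (\<integral>x. g (c + x) \<partial>lborel)" by (rule integral_distr) auto
  finally show ?thesis by simp
qed

lemma partial1_line:
  assumes "((\<lambda>t. f (x + t *\<^sub>R b)) has_vector_derivative d) (at 0)"
  shows "partial1 b f x = d"
  using assms by (simp add: partial1_def vector_derivative_at)

lemma schwartz_sum_arguments:
  assumes "g \<in> schwartz" shows "(\<lambda>z. g (fst z + snd z)) \<in> derivs_in poly_rapid"
proof -
  have "(\<lambda>z. g ((fst z + snd z) + 0)) \<in> derivs_in poly_rapid"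
  proof (rule schwartz_affine_poly_rapid[OF assms, where K=2 and k=1])
    fix x y :: 'a
    show "jbracket y \<le> 2 * jbracket x ^ 1 * jbracket (fst (x, y) + snd (x, y) + 0)"
      using jbracket_diff[of "x + y" x] by (simp add: ac_simps)
  qed (auto intro!: linearI simp: scaleR_add_right)
  then show ?thesis by simp
qed

text \<open>The integral of \<open>g (x + y)\<close> over \<open>y\<close> does not depend on
  \<open>x\<close>. Differentiating this constant at \<open>x = 0\<close> under the pairing with 1
  gives the claim.\<close>

lemma integral_partial1_eq_0:
  fixes g :: "'a::euclidean_space \<Rightarrow> complex"
  assumes g: "g \<in> schwartz" and b: "b \<in> Basis"
  shows "(\<integral>x. partial1 b g x \<partial>lborel) = 0"
proof -
  let ?K = "\<lambda>z. g (fst z + snd z)"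
  note K = schwartz_sum_arguments[OF g]
  note KS = poly_rapid_section[OF K] poly_rapid_section[OF derivs_in_partial1[OF K Basis_Pair(1)[OF b]]]
  have [measurable]: "g \<in> borel_measurable borel"
    by (intro smooth_borel_measurable schwartz_smooth g)
  have "distribution_of (\<lambda>x. 1) (\<lambda>y. ?K (x, y)) = (\<integral>y. g y \<partial>lborel)" for x
    using KS(1)[of x] by (simp add: integral_eq_distribution[symmetric] lborel_integral_translate)
  then have "partial1 b (\<lambda>x. distribution_of (\<lambda>x. 1) (\<lambda>y. ?K (x, y))) 0 = 0"
    by (simp add: partial1_const)
  then have "distribution_of (\<lambda>x. 1) (\<lambda>y. partial1 (b, 0) ?K (0, y)) = 0"
    by (simp only: partial1_pairing[OF tempered_one K b])
  then have "(\<integral>y. partial1 (b, 0) ?K (0, y) \<partial>lborel) = 0"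
    by (simp add: integral_eq_distribution KS)
  moreover have "partial1 (b, 0) ?K (0, y) = partial1 b g y" for y
    by (simp add: partial1_def add.commute)
  ultimately show ?thesis by simp
qed

lemma slow_exponential: "(\<lambda>y. cis (- (2 * pi * (y \<bullet> \<zeta>)))) \<in> slow"
  using slow_cis_inner[of "- (2 * pi)" \<zeta>] by simp

text \<open>Integration by parts: the derivative of \<open>h\<close> times the exponential has
  integral zero.\<close>

lemma fourier_partial1:
  fixes h :: "'a::euclidean_space \<Rightarrow> complex"
  assumes h: "h \<in> schwartz" and b: "b \<in> Basis"
  shows "fourier (partial1 b h) \<zeta> = 2 * pi * \<i> * (\<zeta> \<bullet> b) * fourier h \<zeta>"
proof -
  let ?e = "\<lambda>y. cis (- (2 * pi * (y \<bullet> \<zeta>)))"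
  have he: "(\<lambda>y. g y * ?e y) \<in> schwartz" if "g \<in> schwartz" for g
    by (intro schwartz_mult_slow that slow_exponential)
  have "partial1 b (\<lambda>y. h y * ?e y) = (\<lambda>y. partial1 b h y * ?e y - 2 * pi * \<i> * (\<zeta> \<bullet> b) * (h y * ?e y))"
  proof -
    have "partial1 b ?e = (\<lambda>y. - 2 * pi * \<i> * (\<zeta> \<bullet> b) * ?e y)"
      using partial1_cis_inner[of b "- (2 * pi)" \<zeta>] by (simp add: inner_commute ac_simps)
    then show ?thesis
      using h slow_exponential[of \<zeta>]
      by (subst partial1_mult) (auto intro: smooth_differentiable slow_smooth schwartz_smooth simp: algebra_simps)
  qed
  then have "(\<integral>y. partial1 b h y * ?e y - 2 * pi * \<i> * (\<zeta> \<bullet> b) * (h y * ?e y) \<partial>lborel) = 0"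
    using integral_partial1_eq_0[OF he[OF h] b] by simp
  then show ?thesis
    using he[OF h] he[OF schwartz_partial1[OF h b]]
    by (subst (asm) Bochner_Integration.integral_diff)
       (auto intro!: schwartz_integrable schwartz_cmult integrable_mult_right simp: fourier_def)
qed

lemma fourier_partials_replicate:
  fixes h :: "'a::euclidean_space \<Rightarrow> complex"
  assumes h: "h \<in> schwartz" and b: "b \<in> Basis"
  shows "fourier (partials (replicate n b) h) \<zeta> = (2 * pi * \<i> * (\<zeta> \<bullet> b)) ^ n * fourier h \<zeta>"
proof (induction n)
  case (Suc n)
  have "partials (replicate n b) h \<in> schwartz"
    using b by (intro schwartz_partials h) (auto simp: in_lists_conv_set)
  then show ?case using Suc by (simp add: partials_Cons fourier_partial1 b)
qed simp

lemma schwartz_norm_partials: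
  assumes "\<phi> \<in> schwartz" "bs \<in> lists Basis"
  shows "schwartz_norm N (partials bs \<phi>) \<le> schwartz_norm (N + length bs) \<phi>"
  by (rule schwartz_norm_least)
     (use assms in \<open>auto intro!: schwartz_norm_bound simp flip: partials_append\<close>)

text \<open>A dominant coordinate lets \<open>n\<close> derivatives in one single direction produce
  a full power of the norm of the frequency.\<close>

lemma max_coordinate:
  fixes x :: "'a::euclidean_space"
  shows "\<exists>b\<in>Basis. norm x \<le> DIM('a) * \<bar>x \<bullet> b\<bar>"
proof -
  obtain b where b: "b \<in> Basis" "\<And>c. c \<in> Basis \<Longrightarrow> \<bar>x \<bullet> c\<bar> \<le> \<bar>x \<bullet> b\<bar>"
    using Max_in[of "(\<lambda>b. \<bar>x \<bullet> b\<bar>) ` Basis"] Max_ge[of "(\<lambda>b. \<bar>x \<bullet> b\<bar>) ` Basis"] by fastforce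
  have "norm x \<le> (\<Sum>c\<in>Basis. \<bar>x \<bullet> c\<bar>)" by (rule norm_le_l1)
  also have "\<dots> \<le> (\<Sum>c\<in>(Basis::'a set). \<bar>x \<bullet> b\<bar>)" by (intro sum_mono b)
  finally show ?thesis using b(1) by auto
qed

text \<open>The constant is uniform in \<open>h\<close> as well as in the frequency, since the bound
  is applied to families of functions such as sections and translated products.\<close>

lemma fourier_decay:
  "\<exists>C\<ge>0. \<forall>h\<in>schwartz. \<forall>\<zeta>::'a::euclidean_space.
     jbracket \<zeta> ^ n * norm (fourier h \<zeta>) \<le> C * schwartz_norm (n + DIM('a) + 2) h"
proof -
  let ?I = "\<integral>x. 1 / jbracket x ^ (DIM('a) + 2) \<partial>(lborel :: 'a measure)"
  let ?D = "real DIM('a)"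
  have I: "?I \<ge> 0" by (intro integral_nonneg_AE) auto
  have base: "norm (fourier g \<zeta>) \<le> ?I * schwartz_norm (DIM('a) + 2) g" if "g \<in> schwartz" for g and \<zeta> :: 'a
  proof -
    let ?e = "\<lambda>y. cis (- (2 * pi * (y \<bullet> \<zeta>)))"
    have m: "?e \<in> borel_measurable borel"
      by (intro smooth_borel_measurable slow_smooth slow_exponential)
    have "norm (\<integral>y. ?e y * g y \<partial>lborel) \<le> 1 * ?I * schwartz_norm (0 + DIM('a) + 2) g"
      by (rule poly_times_schwartz_bound[OF m]) (use that in auto)
    then show ?thesis by (simp add: fourier_def mult.commute)
  qed
  have "jbracket \<zeta> ^ n * norm (fourier h \<zeta>) \<le> (2 ^ n * (1 + ?D ^ n) * ?I) * schwartz_norm (n + DIM('a) + 2) h"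
    if h: "h \<in> schwartz" for h and \<zeta> :: 'a
  proof -
    let ?S = "schwartz_norm (n + DIM('a) + 2) h" and ?F = "norm (fourier h \<zeta>)"
    obtain b where b: "b \<in> Basis" "norm \<zeta> \<le> ?D * \<bar>\<zeta> \<bullet> b\<bar>" using max_coordinate by blast
    have bs: "replicate n b \<in> lists Basis" using b by (auto simp: in_lists_conv_set)
    have le1: "?F \<le> ?I * ?S"
      by (rule order_trans[OF base[OF h]]) (intro mult_left_mono schwartz_norm_mono h I; simp)
    have "\<bar>\<zeta> \<bullet> b\<bar> ^ n * ?F \<le> \<bar>2 * pi * (\<zeta> \<bullet> b)\<bar> ^ n * ?F"
      using pi_ge_two by (intro mult_right_mono power_mono) (auto simp: abs_mult mult_le_cancel_right1)
    also have "\<dots> = norm (fourier (partials (replicate n b) h) \<zeta>)"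
      by (simp add: fourier_partials_replicate[OF h b(1)] norm_mult norm_power abs_mult)
    also have "\<dots> \<le> ?I * schwartz_norm (DIM('a) + 2) (partials (replicate n b) h)"
      by (rule base[OF schwartz_partials[OF h bs]])
    also have "\<dots> \<le> ?I * ?S"
      using schwartz_norm_partials[OF h bs, of "DIM('a) + 2"] I by (intro mult_left_mono) (auto simp: ac_simps)
    finally have le2: "\<bar>\<zeta> \<bullet> b\<bar> ^ n * ?F \<le> ?I * ?S" .
    let ?t = "?D * \<bar>\<zeta> \<bullet> b\<bar>"
    have "jbracket \<zeta> \<le> 1 + ?t" using jbracket_le[of \<zeta>] b(2) by linarith
    also have "\<dots> \<le> 2 * max 1 ?t" by simp
    finally have "jbracket \<zeta> ^ n \<le> (2 * max 1 ?t) ^ n" by (intro power_mono) auto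
    also have "\<dots> = 2 ^ n * (max 1 ?t) ^ n" by (rule power_mult_distrib)
    also have "\<dots> \<le> 2 ^ n * (1 + ?t ^ n)" by (intro mult_left_mono) (auto simp: max_def)
    finally have "jbracket \<zeta> ^ n * ?F \<le> 2 ^ n * (1 + ?t ^ n) * ?F" by (intro mult_right_mono) auto
    also have "\<dots> = 2 ^ n * (?F + ?D ^ n * (\<bar>\<zeta> \<bullet> b\<bar> ^ n * ?F))"
      by (simp add: power_mult_distrib algebra_simps)
    also have "\<dots> \<le> 2 ^ n * (?I * ?S + ?D ^ n * (?I * ?S))"
      using le1 le2 by (intro mult_left_mono add_mono) auto
    finally show ?thesis by (simp add: algebra_simps)
  qed
  moreover have "2 ^ n * (1 + ?D ^ n) * ?I \<ge> 0" using I by simp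
  ultimately show ?thesis by blast
qed

lemma fourier2_eq_fourier: "fourier2 \<Phi> (x, \<xi>) = fourier (\<lambda>y. \<Phi> (x, y)) \<xi>"
  by (simp add: fourier2_def fourier_def)

text \<open>The kernel has no decay in the frequency and so is not Schwartz in all variables. It is
  rapidly decreasing in \<open>y\<close> with polynomial growth in the parameters, which makes the
  pairing lemmas applicable.\<close>

lemma
  fixes \<Phi> :: "'a::euclidean_space \<times> 'b::euclidean_space \<Rightarrow> complex"
  assumes \<Phi>: "\<Phi> \<in> schwartz"
  defines "K \<equiv> \<lambda>((x, \<xi>), y). cis (- (2 * pi) * (y \<bullet> \<xi>)) * \<Phi> (x, y)"
  shows fourier2_kernel: "K \<in> derivs_in poly_rapid"
    and fourier2_eq_pairing: "fourier2 \<Phi> = (\<lambda>z. distribution_of (\<lambda>y. 1) (\<lambda>y. K (z, y)))"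
proof -
  have "(\<lambda>z::('a \<times> 'b) \<times> 'b. cis (- (2 * pi) * (snd z \<bullet> snd (fst z)))) \<in> slow"
    by (intro slow_cis_inner_linear linearI) auto
  moreover have "(\<lambda>z. \<Phi> ((fst (fst z), snd z) + 0)) \<in> derivs_in poly_rapid"
    by (rule schwartz_affine_poly_rapid[OF \<Phi>, where K=1 and k=0])
       (auto intro!: linearI simp: jbracket_snd_le)
  ultimately have "(\<lambda>z. cis (- (2 * pi) * (snd z \<bullet> snd (fst z))) * \<Phi> ((fst (fst z), snd z) + 0)) \<in> derivs_in poly_rapid"
    by (intro slow_mult_poly_rapid)
  then show K: "K \<in> derivs_in poly_rapid" by (simp add: K_def split_def)
  show "fourier2 \<Phi> = (\<lambda>z. distribution_of (\<lambda>y. 1) (\<lambda>y. K (z, y)))"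
    using poly_rapid_section[OF K]
    by (auto simp: fun_eq_iff fourier2_def integral_eq_distribution[symmetric]) (simp add: K_def mult.commute)
qed

lemma partial1_fourier2:
  fixes \<Phi> :: "'a::euclidean_space \<times> 'b::euclidean_space \<Rightarrow> complex"
  assumes \<Phi>: "\<Phi> \<in> schwartz"
  shows "a \<in> Basis \<Longrightarrow> partial1 (a, 0) (fourier2 \<Phi>) = fourier2 (partial1 (a, 0) \<Phi>)"
    and "b \<in> Basis \<Longrightarrow> partial1 (0, b) (fourier2 \<Phi>) = fourier2 (\<lambda>z. (- (2 * pi * \<i>) * (snd z \<bullet> b)) * \<Phi> z)"
proof -
  define K where "K = (\<lambda>((x, \<xi>), y). cis (- (2 * pi) * (y \<bullet> \<xi>)) * \<Phi> (x::'a, y::'b))"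
  have K: "K \<in> derivs_in poly_rapid" and eq: "fourier2 \<Phi> = (\<lambda>z. distribution_of (\<lambda>y. 1) (\<lambda>y. K (z, y)))"
    unfolding K_def by (rule fourier2_kernel[OF \<Phi>] fourier2_eq_pairing[OF \<Phi>])+
  have p: "partial1 c (fourier2 \<Phi>) (x, \<xi>) = (\<integral>y. partial1 (c, 0) K ((x, \<xi>), y) \<partial>lborel)" if "c \<in> Basis" for c x \<xi>
    using poly_rapid_section[OF derivs_in_partial1[OF K Basis_Pair(1)[OF that]]]
    by (simp add: eq partial1_pairing[OF tempered_one K that] integral_eq_distribution)
  show "partial1 (a, 0) (fourier2 \<Phi>) = fourier2 (partial1 (a, 0) \<Phi>)" if a: "a \<in> Basis"
  proof (rule ext, clarify)
    fix x \<xi>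
    have "partial1 ((a, 0), 0) K ((x, \<xi>), y) = partial1 (a, 0) \<Phi> (x, y) * cis (- (2 * pi * (y \<bullet> \<xi>)))" for y
    proof (rule partial1_line)
      have "((\<lambda>t. \<Phi> ((x, y) + t *\<^sub>R (a, 0))) has_vector_derivative partial1 (a, 0) \<Phi> ((x, y) + 0 *\<^sub>R (a, 0))) (at 0)"
        by (intro smooth_has_vector_derivative_Basis schwartz_smooth \<Phi> Basis_Pair a)
      from has_vector_derivative_mult_right[OF this, of "cis (- (2 * pi) * (y \<bullet> \<xi>))"]
      show "((\<lambda>t. K (((x, \<xi>), y) + t *\<^sub>R ((a, 0), 0))) has_vector_derivative
          partial1 (a, 0) \<Phi> (x, y) * cis (- (2 * pi * (y \<bullet> \<xi>)))) (at 0)"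
        by (simp add: K_def mult.commute)
    qed
    then show "partial1 (a, 0) (fourier2 \<Phi>) (x, \<xi>) = fourier2 (partial1 (a, 0) \<Phi>) (x, \<xi>)"
      using p[OF Basis_Pair(1)[OF a]] by (simp add: fourier2_def)
  qed
  show "partial1 (0, b) (fourier2 \<Phi>) = fourier2 (\<lambda>z. (- (2 * pi * \<i>) * (snd z \<bullet> b)) * \<Phi> z)" if b: "b \<in> Basis"
  proof (rule ext, clarify)
    fix x \<xi>
    have "partial1 ((0, b), 0) K ((x, \<xi>), y) = (- (2 * pi * \<i>) * (y \<bullet> b)) * \<Phi> (x, y) * cis (- (2 * pi * (y \<bullet> \<xi>)))" for y
    proof (rule partial1_line)
      have "((\<lambda>t. cis (- (2 * pi) * ((\<xi> + t *\<^sub>R b) \<bullet> y))) has_vector_derivative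
          partial1 b (\<lambda>\<xi>. cis (- (2 * pi) * (\<xi> \<bullet> y))) (\<xi> + 0 *\<^sub>R b)) (at 0)"
        by (intro smooth_has_vector_derivative_Basis slow_smooth slow_cis_inner b)
      from has_vector_derivative_mult_left[OF this, of "\<Phi> (x, y)"]
      show "((\<lambda>t. K (((x, \<xi>), y) + t *\<^sub>R ((0, b), 0))) has_vector_derivative
          (- (2 * pi * \<i>) * (y \<bullet> b)) * \<Phi> (x, y) * cis (- (2 * pi * (y \<bullet> \<xi>)))) (at 0)"
        unfolding partial1_cis_inner by (simp add: K_def inner_commute[of y] ac_simps)
    qed
    then show "partial1 (0, b) (fourier2 \<Phi>) (x, \<xi>) = fourier2 (\<lambda>z. (- (2 * pi * \<i>) * (snd z \<bullet> b)) * \<Phi> z) (x, \<xi>)"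
      using p[OF Basis_Pair(2)[OF b]] by (simp add: fourier2_def)
  qed
qed

text \<open>The image of the Schwartz space is stable under differentiation: a derivative in the
  first variable passes inside, one in the frequency becomes multiplication by a coordinate. What
  remains is the decay of the members of this image, which is \<open>fourier_decay\<close> on
  sections.\<close>

lemma fourier2_schwartz:
  fixes \<Phi> :: "'a::euclidean_space \<times> 'b::euclidean_space \<Rightarrow> complex"
  assumes "\<Phi> \<in> schwartz" shows "fourier2 \<Phi> \<in> schwartz"
  unfolding schwartz_eq
proof (rule derivs_in_coinduct[where X="fourier2 ` schwartz"])
  fix g :: "'a \<times> 'b \<Rightarrow> complex" assume "g \<in> fourier2 ` schwartz"
  then obtain \<Psi> :: "'a \<times> 'b \<Rightarrow> complex" where g: "g = fourier2 \<Psi>" and \<Psi>: "\<Psi> \<in> schwartz" by blast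
  show "g differentiable (at x)" for x
    unfolding g fourier2_eq_pairing[OF \<Psi>]
    by (intro smooth_differentiable slow_smooth pairing_slow tempered_one fourier2_kernel \<Psi>)
  show "partial1 c g \<in> fourier2 ` schwartz" if c: "c \<in> Basis" for c
  proof -
    consider a where "c = (a, 0)" "a \<in> Basis" | b where "c = (0, b)" "b \<in> Basis"
      using c unfolding Basis_prod_def by blast
    then show ?thesis
    proof cases
      case 1
      then show ?thesis
        unfolding g using \<Psi> by (auto simp: partial1_fourier2 intro!: schwartz_partial1 Basis_Pair)
    next
      case 2
      have "(\<lambda>z::'a \<times> 'b. - (2 * pi * \<i>) * (snd z \<bullet> b)) \<in> slow"
        by (intro slow_cmult slow_linear_coordinate linearI) auto
      then show ?thesis
        unfolding g using \<Psi> 2 by (simp only: partial1_fourier2) (intro imageI slow_mult_schwartz)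
    qed
  qed
  show "g \<in> rapid"
    unfolding rapid_def mem_Collect_eq
  proof
    fix n
    obtain C where C: "C \<ge> 0" "\<And>h \<zeta>. h \<in> schwartz \<Longrightarrow>
        jbracket (\<zeta>::'b) ^ n * norm (fourier h \<zeta>) \<le> C * schwartz_norm (n + DIM('b) + 2) h"
      using fourier_decay by blast
    let ?N = "n + DIM('b) + 2"
    have "jbracket z ^ n * norm (g z) \<le> C * schwartz_norm (?N + n) \<Psi>" for z
    proof -
      obtain x \<xi> where z: "z = (x, \<xi>)" by fastforce
      have "jbracket z ^ n * norm (g z) \<le> (jbracket x * jbracket \<xi>) ^ n * norm (fourier (\<lambda>y. \<Psi> (x, y)) \<xi>)"
        unfolding z g fourier2_eq_fourier
        by (intro mult_right_mono power_mono jbracket_Pair_le) auto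
      also have "\<dots> = jbracket x ^ n * (jbracket \<xi> ^ n * norm (fourier (\<lambda>y. \<Psi> (x, y)) \<xi>))"
        by (simp add: power_mult_distrib)
      also have "\<dots> \<le> jbracket x ^ n * (C * schwartz_norm ?N (\<lambda>y. \<Psi> (x, y)))"
        by (intro mult_left_mono C schwartz_section \<Psi>) auto
      also have "\<dots> = C * (jbracket x ^ n * schwartz_norm ?N (\<lambda>y. partials [] \<Psi> (x, y)))" by simp
      also have "\<dots> \<le> C * schwartz_norm (?N + n) \<Psi>"
        using schwartz_norm_section[OF \<Psi>, of "[]" x n ?N] by (intro mult_left_mono C) auto
      finally show ?thesis .
    qed
    then show "\<exists>C. \<forall>z. jbracket z ^ n * norm (g z) \<le> C" by blast
  qed
qed (use assms in blast)

subsection \<open>Integrals of Schwartz functions over one variable\<close>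

lemma partials_swap:
  fixes f :: "'b::euclidean_space \<times> 'a::euclidean_space \<Rightarrow> complex"
  shows "partials (map (\<lambda>b. (b, 0)) bs) (\<lambda>w. f (snd w, fst w)) = (\<lambda>w. partials (map (Pair 0) bs) f (snd w, fst w))"
proof (induction bs)
  case (Cons b bs)
  then show ?case by (simp add: partials_Cons) (simp add: partial1_def)
qed simp

lemma schwartz_swap:
  fixes f :: "'b::euclidean_space \<times> 'a::euclidean_space \<Rightarrow> complex"
  assumes "f \<in> schwartz" shows "(\<lambda>w. f (snd w, fst w)) \<in> schwartz"
proof -
  have "(\<lambda>w. f ((snd w, fst w) + 0)) \<in> schwartz"
    by (rule schwartz_affine[OF assms, where K=1])
       (auto intro!: linearI simp: jbracket_def norm_Pair add.commute)
  then show ?thesis by simp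
qed

text \<open>The variables are swapped so that the one that is not integrated becomes the parameter
  of a pairing.\<close>

lemma
  fixes f :: "'b::euclidean_space \<times> 'a::euclidean_space \<Rightarrow> complex"
  assumes f: "f \<in> schwartz"
  shows integral_section_schwartz: "(\<lambda>y. \<integral>z. f (z, y) \<partial>lborel) \<in> schwartz"
    and partials_integral_section: "bs \<in> lists Basis \<Longrightarrow>
      partials bs (\<lambda>y. \<integral>z. f (z, y) \<partial>lborel) = (\<lambda>y. \<integral>z. partials (map (Pair 0) bs) f (z, y) \<partial>lborel)"
proof -
  let ?f = "\<lambda>w. f (snd w, fst w)"
  note f' = schwartz_swap[OF f]
  have eq: "(\<lambda>y. \<integral>z. f (z, y) \<partial>lborel) = (\<lambda>y. distribution_of (\<lambda>z. 1) (\<lambda>z. ?f (y, z)))"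
    using schwartz_section[OF f'] by (simp add: integral_eq_distribution)
  show "(\<lambda>y. \<integral>z. f (z, y) \<partial>lborel) \<in> schwartz"
    unfolding eq by (rule pairing_schwartz[OF tempered_one f'])
  show "partials bs (\<lambda>y. \<integral>z. f (z, y) \<partial>lborel) = (\<lambda>y. \<integral>z. partials (map (Pair 0) bs) f (z, y) \<partial>lborel)"
    if bs: "bs \<in> lists Basis"
  proof
    fix y
    have "(\<lambda>z. partials (map (\<lambda>b. (b, 0)) bs) ?f (y, z)) \<in> schwartz"
      by (intro schwartz_section schwartz_partials f' lists_Basis_Pair bs)
    then have "distribution_of (\<lambda>z. 1) (\<lambda>z. partials (map (\<lambda>b. (b, 0)) bs) ?f (y, z))
        = (\<integral>z. partials (map (\<lambda>b. (b, 0)) bs) ?f (y, z) \<partial>lborel)"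
      by (simp add: integral_eq_distribution)
    then show "partials bs (\<lambda>y. \<integral>z. f (z, y) \<partial>lborel) y = (\<integral>z. partials (map (Pair 0) bs) f (z, y) \<partial>lborel)"
      unfolding eq partials_pairing[OF tempered_one schwartz_in_poly_rapid[OF f'] bs]
      by (simp add: partials_swap)
  qed
qed

section \<open>Exchange of a tempered distribution with an integral\<close>

lemma schwartz_bounded: "\<phi> \<in> schwartz \<Longrightarrow> \<exists>B. \<forall>x. norm (\<phi> x) \<le> B"
  using schwartz_rapidD[of \<phi> 0] by auto

lemma partials_cmult:
  assumes "smooth f" "bs \<in> lists Basis"
  shows "partials bs (\<lambda>x. c * f x) = (\<lambda>x. c * partials bs f x)"
  using partials_lincomb[of "{()}" "\<lambda>_. f" bs "\<lambda>_. c"] assms by simp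

text \<open>The coefficients are the integrals of \<open>\<omega>\<close> over the level sets of
  \<open>r\<close> and do not depend on \<open>g\<close>. One finite combination therefore serves
  for a scalar function and for the sections of a kernel at every \<open>y\<close>.\<close>

lemma integral_simple_function:
  fixes \<omega> :: "'b \<Rightarrow> real" and g :: "'c \<Rightarrow> complex"
  assumes r: "simple_function M r" and \<omega>: "integrable M \<omega>"
  shows "(\<integral>z. of_real (\<omega> z) * g (r z) \<partial>M)
    = (\<Sum>w\<in>r ` space M. of_real (\<integral>z. \<omega> z * indicator (r -` {w} \<inter> space M) z \<partial>M) * g w)"
proof -
  let ?W = "r ` space M" and ?i = "\<lambda>w z. \<omega> z * indicator (r -` {w} \<inter> space M) z"
  have fin: "finite ?W" and meas: "\<And>w. r -` {w} \<inter> space M \<in> sets M"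
    using simple_functionD[OF r] by auto
  have int: "integrable M (?i w)" for w
    using integrable_mult_indicator[OF meas \<omega>, of w] by (simp add: mult.commute)
  have "(\<integral>z. of_real (\<omega> z) * g (r z) \<partial>M) = (\<integral>z. (\<Sum>w\<in>?W. of_real (?i w z) * g w) \<partial>M)"
  proof (rule Bochner_Integration.integral_cong)
    fix z assume z: "z \<in> space M"
    have "(\<Sum>w\<in>?W. of_real (?i w z) * g w) = (\<Sum>w\<in>?W. if w = r z then of_real (\<omega> z) * g w else 0)"
      using z by (intro sum.cong) (auto simp: indicator_def)
    also have "\<dots> = of_real (\<omega> z) * g (r z)" using fin z by simp
    finally show "of_real (\<omega> z) * g (r z) = (\<Sum>w\<in>?W. of_real (?i w z) * g w)" by simp
  qed simp
  also have "\<dots> = (\<Sum>w\<in>?W. \<integral>z. of_real (?i w z) * g w \<partial>M)"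
    by (intro Bochner_Integration.integral_sum integrable_mult_left integrable_of_real int)
  also have "\<dots> = (\<Sum>w\<in>?W. of_real (\<integral>z. ?i w z \<partial>M) * g w)"
    by (simp only: integral_mult_left_zero integral_complex_of_real)
  finally show ?thesis .
qed

lemma lborel_simple_approximation:
  "\<exists>r. (\<forall>i. simple_function lborel (r i)) \<and> (\<forall>z. (\<lambda>i. r i z) \<longlonglongrightarrow> (z::'b::euclidean_space)) \<and>
    (\<forall>i z. norm (r i z) \<le> 2 * norm z)"
  using borel_measurable_implies_sequence_metric[of "\<lambda>x::'b. x" lborel 0] by simp

text \<open>The vector-valued integral is approximated by finite sums, the weight \<open>\<omega>\<close> making
  them converge in every Schwartz seminorm.\<close>

theorem tempered_integral:
  fixes K :: "'b::euclidean_space \<times> 'a::euclidean_space \<Rightarrow> complex"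
  assumes v: "v \<in> tempered" and K: "K \<in> schwartz"
  shows "v (\<lambda>y. \<integral>z. K (z, y) \<partial>lborel) = (\<integral>z. v (\<lambda>y. K (z, y)) \<partial>lborel)"
proof -
  \<comment> \<open>Even, so that \<open><z>^p\<close> is a polynomial and \<open>L\<close> stays
    Schwartz; and large enough for both \<open>\<omega>\<close> and \<open>norm z * \<omega>\<close>
    to be integrable.\<close>
  define p where "p = 2 * (DIM('b) + 2)"
  define \<omega> :: "'b \<Rightarrow> real" where "\<omega> z = 1 / jbracket z ^ p" for z
  define L where "L w = of_real (jbracket (fst w) ^ p) * K w" for w
  have \<omega>0: "\<omega> z \<ge> 0" for z by (simp add: \<omega>_def)
  have "(\<lambda>w::'b \<times> 'a. of_real (jbracket (fst w + 0) ^ p)) \<in> slow"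
    unfolding p_def by (rule slow_affine[OF slow_jbracket_even]) (auto intro: linearI)
  then have L: "L \<in> schwartz" unfolding L_def by (intro slow_mult_schwartz K) simp
  have KL: "K (z, y) = of_real (\<omega> z) * L (z, y)" for z y by (simp add: \<omega>_def L_def)
  have int\<omega>: "integrable lborel \<omega>" unfolding \<omega>_def p_def by (rule integrable_jbracket) simp
  have int\<omega>': "integrable lborel (\<lambda>z. \<omega> z * (3 * norm z))"
  proof (rule Bochner_Integration.integrable_bound)
    show "integrable lborel (\<lambda>z::'b. 3 * (1 / jbracket z ^ (p - 1)))"
      unfolding p_def by (intro integrable_mult_right integrable_jbracket) simp
    have "\<omega> z * (3 * norm z) \<le> 3 * (1 / jbracket z ^ (p - 1))" for z
    proof -
      have "p = Suc (p - 1)" by (simp add: p_def)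
      then have "\<omega> z = 1 / jbracket z ^ (p - 1) / jbracket z"
        unfolding \<omega>_def by (metis power_Suc2 divide_divide_eq_left)
      then have "\<omega> z * (3 * norm z) = 3 * (1 / jbracket z ^ (p - 1)) * (norm z / jbracket z)" by simp
      also have "\<dots> \<le> 3 * (1 / jbracket z ^ (p - 1))"
        by (intro mult_left_le) (auto simp: divide_le_eq norm_le_jbracket)
      finally show ?thesis .
    qed
    then show "AE z in lborel. norm (\<omega> z * (3 * norm z)) \<le> norm (3 * (1 / jbracket z ^ (p - 1)))"
      using \<omega>0 by (intro AE_I2) (simp add: abs_mult)
    show "(\<lambda>z. \<omega> z * (3 * norm z)) \<in> borel_measurable lborel"
      using int\<omega> by measurable
  qed
  obtain r :: "nat \<Rightarrow> 'b \<Rightarrow> 'b" where r: "\<And>i. simple_function lborel (r i)" "\<And>z. (\<lambda>i. r i z) \<longlonglongrightarrow> z"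
      "\<And>i z. norm (r i z) \<le> 2 * norm z"
    using lborel_simple_approximation by blast
  have [measurable]: "r i \<in> borel_measurable borel" for i
    using borel_measurable_simple_function[OF r(1)] by simp
  have [measurable]: "\<omega> \<in> borel_measurable borel" using int\<omega> by auto
  have bounded_int: "integrable lborel (\<lambda>z. of_real (\<omega> z) * g z)"
    if [measurable]: "g \<in> borel_measurable borel" and C: "\<And>z. norm (g z) \<le> C" for g :: "'b \<Rightarrow> complex" and C
  proof (rule Bochner_Integration.integrable_bound)
    show "integrable lborel (\<lambda>z. \<omega> z * C)" using int\<omega> by simp
    have "norm (of_real (\<omega> z) * g z) \<le> norm (\<omega> z * C)" for z
      using order_trans[OF mult_left_mono[OF C[of z] \<omega>0[of z]] abs_ge_self[of "\<omega> z * C"]] \<omega>0[of z]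
      by (simp add: norm_mult)
    then show "AE z in lborel. norm (of_real (\<omega> z) * g z) \<le> norm (\<omega> z * C)" by (intro AE_I2)
  qed measurable
  \<comment> \<open>This supplies the integrable majorant \<open>\<omega> z * (3 * norm z)\<close>
    for the error.\<close>
  have dr: "norm (r i z - z) \<le> 3 * norm z" for i z
    using norm_triangle_ineq4[of "r i z" z] r(3)[of i z] by linarith
  \<comment> \<open>The weighted mean distance of the step function from the identity. It bounds the
    seminorm error up to a factor independent of \<open>i\<close>.\<close>
  define e where "e i = (\<integral>z. \<omega> z * norm (r i z - z) \<partial>lborel)" for i
  have inte: "integrable lborel (\<lambda>z. \<omega> z * norm (r i z - z))" for i
  proof (rule Bochner_Integration.integrable_bound[OF int\<omega>'])
    show "AE z in lborel. norm (\<omega> z * norm (r i z - z)) \<le> norm (\<omega> z * (3 * norm z))"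
      using dr \<omega>0 by (intro AE_I2) (simp add: abs_mult mult_left_mono)
  qed measurable
  have "e \<longlonglongrightarrow> (\<integral>z. \<omega> z * 0 \<partial>(lborel :: 'b measure))"
    unfolding e_def
  proof (rule integral_dominated_convergence[OF _ _ int\<omega>'])
    have "(\<lambda>i. \<omega> z * norm (r i z - z)) \<longlonglongrightarrow> \<omega> z * 0" for z
      by (rule tendsto_mult[OF tendsto_const tendsto_norm_zero[OF LIM_zero[OF r(2)]]])
    then show "AE z in lborel. (\<lambda>i. \<omega> z * norm (r i z - z)) \<longlonglongrightarrow> \<omega> z * 0" by simp
    show "AE z in lborel. norm (\<omega> z * norm (r i z - z)) \<le> \<omega> z * (3 * norm z)" for i
      using dr \<omega>0 by (intro AE_I2) (simp add: abs_mult mult_left_mono)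
  qed measurable
  then have e: "e \<longlonglongrightarrow> 0" by simp
  define c where "c i w = (\<integral>z. \<omega> z * indicator (r i -` {w} \<inter> space lborel) z \<partial>lborel)" for i w
  define W where "W i = r i ` space lborel" for i
  have simple: "(\<integral>z. of_real (\<omega> z) * g (r i z) \<partial>lborel) = (\<Sum>w\<in>W i. of_real (c i w) * g w)" for i and g :: "'b \<Rightarrow> complex"
    unfolding c_def W_def by (rule integral_simple_function[OF r(1) int\<omega>])
  \<comment> \<open>Riemann-type sums: \<open>v\<close> passes through them by linearity, and they
    approximate the integral in the one seminorm that bounds \<open>v\<close>.\<close>
  define \<Phi> where "\<Phi> i y = (\<Sum>w\<in>W i. of_real (c i w) * L (w, y))" for i y
  let ?\<Phi> = "\<lambda>y. \<integral>z. K (z, y) \<partial>lborel"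
  note LS = schwartz_section[OF L]
  have \<Phi>S: "\<Phi> i \<in> schwartz" for i unfolding \<Phi>_def by (intro schwartz_sum schwartz_cmult LS)
  have \<Phi>0S: "?\<Phi> \<in> schwartz" by (rule integral_section_schwartz[OF K])
  obtain C0 N where C0: "C0 \<ge> 0" "\<And>\<phi>. \<phi> \<in> schwartz \<Longrightarrow> norm (v \<phi>) \<le> C0 * schwartz_norm N \<phi>"
    using temperedD(3)[OF v] by blast
  \<comment> \<open>The mean value inequality costs one derivative, hence the order
    \<open>N + 1\<close>.\<close>
  let ?S = "schwartz_norm (N + 1) L"
  have close: "schwartz_norm N (\<lambda>y. \<Phi> i y - ?\<Phi> y) \<le> DIM('b) * ?S * e i" for i
  proof (rule schwartz_norm_least)
    fix bs y assume bs: "bs \<in> lists (Basis :: 'a set)" "length bs \<le> N"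
    let ?bs = "map (Pair 0) bs :: ('b \<times> 'a) list"
    note bs' = lists_Basis_Pair(1)[OF bs(1)]
    define J where "J = partials ?bs L"
    have J: "J \<in> schwartz" unfolding J_def by (intro schwartz_partials L bs')
    have sec: "partials bs (\<lambda>y. L (z, y)) = (\<lambda>y. J (z, y))" for z
      unfolding J_def by (rule partials_section[OF schwartz_smooth[OF L] bs(1)])
    have KJ: "partials ?bs K (z, y) = of_real (\<omega> z) * J (z, y)" for z
    proof -
      have "partials ?bs K (z, y) = partials bs (\<lambda>y. K (z, y)) y"
        by (simp add: partials_section[OF schwartz_smooth[OF K] bs(1)])
      also have "\<dots> = of_real (\<omega> z) * J (z, y)"
        by (simp add: KL partials_cmult[OF schwartz_smooth[OF LS] bs(1)] sec)
      finally show ?thesis .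
    qed
    obtain B where B: "\<And>w. norm (J w) \<le> B"
      using schwartz_bounded[OF J] by blast
    have mJ: "(\<lambda>z. J (z, y)) \<in> borel_measurable borel"
      by (intro borel_measurable_continuous_onI continuous_on_compose2[OF smooth_continuous_on[OF schwartz_smooth[OF J]]]
          continuous_intros) auto
    have intJ: "integrable lborel (\<lambda>z. of_real (\<omega> z) * J (r i z, y))" "integrable lborel (\<lambda>z. of_real (\<omega> z) * J (z, y))"
      by (rule bounded_int[OF measurable_compose[OF \<open>r i \<in> borel_measurable borel\<close> mJ] B])
         (rule bounded_int[OF mJ B])
    have "partials bs (\<lambda>y. \<Phi> i y - ?\<Phi> y) y = (\<Sum>w\<in>W i. of_real (c i w) * J (w, y)) - (\<integral>z. of_real (\<omega> z) * J (z, y) \<partial>lborel)"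
      using schwartz_smooth[OF \<Phi>S] schwartz_smooth[OF \<Phi>0S]
      by (simp add: partials_diff bs partials_integral_section[OF K bs(1)] KJ)
         (simp add: \<Phi>_def[abs_def] partials_lincomb schwartz_smooth[OF LS] bs sec)
    also have "\<dots> = (\<integral>z. of_real (\<omega> z) * J (r i z, y) - of_real (\<omega> z) * J (z, y) \<partial>lborel)"
      by (simp add: simple[of "\<lambda>w. J (w, y)" i, symmetric] intJ)
    finally have eq: "partials bs (\<lambda>y. \<Phi> i y - ?\<Phi> y) y = (\<integral>z. of_real (\<omega> z) * J (r i z, y) - of_real (\<omega> z) * J (z, y) \<partial>lborel)" .
    have diffJ: "jbracket y ^ N * norm (J (r i z, y) - J (z, y)) \<le> DIM('b) * ?S * norm (r i z - z)" for z
    proof -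
      \<comment> \<open>The exponent \<open>0\<close> expresses that the weighted derivatives of
        \<open>J\<close> are bounded uniformly in the first variable, so the increment alone
        remains.\<close>
      have "jbracket y ^ N * norm (J (z + (r i z - z), y) - J (z, y))
          \<le> norm (r i z - z) * (DIM('b) * (?S * (2 * jbracket z * jbracket (r i z - z)) ^ 0))"
      proof (rule first_order_bound)
        show "smooth J" by (rule schwartz_smooth[OF J])
        show "0 \<le> ?S" by (rule schwartz_norm_nonneg[OF L])
        fix b :: 'b and x y assume b: "b \<in> Basis"
        have "jbracket y ^ N * norm (partial1 (b, 0) J (x, y)) \<le> jbracket (x, y) ^ N * norm (partials ((b, 0) # ?bs) L (x, y))"
          by (auto simp: partials_Cons J_def intro!: mult_right_mono power_mono jbracket_snd_le)
        also have "\<dots> \<le> ?S"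
          by (rule schwartz_norm_bound[OF L]) (use bs bs' b Basis_Pair in auto)
        finally show "jbracket y ^ N * norm (partial1 (b, 0) J (x, y)) \<le> ?S * jbracket x ^ 0" by simp
      qed
      then show ?thesis by (simp add: ac_simps)
    qed
    have "jbracket y ^ N * norm (partials bs (\<lambda>y. \<Phi> i y - ?\<Phi> y) y)
        \<le> jbracket y ^ N * (\<integral>z. norm (of_real (\<omega> z) * J (r i z, y) - of_real (\<omega> z) * J (z, y)) \<partial>lborel)"
      unfolding eq by (intro mult_left_mono integral_norm_bound) auto
    also have "\<dots> = (\<integral>z. jbracket y ^ N * norm (of_real (\<omega> z) * J (r i z, y) - of_real (\<omega> z) * J (z, y)) \<partial>lborel)"
      by (rule integral_mult_right_zero[symmetric])
    also have "\<dots> \<le> (\<integral>z. DIM('b) * ?S * (\<omega> z * norm (r i z - z)) \<partial>lborel)"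
    proof (rule integral_mono)
      fix z
      have "jbracket y ^ N * norm (of_real (\<omega> z) * J (r i z, y) - of_real (\<omega> z) * J (z, y))
          = \<omega> z * (jbracket y ^ N * norm (J (r i z, y) - J (z, y)))"
        using \<omega>0[of z] by (simp add: norm_mult flip: right_diff_distrib)
      also have "\<dots> \<le> \<omega> z * (DIM('b) * ?S * norm (r i z - z))"
        by (intro mult_left_mono diffJ \<omega>0)
      finally show "jbracket y ^ N * norm (of_real (\<omega> z) * J (r i z, y) - of_real (\<omega> z) * J (z, y))
          \<le> DIM('b) * ?S * (\<omega> z * norm (r i z - z))" by (simp add: ac_simps)
    qed (intro integrable_mult_right integrable_norm Bochner_Integration.integrable_diff intJ inte)+
    also have "\<dots> = DIM('b) * ?S * e i" unfolding e_def by (rule integral_mult_right_zero)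
    finally show "jbracket y ^ N * norm (partials bs (\<lambda>y. \<Phi> i y - ?\<Phi> y) y) \<le> DIM('b) * ?S * e i" .
  qed
  have "norm (v (\<Phi> i) - v ?\<Phi>) \<le> C0 * (DIM('b) * ?S * e i)" for i
    unfolding tempered_diff[OF v \<Phi>S \<Phi>0S, symmetric]
    by (rule order_trans[OF C0(2)[OF schwartz_diff[OF \<Phi>S \<Phi>0S]] mult_left_mono[OF close C0(1)]])
  then have "\<forall>\<^sub>F i in sequentially. norm (v (\<Phi> i) - v ?\<Phi>) \<le> C0 * (DIM('b) * ?S * e i)"
    by (intro always_eventually allI)
  moreover have "(\<lambda>i. C0 * (DIM('b) * ?S * e i)) \<longlonglongrightarrow> 0"
    using tendsto_mult[OF tendsto_const tendsto_mult[OF tendsto_const e], of C0 "DIM('b) * ?S"] by simp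
  ultimately have "(\<lambda>i. v (\<Phi> i) - v ?\<Phi>) \<longlonglongrightarrow> 0"
    by (rule Lim_null_comparison)
  then have lim1: "(\<lambda>i. v (\<Phi> i)) \<longlonglongrightarrow> v ?\<Phi>" by (rule LIM_zero_cancel)
  \<comment> \<open>The same finite sums, evaluated after \<open>v\<close> has been applied,
    converge to the other side of the identity by dominated convergence.\<close>
  define g where "g z = v (\<lambda>y. L (z, y))" for z
  have g: "g \<in> schwartz" unfolding g_def by (rule pairing_schwartz[OF v L])
  have [measurable]: "g \<in> borel_measurable borel"
    by (intro smooth_borel_measurable schwartz_smooth g)
  obtain B where B: "\<And>w. norm (g w) \<le> B"
    using schwartz_bounded[OF g] by blast
  have "v (\<Phi> i) = (\<Sum>w\<in>W i. of_real (c i w) * g w)" for i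
    unfolding \<Phi>_def[abs_def] g_def by (rule tempered_sum[OF v, where \<phi>="\<lambda>w y. L (w, y)"]) (rule LS)
  then have "v (\<Phi> i) = (\<integral>z. of_real (\<omega> z) * g (r i z) \<partial>lborel)" for i
    by (simp only: simple)
  moreover have "(\<lambda>i. \<integral>z. of_real (\<omega> z) * g (r i z) \<partial>lborel) \<longlonglongrightarrow> (\<integral>z. of_real (\<omega> z) * g z \<partial>lborel)"
  proof (rule integral_dominated_convergence[where w="\<lambda>z. \<omega> z * B"])
    show "integrable lborel (\<lambda>z. \<omega> z * B)" using int\<omega> by simp
    have "isCont g z" for z
      using smooth_continuous_on[OF schwartz_smooth[OF g], of UNIV] by (simp add: continuous_on_eq_continuous_at)
    then have "(\<lambda>i. of_real (\<omega> z) * g (r i z)) \<longlonglongrightarrow> of_real (\<omega> z) * g z" for z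
      by (intro tendsto_intros isCont_tendsto_compose[OF _ r(2)])
    then show "AE z in lborel. (\<lambda>i. of_real (\<omega> z) * g (r i z)) \<longlonglongrightarrow> of_real (\<omega> z) * g z" by simp
    show "AE z in lborel. norm (of_real (\<omega> z) * g (r i z)) \<le> \<omega> z * B" for i
      using \<omega>0 B by (intro AE_I2) (simp add: norm_mult mult_left_mono)
  qed measurable
  ultimately have "(\<lambda>i. v (\<Phi> i)) \<longlonglongrightarrow> (\<integral>z. of_real (\<omega> z) * g z \<partial>lborel)" by simp
  with lim1 have "v ?\<Phi> = (\<integral>z. of_real (\<omega> z) * g z \<partial>lborel)" by (rule LIMSEQ_unique)
  also have "\<dots> = (\<integral>z. v (\<lambda>y. K (z, y)) \<partial>lborel)"
    by (simp add: KL g_def temperedD(2)[OF v LS])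
  finally show ?thesis .
qed

subsection \<open>Weighted bounds\<close>

lemma derivs_in_bdd_by_mult:
  assumes f: "f \<in> derivs_in (bdd_by \<omega>1)" and g: "g \<in> derivs_in (bdd_by \<omega>2)"
  shows "(\<lambda>x. f x * g x) \<in> derivs_in (bdd_by (\<lambda>x. \<omega>1 x * \<omega>2 x))"
proof (rule derivs_in_mult[OF lin_closed_bdd_by f g])
  fix f g assume "f \<in> bdd_by \<omega>1" "g \<in> bdd_by \<omega>2"
  then obtain C D where CD: "\<And>x. norm (f x) \<le> C * \<omega>1 x" "\<And>x. norm (g x) \<le> D * \<omega>2 x"
    by (auto simp: bdd_by_def)
  have "norm (f x * g x) \<le> C * D * (\<omega>1 x * \<omega>2 x)" for x
    using product_bound[OF CD(1)[of x] CD(2)[of x]] by (simp add: norm_mult)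
  then show "(\<lambda>x. f x * g x) \<in> bdd_by (\<lambda>x. \<omega>1 x * \<omega>2 x)" unfolding bdd_by_def by blast
qed

lemma derivs_in_bdd_by_affine:
  fixes A :: "'a::euclidean_space \<Rightarrow> 'b::euclidean_space"
  assumes "f \<in> derivs_in (bdd_by \<omega>)" "linear A"
  shows "(\<lambda>x. f (A x + c)) \<in> derivs_in (bdd_by (\<lambda>x. \<omega> (A x + c)))"
  by (rule derivs_in_affine[OF lin_closed_bdd_by assms]) (auto simp: bdd_by_def)

lemma derivs_in_bdd_by_mono:
  assumes "f \<in> derivs_in (bdd_by \<omega>)" "\<And>x. \<omega> x \<le> K * \<omega>' x" "\<And>x. 0 \<le> \<omega> x"
  shows "f \<in> derivs_in (bdd_by \<omega>')"
proof -
  have "bdd_by \<omega> \<subseteq> bdd_by \<omega>'"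
  proof
    fix g assume "g \<in> bdd_by \<omega>"
    then obtain C where C: "\<And>x. norm (g x) \<le> C * \<omega> x" by (auto simp: bdd_by_def)
    have "norm (g x) \<le> \<bar>C\<bar> * K * \<omega>' x" for x
      using order_trans[OF C[of x] order_trans[OF mult_right_mono[OF abs_ge_self assms(3)] mult_left_mono[OF assms(2) abs_ge_zero]]]
      by (simp add: mult.assoc)
    then show "g \<in> bdd_by \<omega>'" unfolding bdd_by_def by blast
  qed
  then show ?thesis using assms(1) derivs_in_mono by blast
qed

lemma schwartz_iff_bdd_by: "f \<in> schwartz \<longleftrightarrow> (\<forall>N. f \<in> derivs_in (bdd_by (\<lambda>x. 1 / jbracket x ^ N)))"
  unfolding schwartz_eq rapid_eq derivs_in_def by blast

lemma schwartz_tensor: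
  fixes f :: "'a::euclidean_space \<Rightarrow> complex" and g :: "'b::euclidean_space \<Rightarrow> complex"
  assumes f: "f \<in> schwartz" and g: "g \<in> schwartz"
  shows "(\<lambda>z. f (fst z) * g (snd z)) \<in> schwartz"
  unfolding schwartz_iff_bdd_by
proof
  fix N
  have "(\<lambda>z. f (fst z + 0) * g (snd z + 0)) \<in> derivs_in (bdd_by (\<lambda>z. 1 / jbracket (fst z + 0 :: 'a) ^ N * (1 / jbracket (snd z + 0 :: 'b) ^ N)))"
    using f g unfolding schwartz_iff_bdd_by
    by (intro derivs_in_bdd_by_mult derivs_in_bdd_by_affine[where \<omega>="\<lambda>x. 1 / jbracket x ^ N"] linearI) auto
  then have "(\<lambda>z. f (fst z) * g (snd z)) \<in> derivs_in (bdd_by (\<lambda>z. 1 / (jbracket (fst z) ^ N * jbracket (snd z) ^ N)))"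
    by simp
  then show "(\<lambda>z. f (fst z) * g (snd z)) \<in> derivs_in (bdd_by (\<lambda>z. 1 / jbracket z ^ N))"
  proof (rule derivs_in_bdd_by_mono[where K=1])
    fix z :: "'a \<times> 'b"
    have "jbracket z ^ N \<le> (jbracket (fst z) * jbracket (snd z)) ^ N"
      using jbracket_Pair_le[of "fst z" "snd z"] by (intro power_mono) auto
    then show "1 / (jbracket (fst z) ^ N * jbracket (snd z) ^ N) \<le> 1 * (1 / jbracket z ^ N)"
      by (simp add: power_mult_distrib frac_le)
  qed simp
qed

section \<open>Fourier inversion\<close>

text \<open>Reduction to the partial transform: \<open>h\<close> itself fills the first variable,
  and freezing that variable where \<open>h\<close> does not vanish recovers
  \<open>fourier h\<close> up to a nonzero factor.\<close>

lemma fourier_schwartz: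
  fixes h :: "'a::euclidean_space \<Rightarrow> complex"
  assumes h: "h \<in> schwartz" shows "fourier h \<in> schwartz"
proof (cases "\<exists>x0. h x0 \<noteq> 0")
  case True
  then obtain x0 where x0: "h x0 \<noteq> 0" by blast
  have "fourier2 (\<lambda>z. h (fst z) * h (snd z)) (x0, \<xi>) = h x0 * fourier h \<xi>" for \<xi>
    by (simp add: fourier2_eq_fourier fourier_def mult.assoc)
  then have "fourier h = (\<lambda>\<xi>. inverse (h x0) * fourier2 (\<lambda>z. h (fst z) * h (snd z)) (x0, \<xi>))"
    using x0 by (simp add: fun_eq_iff)
  then show ?thesis
    by (simp add: schwartz_cmult schwartz_section fourier2_schwartz schwartz_tensor h)
next
  case False
  then have "fourier h = (\<lambda>\<xi>. 0)" by (auto simp: fourier_def)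
  then show ?thesis by (simp add: schwartz_zero)
qed

lemma schwartz_integral_commute:
  fixes K :: "'b::euclidean_space \<times> 'a::euclidean_space \<Rightarrow> complex"
  assumes K: "K \<in> schwartz"
  shows "(\<integral>y. \<integral>z. K (z, y) \<partial>lborel \<partial>lborel) = (\<integral>z. \<integral>y. K (z, y) \<partial>lborel \<partial>lborel)"
  using tempered_integral[OF tempered_one K] integral_section_schwartz[OF K] schwartz_section[OF K]
  by (simp add: integral_eq_distribution)

lemma schwartz_integral_prod:
  fixes K :: "'b::euclidean_space \<times> 'a::euclidean_space \<Rightarrow> complex"
  assumes K: "K \<in> schwartz"
  shows "(\<integral>w. K w \<partial>lborel) = (\<integral>z. \<integral>y. K (z, y) \<partial>lborel \<partial>lborel)"
  using lborel_pair.integral_fst'[of K] schwartz_integrable[OF K] by (simp add: lborel_prod)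

lemma fourier_multiplication:
  fixes g h :: "'a::euclidean_space \<Rightarrow> complex"
  assumes g: "g \<in> schwartz" and h: "h \<in> schwartz"
  shows "(\<integral>\<zeta>. g \<zeta> * fourier h \<zeta> \<partial>lborel) = (\<integral>y. fourier g y * h y \<partial>lborel)"
proof -
  let ?K = "\<lambda>w. (cis (- (2 * pi) * (snd w \<bullet> fst w)) * (g (fst w) * h (snd w))) :: complex"
  have K: "?K \<in> schwartz"
    by (intro slow_mult_schwartz slow_cis_inner_linear schwartz_tensor g h linearI) auto
  have "(\<integral>\<zeta>. \<integral>y. ?K (\<zeta>, y) \<partial>lborel \<partial>lborel) = (\<integral>\<zeta>. g \<zeta> * fourier h \<zeta> \<partial>lborel)"
    by (intro Bochner_Integration.integral_cong refl)
       (simp add: fourier_def flip: integral_mult_right_zero, simp add: ac_simps)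
  moreover have "(\<integral>y. \<integral>\<zeta>. ?K (\<zeta>, y) \<partial>lborel \<partial>lborel) = (\<integral>y. fourier g y * h y \<partial>lborel)"
    by (intro Bochner_Integration.integral_cong refl)
       (simp add: fourier_def flip: integral_mult_left_zero, simp add: ac_simps inner_commute)
  ultimately show ?thesis using schwartz_integral_commute[OF K] by simp
qed

lemma lborel_integral_scale:
  fixes g :: "'a::euclidean_space \<Rightarrow> complex"
  assumes [measurable]: "g \<in> borel_measurable borel" and "c \<noteq> 0"
  shows "(\<integral>x. g x \<partial>lborel) = of_real (\<bar>c\<bar> ^ DIM('a)) * (\<integral>x. g (c *\<^sub>R x) \<partial>lborel)"
proof -
  have "(\<integral>x. g x \<partial>lborel) = (\<integral>x. g x \<partial>density (distr lborel borel (\<lambda>x. 0 + c *\<^sub>R x)) (\<lambda>_. ennreal (\<bar>c\<bar> ^ DIM('a))))"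
    using lborel_affine[of c "0 :: 'a"] \<open>c \<noteq> 0\<close> by simp
  also have "\<dots> = (\<integral>x. \<bar>c\<bar> ^ DIM('a) *\<^sub>R g x \<partial>distr lborel borel (\<lambda>x. 0 + c *\<^sub>R x))"
    by (intro integral_density) auto
  also have "\<dots> = (\<integral>x. \<bar>c\<bar> ^ DIM('a) *\<^sub>R g (0 + c *\<^sub>R x) \<partial>lborel)"
    by (intro integral_distr) auto
  finally show ?thesis by (simp add: scaleR_conv_of_real)
qed

lemma schwartz_scale:
  fixes h :: "'a::euclidean_space \<Rightarrow> complex"
  assumes "h \<in> schwartz" "c > 0" shows "(\<lambda>x. h (c *\<^sub>R x)) \<in> schwartz"
proof -
  have "(\<lambda>x. h (c *\<^sub>R x + 0)) \<in> schwartz"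
  proof (rule schwartz_affine[OF assms(1), where K="max 1 (1 / c)"])
    fix x :: 'a
    show "jbracket x \<le> max 1 (1 / c) * jbracket (c *\<^sub>R x + 0)"
    proof (rule power2_le_imp_le)
      have "norm x \<le> max 1 (1 / c) * (c * norm x)"
        using assms(2) mult_right_mono[of "1 / c" "max 1 (1 / c)" "c * norm x"] by simp
      then have "(norm x)\<^sup>2 \<le> (max 1 (1 / c))\<^sup>2 * (c * norm x)\<^sup>2"
        by (metis norm_ge_zero power_mono power_mult_distrib)
      moreover have "1 \<le> (max 1 (1 / c))\<^sup>2" by (simp add: one_le_power)
      ultimately show "(jbracket x)\<^sup>2 \<le> (max 1 (1 / c) * jbracket (c *\<^sub>R x + 0))\<^sup>2"
        using assms(2) by (simp add: power_mult_distrib jbracket_square distrib_left add_mono)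
    qed simp
  qed (auto intro: linearI simp: scaleR_add_right)
  then show ?thesis by simp
qed

lemma fourier_scale:
  fixes h :: "'a::euclidean_space \<Rightarrow> complex"
  assumes h: "h \<in> schwartz" and c: "c > 0"
  shows "fourier h (c *\<^sub>R \<zeta>) = of_real (1 / c ^ DIM('a)) * fourier (\<lambda>x. h (x /\<^sub>R c)) \<zeta>"
proof -
  have h': "(\<lambda>x. h (x /\<^sub>R c)) \<in> schwartz" using schwartz_scale[OF h, of "1 / c"] c by (simp add: divide_inverse)
  have "(\<lambda>y. h (y /\<^sub>R c) * cis (- (2 * pi * (y \<bullet> \<zeta>)))) \<in> borel_measurable borel"
    by (intro smooth_borel_measurable schwartz_smooth schwartz_mult_slow h' slow_exponential)
  from lborel_integral_scale[OF this, of c] show ?thesis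
    using c by (simp add: fourier_def)
qed

text \<open>The scaling sits on \<open>g\<close> on one side and on \<open>h\<close> on the other.
  As \<open>c\<close> tends to 0, each side freezes its scaled factor at the origin.\<close>

lemma fourier_multiplication_scaled:
  fixes g h :: "'a::euclidean_space \<Rightarrow> complex"
  assumes g: "g \<in> schwartz" and h: "h \<in> schwartz" and c: "c > 0"
  shows "(\<integral>\<zeta>. g (c *\<^sub>R \<zeta>) * fourier h \<zeta> \<partial>lborel) = (\<integral>y. fourier g y * h (c *\<^sub>R y) \<partial>lborel)"
proof -
  let ?h = "\<lambda>x. h (c *\<^sub>R x)"
  have h': "?h \<in> schwartz" by (rule schwartz_scale[OF h c])
  have eq: "fourier ?h (c *\<^sub>R \<zeta>) = of_real (1 / c ^ DIM('a)) * fourier h \<zeta>" for \<zeta>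
    using fourier_scale[OF h' c, of \<zeta>] c by simp
  have "(\<lambda>\<zeta>. g \<zeta> * fourier ?h \<zeta>) \<in> borel_measurable borel"
    by (intro smooth_borel_measurable schwartz_smooth slow_mult_schwartz schwartz_in_slow g fourier_schwartz h')
  from lborel_integral_scale[OF this, of c]
  have "(\<integral>\<zeta>. g \<zeta> * fourier ?h \<zeta> \<partial>lborel)
      = of_real (c ^ DIM('a)) * (\<integral>\<zeta>. of_real (1 / c ^ DIM('a)) * (g (c *\<^sub>R \<zeta>) * fourier h \<zeta>) \<partial>lborel)"
    using c by (simp only: eq mult.left_commute abs_of_pos)
  also have "\<dots> = (\<integral>\<zeta>. g (c *\<^sub>R \<zeta>) * fourier h \<zeta> \<partial>lborel)"
    using c by (subst integral_mult_right_zero) simp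
  finally show ?thesis using fourier_multiplication[OF g h'] by simp
qed

text \<open>The limit \<open>c -> 0\<close> of the scaled multiplication formula, by dominated
  convergence on both sides. It is the inversion formula at the origin, the constant being fixed by
  any one \<open>g\<close> with \<open>g 0 \<noteq> 0\<close>.\<close>

lemma fourier_at_zero_limit:
  fixes g h :: "'a::euclidean_space \<Rightarrow> complex"
  assumes g: "g \<in> schwartz" and h: "h \<in> schwartz"
  shows "g 0 * (\<integral>\<zeta>. fourier h \<zeta> \<partial>lborel) = (\<integral>\<zeta>. fourier g \<zeta> \<partial>lborel) * h 0"
proof -
  let ?c = "\<lambda>n. inverse (real (Suc n))"
  have lim: "(\<lambda>n. \<integral>\<zeta>. u (?c n *\<^sub>R \<zeta>) * v \<zeta> \<partial>lborel) \<longlonglongrightarrow> (\<integral>\<zeta>. u 0 * v \<zeta> \<partial>lborel)"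
    if u: "u \<in> schwartz" and v: "v \<in> schwartz" for u v :: "'a \<Rightarrow> complex"
  proof -
    obtain B where B: "\<And>x. norm (u x) \<le> B" using schwartz_bounded[OF u] by blast
    have [measurable]: "u \<in> borel_measurable borel" "v \<in> borel_measurable borel"
      by (intro smooth_borel_measurable schwartz_smooth u v)+
    have cont: "isCont u 0"
      using smooth_continuous_on[OF schwartz_smooth[OF u], of UNIV] by (simp add: continuous_on_eq_continuous_at)
    show ?thesis
    proof (rule integral_dominated_convergence[where w="\<lambda>\<zeta>. B * norm (v \<zeta>)"])
      have "(\<lambda>n. ?c n *\<^sub>R \<zeta>) \<longlonglongrightarrow> 0" for \<zeta> :: 'a
        using tendsto_scaleR[OF LIMSEQ_inverse_real_of_nat tendsto_const, of \<zeta>] by simp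
      then have "(\<lambda>n. u (?c n *\<^sub>R \<zeta>) * v \<zeta>) \<longlonglongrightarrow> u 0 * v \<zeta>" for \<zeta>
        by (rule tendsto_mult[OF isCont_tendsto_compose[OF cont] tendsto_const])
      then show "AE \<zeta> in lborel. (\<lambda>n. u (?c n *\<^sub>R \<zeta>) * v \<zeta>) \<longlonglongrightarrow> u 0 * v \<zeta>" by simp
      show "AE \<zeta> in lborel. norm (u (?c n *\<^sub>R \<zeta>) * v \<zeta>) \<le> B * norm (v \<zeta>)" for n
        using B by (intro AE_I2) (simp add: norm_mult mult_right_mono)
      show "integrable lborel (\<lambda>\<zeta>. B * norm (v \<zeta>))"
        by (intro integrable_mult_right integrable_norm schwartz_integrable v)
    qed measurable
  qed
  have eq: "(\<integral>\<zeta>. g (?c n *\<^sub>R \<zeta>) * fourier h \<zeta> \<partial>lborel) = (\<integral>y. h (?c n *\<^sub>R y) * fourier g y \<partial>lborel)" for n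
    using fourier_multiplication_scaled[OF g h, of "?c n"] by (simp add: mult.commute)
  have "(\<integral>\<zeta>. g 0 * fourier h \<zeta> \<partial>lborel) = (\<integral>\<zeta>. h 0 * fourier g \<zeta> \<partial>lborel)"
    using LIMSEQ_unique[OF lim[OF g fourier_schwartz[OF h], unfolded eq] lim[OF h fourier_schwartz[OF g]]] .
  then show ?thesis by (simp add: mult.commute)
qed

subsection \<open>Test functions\<close>

text \<open>\<open>flat 0\<close> is \<open>exp (- 1 / t)\<close> extended by zero. The powers of
  \<open>1 / t\<close> make the family stable under differentiation up to linear
  combinations.\<close>

definition flat :: "nat \<Rightarrow> real \<Rightarrow> real"
  where "flat k t = (if t > 0 then exp (- inverse t) * inverse t ^ k else 0)"

lemma flat_tendsto_0: "(flat k \<longlongrightarrow> 0) (at 0)"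
proof (rule filterlim_split_at)
  have "\<forall>\<^sub>F t in at_left (0::real). flat k t = 0"
    unfolding eventually_at_filter by (auto simp: flat_def)
  then show "(flat k \<longlongrightarrow> 0) (at_left 0)"
    by (rule tendsto_eventually)
  have "((\<lambda>t::real. inverse t ^ k / exp (inverse t)) \<longlongrightarrow> 0) (at_right 0)"
    by (rule filterlim_compose[OF tendsto_power_div_exp_0 filterlim_inverse_at_top_right])
  moreover have "\<forall>\<^sub>F t in at_right (0::real). inverse t ^ k / exp (inverse t) = flat k t"
    unfolding eventually_at_filter by (auto simp: flat_def exp_minus field_simps)
  ultimately show "(flat k \<longlongrightarrow> 0) (at_right 0)"
    by (rule Lim_transform_eventually)
qed

lemma flat_has_derivative:
  "(flat k has_real_derivative flat (k + 2) t - k * flat (k + 1) t) (at t)"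
proof (cases t "0 :: real" rule: linorder_cases)
  case less
  have "((\<lambda>_. 0) has_real_derivative 0) (at t)" by simp
  then have "(flat k has_real_derivative 0) (at t)"
    by (rule has_field_derivative_transform_within_open[where S="{..<0}"]) (use less in \<open>auto simp: flat_def\<close>)
  then show ?thesis using less by (simp add: flat_def)
next
  case equal
  \<comment> \<open>At the origin the difference quotient of \<open>flat k\<close> is
    \<open>flat (k + 1)\<close>, which tends to 0.\<close>
  have "\<forall>\<^sub>F h in at (0::real). flat (k + 1) h = flat k h / h"
    unfolding eventually_at_filter by (auto simp: flat_def field_simps)
  from Lim_transform_eventually[OF flat_tendsto_0 this] show ?thesis
    by (simp add: equal DERIV_def) (simp add: flat_def)
next
  case greater
  have p: "((\<lambda>t. inverse t ^ k) has_real_derivative - (k * inverse t ^ (k + 1))) (at t)"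
    using DERIV_power[OF DERIV_inverse[of t], of k] greater by (cases k) (simp_all add: ac_simps)
  have e: "((\<lambda>t. exp (- inverse t)) has_real_derivative exp (- inverse t) * inverse t ^ 2) (at t)"
    using greater by (auto intro!: derivative_eq_intros simp: power2_eq_square)
  have "((\<lambda>t. exp (- inverse t) * inverse t ^ k) has_real_derivative
      exp (- inverse t) * inverse t ^ 2 * inverse t ^ k + - (k * inverse t ^ (k + 1)) * exp (- inverse t)) (at t)"
    by (rule DERIV_mult[OF e p])
  then have "(flat k has_real_derivative
      exp (- inverse t) * inverse t ^ 2 * inverse t ^ k + - (k * inverse t ^ (k + 1)) * exp (- inverse t)) (at t)"
    by (rule has_field_derivative_transform_within_open[where S="{0<..}"]) (use greater in \<open>auto simp: flat_def\<close>)
  then show ?thesis using greater by (simp add: flat_def power_add power2_eq_square algebra_simps)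
qed

text \<open>The bump is \<open>flat 0\<close> applied to \<open>1 - (norm (x - z))^2\<close>.
  Differentiation produces combinations of slow functions times \<open>F k\<close>, and the span of
  these is stable.\<close>

lemma test_function_exists: "\<exists>\<phi>\<in>test_functions. \<phi> (z::'a::euclidean_space) \<noteq> 0"
proof -
  define q where "q x = 1 - (x - z) \<bullet> (x - z)" for x
  define F where "F k x = complex_of_real (flat k (q x))" for k x
  let ?Y = "{\<lambda>x. p x * F k x | p k. p \<in> slow}"
  have q: "(q has_derivative (\<lambda>h. - (2 * ((x - z) \<bullet> h)))) (at x)" for x
    unfolding q_def by (auto intro!: derivative_eq_intros simp: inner_commute)
  have F: "(F k has_derivative (\<lambda>h. of_real ((flat (k + 2) (q x) - k * flat (k + 1) (q x)) * (- (2 * ((x - z) \<bullet> h)))))) (at x)" for k x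
    unfolding F_def
    by (intro has_derivative_of_real)
       (rule has_derivative_compose[OF q flat_has_derivative[unfolded has_field_derivative_def]])
  have dF: "F k differentiable (at x)" for k x using F by (auto simp: differentiable_def)
  have pF: "partial1 b (F k) = (\<lambda>x. of_real (- (2 * ((x - z) \<bullet> b))) * (F (k + 2) x - of_nat k * F (k + 1) x))" for b k
    by (rule ext, subst partial1_eq[OF F]) (simp add: F_def)
  have "(\<lambda>x. 1 * F 0 x) \<in> derivs_in UNIV"
  proof (rule derivs_in_lin_span[where Y="?Y"])
    show "(\<lambda>x. 1 * F 0 x) \<in> lin_span ?Y"
      by (intro lin_span_base CollectI exI[of _ "\<lambda>_. 1"] exI[of _ 0] conjI slow_const refl)
    fix g assume "g \<in> ?Y"
    then obtain p k where g: "g = (\<lambda>x. p x * F k x)" and p: "p \<in> slow" by blast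
    have dp: "p differentiable (at x)" for x using p slow_smooth smooth_differentiable by blast
    show "g differentiable (at x)" for x
      unfolding g by (intro differentiable_mult dp dF)
    fix b :: 'a assume b: "b \<in> Basis"
    let ?s = "\<lambda>x. complex_of_real (- (2 * ((x - z) \<bullet> b)))"
    have s: "?s \<in> slow"
      using slow_add[OF slow_cmult[OF slow_coordinate, of "-2" b] slow_const[of "of_real (2 * (z \<bullet> b))"]]
      by (simp add: inner_diff_left algebra_simps)
    have "partial1 b g = (\<lambda>x. partial1 b p x * F k x + (p x * ?s x * F (k + 2) x + (- of_nat k * (p x * ?s x)) * F (k + 1) x))"
      unfolding g partial1_mult[OF dp dF] pF by (simp add: algebra_simps)
    also have "\<dots> \<in> lin_span ?Y"
    proof (intro lin_span_add lin_span_base)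
      have Y: "(\<lambda>x. p x * F k x) \<in> ?Y" if "p \<in> slow" for p k
        using that unfolding mem_Collect_eq by (intro exI[of _ p] exI[of _ k] conjI refl)
      show "(\<lambda>x. partial1 b p x * F k x) \<in> ?Y" by (rule Y[OF slow_partial1[OF p b]])
      show "(\<lambda>x. p x * ?s x * F (k + 2) x) \<in> ?Y" by (rule Y[OF slow_mult[OF p s]])
      show "(\<lambda>x. (- of_nat k * (p x * ?s x)) * F (k + 1) x) \<in> ?Y" by (rule Y[OF slow_cmult[OF slow_mult[OF p s]]])
    qed
    finally show "partial1 b g \<in> lin_span ?Y" .
  qed (auto simp: lin_closed_UNIV)
  then have "smooth (F 0)" by (simp add: derivs_in_UNIV)
  moreover have "compact (closure {x. F 0 x \<noteq> 0})"
  proof -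
    have "{x. F 0 x \<noteq> 0} \<subseteq> ball z 1"
      by (auto simp: F_def flat_def q_def dist_norm norm_minus_commute power2_norm_eq_inner[symmetric] abs_square_less_1 split: if_splits)
    then show ?thesis by (meson bounded_ball bounded_subset compact_closure)
  qed
  moreover have "F 0 z \<noteq> 0" by (simp add: F_def flat_def q_def)
  ultimately show ?thesis unfolding test_functions_def by blast
qed

text \<open>All derivatives vanish on the open complement of the support, and on the compact support
  every weighted derivative is bounded.\<close>

lemma test_functions_schwartz:
  assumes "\<phi> \<in> test_functions" shows "\<phi> \<in> schwartz"
  unfolding schwartz_eq
proof (rule derivs_in_coinduct)
  define S where "S = closure {x. \<phi> x \<noteq> 0}"
  have S: "compact S" "smooth \<phi>" using assms by (auto simp: test_functions_def S_def)
  have opS: "open (- S)" unfolding S_def by (intro open_Compl closed_closure)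
  let ?X = "{g. smooth g \<and> (\<forall>x. x \<notin> S \<longrightarrow> g x = 0)}"
  show "\<phi> \<in> ?X" using S closure_subset[of "{x. \<phi> x \<noteq> 0}"] by (auto simp: S_def)
  fix g assume g: "g \<in> ?X"
  show "g differentiable (at x)" for x using g by (auto intro: smooth_differentiable)
  show "partial1 b g \<in> ?X" if "b \<in> Basis" for b
  proof -
    have "partial1 b g x = 0" if "x \<notin> S" for x
    proof -
      have "((\<lambda>x. 0) has_derivative (\<lambda>h. 0)) (at x)" by simp
      then have "(g has_derivative (\<lambda>h. 0)) (at x)"
        by (rule has_derivative_transform_within_open[OF _ opS]) (use g that in auto)
      from partial1_eq[OF this] show ?thesis by simp
    qed
    then show ?thesis using g that by (auto intro: smooth_partial1)
  qed
  show "g \<in> rapid"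
    unfolding rapid_def mem_Collect_eq
  proof
    fix N
    have "continuous_on S (\<lambda>x. jbracket x ^ N * norm (g x))"
      unfolding jbracket_def using g by (intro continuous_intros smooth_continuous_on) auto
    from compact_imp_bounded[OF compact_continuous_image[OF this S(1)]]
    obtain C where C: "\<And>x. x \<in> S \<Longrightarrow> norm (jbracket x ^ N * norm (g x)) \<le> C"
      unfolding bounded_iff by blast
    have "jbracket x ^ N * norm (g x) \<le> max C 0" for x
      using C[of x] g by (cases "x \<in> S") (auto simp: abs_mult)
    then show "\<exists>C. \<forall>x. jbracket x ^ N * norm (g x) \<le> C" by blast
  qed
qed

subsection \<open>The inversion formula up to a constant\<close>

text \<open>The set where \<open>\<phi>\<close> is nonzero is open and of measure zero, hence empty.
  This shows that two constants do not vanish: the one of Fourier inversion and the squared norm of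
  a window.\<close>

lemma schwartz_L2_zero:
  fixes \<phi> :: "'a::euclidean_space \<Rightarrow> complex"
  assumes \<phi>: "\<phi> \<in> schwartz" and 0: "(\<integral>x. \<phi> x * cnj (\<phi> x) \<partial>lborel) = 0"
  shows "\<phi> x = 0"
proof -
  have int: "integrable lborel (\<lambda>x. (norm (\<phi> x))\<^sup>2)"
  proof -
    have "integrable lborel (\<lambda>x. Re (\<phi> x * cnj (\<phi> x)))"
      by (intro integrable_Re schwartz_integrable slow_mult_schwartz schwartz_in_slow schwartz_cnj \<phi>)
    then show ?thesis by (simp add: complex_mult_cnj cmod_power2)
  qed
  have "(\<integral>x. of_real ((norm (\<phi> x))\<^sup>2) \<partial>lborel) = (0::complex)"
    using 0 by (simp flip: complex_norm_square)
  then have "(\<integral>x. (norm (\<phi> x))\<^sup>2 \<partial>lborel) = 0"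
    by (simp only: integral_complex_of_real of_real_eq_0_iff)
  then have "AE x in lborel. (norm (\<phi> x))\<^sup>2 = 0"
    using integral_nonneg_eq_0_iff_AE[OF int] by simp
  then have ae: "AE x in lborel. \<phi> x = 0" by simp
  let ?N = "{x. \<phi> x \<noteq> 0}"
  have op: "open ?N"
  proof -
    have "open (\<phi> -` (- {0}))"
      by (intro open_vimage smooth_continuous_on schwartz_smooth \<phi>) auto
    then show ?thesis by (simp add: vimage_def)
  qed
  then have "?N \<in> null_sets lborel"
    using ae by (subst (asm) AE_iff_null) (auto simp: space_borel)
  then have "negligible ?N"
    by (simp add: negligible_iff_null_sets null_sets_completionI)
  then show ?thesis using open_not_negligible[OF op] by blast
qed

lemma lborel_integral_reflect:
  fixes g :: "'a::euclidean_space \<Rightarrow> complex"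
  assumes "g \<in> borel_measurable borel"
  shows "(\<integral>x. g (- x) \<partial>lborel) = (\<integral>x. g x \<partial>lborel)"
  using lborel_integral_scale[OF assms, of "-1"] by simp

lemma fourier_translate:
  fixes h :: "'a::euclidean_space \<Rightarrow> complex"
  assumes h: "h \<in> schwartz"
  shows "fourier (\<lambda>y. h (y + x)) \<zeta> = cis (2 * pi * (\<zeta> \<bullet> x)) * fourier h \<zeta>"
proof -
  let ?g = "\<lambda>y. h (y + x) * cis (- (2 * pi * (y \<bullet> \<zeta>)))"
  have "?g \<in> borel_measurable borel"
    by (intro smooth_borel_measurable schwartz_smooth schwartz_mult_slow slow_exponential schwartz_translate h)
  from lborel_integral_translate[OF this, of "- x"]
  have "fourier (\<lambda>y. h (y + x)) \<zeta> = (\<integral>y. cis (2 * pi * (\<zeta> \<bullet> x)) * (h y * cis (- (2 * pi * (y \<bullet> \<zeta>)))) \<partial>lborel)"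
    by (simp add: fourier_def inner_diff_left inner_commute[of x] algebra_simps cis_mult)
  then show ?thesis by (simp add: fourier_def)
qed

lemma fourier_cnj_reflect:
  fixes h :: "'a::euclidean_space \<Rightarrow> complex"
  assumes h: "h \<in> schwartz"
  shows "fourier (\<lambda>y. cnj (h (- y))) \<zeta> = cnj (fourier h \<zeta>)"
proof -
  let ?g = "\<lambda>y. cnj (h y * cis (- (2 * pi * (y \<bullet> \<zeta>))))"
  have "?g \<in> borel_measurable borel"
    by (intro smooth_borel_measurable schwartz_smooth schwartz_cnj schwartz_mult_slow slow_exponential h)
  then have "(\<integral>y. ?g (- y) \<partial>lborel) = (\<integral>y. ?g y \<partial>lborel)"
    by (rule lborel_integral_reflect)
  also have "\<dots> = cnj (fourier h \<zeta>)" unfolding fourier_def by (rule Bochner_Integration.integral_cnj)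
  finally show ?thesis by (simp add: fourier_def cis_cnj)
qed

text \<open>Translation carries the formula from the origin to every \<open>x\<close>. The constant
  stays undetermined, and the substance is that it is nonzero. If it vanished, the double transform
  of every \<open>h\<close> would be zero, the multiplication formula would make the squared norm of
  \<open>fourier h\<close> zero, and \<open>h = g * cnj g\<close> at frequency 0 would give
  \<open>g\<close> norm zero.\<close>

theorem fourier_inversion:
  "\<exists>c. c \<noteq> 0 \<and> (\<forall>h\<in>schwartz. \<forall>x::'a::euclidean_space. (\<integral>\<zeta>. fourier h \<zeta> * cis (2 * pi * (\<zeta> \<bullet> x)) \<partial>lborel) = c * h x)"
proof -
  obtain g :: "'a \<Rightarrow> complex" where g: "g \<in> schwartz" "g 0 \<noteq> 0"
    using test_function_exists test_functions_schwartz by blast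
  define c where "c = (\<integral>\<zeta>. fourier g \<zeta> \<partial>lborel) / g 0"
  have c: "(\<integral>\<zeta>. fourier h \<zeta> * cis (2 * pi * (\<zeta> \<bullet> x)) \<partial>lborel) = c * h x"
    if h: "h \<in> schwartz" for h and x :: 'a
  proof -
    have "g 0 * (\<integral>\<zeta>. fourier h \<zeta> * cis (2 * pi * (\<zeta> \<bullet> x)) \<partial>lborel) = (\<integral>\<zeta>. fourier g \<zeta> \<partial>lborel) * h x"
      using fourier_at_zero_limit[OF g(1) schwartz_translate[OF h, of x]]
      by (simp add: fourier_translate[OF h] mult.commute)
    then show ?thesis using g(2) by (simp add: c_def field_simps)
  qed
  have "c \<noteq> 0"
  proof
    assume "c = 0"
    have "fourier h 0 = 0" if h: "h \<in> schwartz" for h :: "'a \<Rightarrow> complex"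
    proof -
      \<comment> \<open>The double transform at \<open>y\<close> is the inversion integral at
        \<open>- y\<close>.\<close>
      have zero: "fourier (fourier h) y = 0" for y
        using c[OF h, of "- y"] \<open>c = 0\<close> by (simp add: fourier_def)
      have "(\<lambda>y. h (- y + 0)) \<in> schwartz"
        by (rule schwartz_affine[OF h, where K=1]) (auto intro: linearI)
      then have "(\<lambda>y. cnj (h (- y))) \<in> schwartz" by (simp add: schwartz_cnj)
      from fourier_multiplication[OF fourier_schwartz[OF h] this]
      have "(\<integral>\<zeta>. fourier h \<zeta> * cnj (fourier h \<zeta>) \<partial>lborel) = 0"
        by (simp add: fourier_cnj_reflect[OF h] zero)
      then show "fourier h 0 = 0"
        by (rule schwartz_L2_zero[OF fourier_schwartz[OF h]])
    qed
    from this[of "\<lambda>x. g x * cnj (g x)"] have "(\<integral>x. g x * cnj (g x) \<partial>lborel) = 0"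
      by (simp add: fourier_def slow_mult_schwartz schwartz_in_slow schwartz_cnj g)
    from schwartz_L2_zero[OF g(1) this] g(2) show False by blast
  qed
  then show ?thesis using c by blast
qed

subsection \<open>The reproducing formula of the short-time Fourier transform\<close>

text \<open>The short-time Fourier transform of \<open>\<Psi>\<close> with window
  \<open>\<Phi>\<close> as a function of the pair (position, frequency). Written through
  \<open>fourier2\<close>, it inherits the Schwartz property.\<close>

definition window_kernel :: "('a::euclidean_space \<Rightarrow> complex) \<Rightarrow> ('a \<Rightarrow> complex) \<Rightarrow> 'a \<times> 'a \<Rightarrow> complex"
  where "window_kernel \<Psi> \<Phi> = fourier2 (\<lambda>w. \<Psi> (snd w) * cnj (\<Phi> (snd w - fst w)))"

lemma window_schwartz:
  fixes \<Psi> \<Phi> :: "'a::euclidean_space \<Rightarrow> complex"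
  assumes \<Psi>: "\<Psi> \<in> schwartz" and \<Phi>: "\<Phi> \<in> schwartz"
  shows "(\<lambda>w. \<Psi> (snd w) * cnj (\<Phi> (snd w - fst w))) \<in> schwartz"
proof -
  \<comment> \<open>\<open>?B\<close> inverts \<open>?A\<close>; its boundedness supplies the lower
    bound that \<open>schwartz_affine\<close> asks for.\<close>
  let ?A = "\<lambda>w::'a \<times> 'a. (snd w, snd w - fst w)" and ?B = "\<lambda>w::'a \<times> 'a. (fst w - snd w, fst w)"
  have "linear ?A" "linear ?B" by (auto intro!: linearI simp: algebra_simps)
  obtain K where K: "\<And>w. jbracket (?B w + 0) \<le> K * jbracket w"
    using jbracket_affine[OF \<open>linear ?B\<close>] by blast
  have "(\<lambda>z. \<Psi> (fst z) * cnj (\<Phi> (snd z))) \<in> schwartz"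
    by (intro schwartz_tensor schwartz_cnj assms)
  from schwartz_affine[OF this \<open>linear ?A\<close>, of K 0] K[of "?A _"]
  show ?thesis by simp
qed

lemma window_kernel_schwartz:
  assumes "\<Psi> \<in> schwartz" "\<Phi> \<in> schwartz" shows "window_kernel \<Psi> \<Phi> \<in> schwartz"
  unfolding window_kernel_def by (intro fourier2_schwartz window_schwartz assms)

text \<open>For a fixed position \<open>P\<close>, inversion in the frequency returns
  \<open>c * \<Psi> Y * cnj (\<Phi> (Y - P))\<close>. Multiplying by \<open>\<Phi> (Y - P)\<close>
  and integrating over \<open>P\<close> leaves the squared norm of the window.\<close>

theorem reproducing_formula:
  "\<exists>c. c \<noteq> 0 \<and> (\<forall>\<Psi>\<in>schwartz. \<forall>\<Phi>\<in>schwartz. \<forall>Y::'a::euclidean_space.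
     (\<integral>w. window_kernel \<Psi> \<Phi> w * cis (2 * pi * (snd w \<bullet> Y)) * \<Phi> (Y - fst w) \<partial>lborel)
       = c * (\<integral>y. \<Phi> y * cnj (\<Phi> y) \<partial>lborel) * \<Psi> Y)"
proof -
  obtain c where c: "c \<noteq> 0" "\<And>h x. h \<in> schwartz \<Longrightarrow>
      (\<integral>\<zeta>. fourier h \<zeta> * cis (2 * pi * (\<zeta> \<bullet> (x::'a))) \<partial>lborel) = c * h x"
    using fourier_inversion by blast
  have "(\<integral>w. window_kernel \<Psi> \<Phi> w * cis (2 * pi * (snd w \<bullet> Y)) * \<Phi> (Y - fst w) \<partial>lborel)
       = c * (\<integral>y. \<Phi> y * cnj (\<Phi> y) \<partial>lborel) * \<Psi> Y"
    if \<Psi>: "\<Psi> \<in> schwartz" and \<Phi>: "\<Phi> \<in> schwartz" for \<Psi> \<Phi> and Y :: 'a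
  proof -
    let ?h = "\<lambda>P Y. \<Psi> Y * cnj (\<Phi> (Y - P))"
    let ?K = "\<lambda>w. window_kernel \<Psi> \<Phi> w * cis (2 * pi * (snd w \<bullet> Y)) * \<Phi> (Y - fst w)"
    have h: "?h P \<in> schwartz" for P
      using schwartz_section[OF window_schwartz[OF \<Psi> \<Phi>], of P] by simp
    have "(\<lambda>w::'a \<times> 'a. cis (2 * pi * ((snd w + 0) \<bullet> Y))) \<in> slow"
      by (rule slow_affine[where f="\<lambda>x. cis (2 * pi * (x \<bullet> Y))"]) (auto intro: linearI slow_cis_inner)
    moreover have "(\<lambda>w::'a \<times> 'a. \<Phi> (- fst w + Y)) \<in> slow"
      by (rule slow_affine[OF schwartz_in_slow[OF \<Phi>]]) (auto intro: linearI)
    ultimately have K: "?K \<in> schwartz"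
      using window_kernel_schwartz[OF \<Psi> \<Phi>] by (intro schwartz_mult_slow) simp_all
    have "(\<integral>w. ?K w \<partial>lborel) = (\<integral>P. \<integral>A. ?K (P, A) \<partial>lborel \<partial>lborel)"
      by (rule schwartz_integral_prod[OF K])
    also have "\<dots> = (\<integral>P. c * \<Psi> Y * (\<Phi> (Y - P) * cnj (\<Phi> (Y - P))) \<partial>lborel)"
    proof (rule Bochner_Integration.integral_cong)
      fix P
      have "(\<integral>A. ?K (P, A) \<partial>lborel) = (\<integral>A. fourier (?h P) A * cis (2 * pi * (A \<bullet> Y)) \<partial>lborel) * \<Phi> (Y - P)"
        by (simp add: window_kernel_def fourier2_eq_fourier)
      also have "\<dots> = c * \<Psi> Y * (\<Phi> (Y - P) * cnj (\<Phi> (Y - P)))"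
        by (simp add: c(2)[OF h])
      finally show "(\<integral>A. ?K (P, A) \<partial>lborel) = c * \<Psi> Y * (\<Phi> (Y - P) * cnj (\<Phi> (Y - P)))" .
    qed simp
    also have "\<dots> = c * \<Psi> Y * (\<integral>P. \<Phi> (Y - P) * cnj (\<Phi> (Y - P)) \<partial>lborel)"
      by (rule integral_mult_right_zero)
    also have "(\<integral>P. \<Phi> (Y - P) * cnj (\<Phi> (Y - P)) \<partial>lborel) = (\<integral>y. \<Phi> y * cnj (\<Phi> y) \<partial>lborel)"
    proof -
      have [measurable]: "(\<lambda>y. \<Phi> y * cnj (\<Phi> y)) \<in> borel_measurable borel"
        by (intro smooth_borel_measurable schwartz_smooth slow_mult_schwartz schwartz_in_slow schwartz_cnj \<Phi>)
      then have "(\<lambda>y. \<Phi> (Y + y) * cnj (\<Phi> (Y + y))) \<in> borel_measurable borel"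
        by (rule measurable_compose[rotated]) simp
      from lborel_integral_reflect[OF this] show ?thesis
        using lborel_integral_translate[of "\<lambda>y. \<Phi> y * cnj (\<Phi> y)" Y] by simp
    qed
    finally show ?thesis by (simp add: ac_simps)
  qed
  then show ?thesis using c(1) by blast
qed

section \<open>Functions of slow growth\<close>

text \<open>The real exponent is rounded up to a natural number, once for all derivatives.\<close>

lemma slow_function_derivs_in:
  assumes "slow_function f" shows "\<exists>N. f \<in> derivs_in (bdd_by (\<lambda>x. jbracket x ^ N))"
proof -
  obtain r where r: "r > 0" "\<And>bs. bs \<in> lists Basis \<Longrightarrow> \<exists>C>0. \<forall>x. norm (partials bs f x) \<le> C * jbracket x powr r"
    using assms by (auto simp: slow_function_def)
  define N where "N = nat \<lceil>r\<rceil>"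
  have N: "jbracket x powr r \<le> jbracket x ^ N" for x :: 'a
  proof -
    have "jbracket x powr r \<le> jbracket x powr real N"
      using r(1) by (intro powr_mono jbracket_ge_1) (simp add: N_def)
    then show ?thesis by (simp add: powr_realpow)
  qed
  have "partials bs f \<in> bdd_by (\<lambda>x. jbracket x ^ N)" if bs: "bs \<in> lists Basis" for bs
  proof -
    obtain C where C: "C > 0" "\<And>x. norm (partials bs f x) \<le> C * jbracket x powr r" using r(2)[OF bs] by blast
    have "norm (partials bs f x) \<le> C * jbracket x ^ N" for x
      using order_trans[OF C(2)[of x] mult_left_mono[OF N[of x], of C]] C(1) by simp
    then show ?thesis unfolding bdd_by_def by blast
  qed
  then show ?thesis using assms by (auto simp: derivs_in_def slow_function_def)
qed

lemma derivs_in_power_slow: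
  assumes "f \<in> derivs_in (bdd_by (\<lambda>x. jbracket x ^ N))" shows "f \<in> slow"
proof -
  have "bdd_by (\<lambda>x. jbracket x ^ N) \<subseteq> poly_bdd" by (auto simp: bdd_by_def poly_bdd_def)
  then show ?thesis using assms derivs_in_mono unfolding slow_def by blast
qed

text \<open>The degree \<open>N\<close> in the bound does not depend on \<open>n\<close> since all derivatives of \<open>f\<close> have
  the same growth.\<close>

lemma fourier_translate_bound:
  fixes f \<Theta> :: "'a::euclidean_space \<Rightarrow> complex"
  assumes f: "f \<in> derivs_in (bdd_by (\<lambda>x. jbracket x ^ N))" and \<Theta>: "\<Theta> \<in> schwartz"
  shows "\<exists>C\<ge>0. \<forall>X \<zeta>. jbracket \<zeta> ^ n * norm (fourier (\<lambda>Y. f (Y + X) * \<Theta> Y) \<zeta>) \<le> C * jbracket X ^ N"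
proof -
  define K where "K w = f (snd w + fst w) * \<Theta> (snd w)" for w :: "'a \<times> 'a"
  have K: "K \<in> derivs_in (bdd_by (\<lambda>w. jbracket (fst w) ^ N * (1 / jbracket (snd w) ^ M)))" for M
  proof -
    \<comment> \<open>The \<open>N\<close> additional powers of decay absorb the factor
      \<open><Y>^N\<close> that Peetre's inequality produces.\<close>
    have "\<Theta> \<in> derivs_in (bdd_by (\<lambda>x. 1 / jbracket x ^ (M + N)))"
      using \<Theta> by (simp add: schwartz_iff_bdd_by)
    then have "(\<lambda>w::'a \<times> 'a. f ((snd w + fst w) + 0) * \<Theta> (snd w + 0))
      \<in> derivs_in (bdd_by (\<lambda>w. jbracket ((snd w + fst w) + 0) ^ N * (1 / jbracket (snd w + 0) ^ (M + N))))"
      by (intro derivs_in_bdd_by_mult derivs_in_bdd_by_affine[OF f]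
            derivs_in_bdd_by_affine[where \<omega>="\<lambda>x. 1 / jbracket x ^ (M + N)"] linearI)
         (auto simp: scaleR_add_right)
    then have "K \<in> derivs_in (bdd_by (\<lambda>w. jbracket (snd w + fst w) ^ N * (1 / jbracket (snd w) ^ (M + N))))"
      by (simp add: K_def[abs_def])
    then show ?thesis
    proof (rule derivs_in_bdd_by_mono[where K="2 ^ N"])
      fix w :: "'a \<times> 'a"
      have "jbracket (snd w + fst w) ^ N \<le> (2 * jbracket (snd w) * jbracket (fst w)) ^ N"
        by (intro power_mono jbracket_add) simp
      then show "jbracket (snd w + fst w) ^ N * (1 / jbracket (snd w) ^ (M + N))
          \<le> 2 ^ N * (jbracket (fst w) ^ N * (1 / jbracket (snd w) ^ M))"
        by (simp add: power_add power_mult_distrib field_simps)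
    qed simp
  qed
  have smK: "smooth K" using K[of 0] by (rule derivs_in_smooth)
  have KS: "(\<lambda>Y. f (Y + X) * \<Theta> Y) \<in> schwartz" for X
    by (intro slow_mult_schwartz \<Theta> slow_affine[OF derivs_in_power_slow[OF f]] linearI) auto
  obtain C where C: "C \<ge> 0" "\<And>h \<zeta>. h \<in> schwartz \<Longrightarrow>
      jbracket (\<zeta>::'a) ^ n * norm (fourier h \<zeta>) \<le> C * schwartz_norm (n + DIM('a) + 2) h"
    using fourier_decay by blast
  let ?M = "n + DIM('a) + 2"
  \<comment> \<open>The growing parameter of \<open>schwartz_norm_family\<close> is set to 1 and
    \<open><X>^N\<close> is its exact factor. The degree in \<open>X\<close> thus stays
    \<open>N\<close>, whichever derivatives enter.\<close>
  have "\<exists>D\<ge>0. \<exists>m::nat. \<forall>X\<in>UNIV. schwartz_norm ?M (\<lambda>Y. K (X, Y)) \<le> D * 1 ^ m * jbracket X ^ N"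
  proof (rule schwartz_norm_family)
    fix bs assume bs: "bs \<in> lists (Basis :: 'a set)"
    have "partials (map (Pair 0) bs) K \<in> bdd_by (\<lambda>w. jbracket (fst w) ^ N * (1 / jbracket (snd w) ^ ?M))"
      by (rule derivs_inD[OF derivs_in_partials[OF K lists_Basis_Pair(1)[OF bs]]])
    then obtain D where D: "\<And>w. norm (partials (map (Pair 0) bs) K w) \<le> D * (jbracket (fst w) ^ N * (1 / jbracket (snd w) ^ ?M))"
      unfolding bdd_by_def by blast
    have "jbracket Y ^ ?M * norm (partials bs (\<lambda>Y. K (X, Y)) Y) \<le> D * 1 ^ 0 * jbracket X ^ N" for X Y
      using mult_left_mono[OF D[of "(X, Y)"], of "jbracket Y ^ ?M"]
      by (simp add: partials_section[OF smK bs])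
    then show "\<exists>D m. \<forall>X\<in>UNIV. \<forall>Y. jbracket Y ^ ?M * norm (partials bs (\<lambda>Y. K (X, Y)) Y) \<le> D * 1 ^ m * jbracket X ^ N"
      by blast
  qed auto
  then obtain D where D: "D \<ge> 0" "\<And>X. schwartz_norm ?M (\<lambda>Y. f (Y + X) * \<Theta> Y) \<le> D * jbracket X ^ N"
    by (auto simp: K_def)
  have "jbracket \<zeta> ^ n * norm (fourier (\<lambda>Y. f (Y + X) * \<Theta> Y) \<zeta>) \<le> C * D * jbracket X ^ N" for X \<zeta>
    using order_trans[OF C(2)[OF KS] mult_left_mono[OF D(2)[of X] C(1)]] by (simp add: mult.assoc)
  then show ?thesis using C(1) D(1) by (intro exI[of _ "C * D"]) auto
qed

section \<open>The short-time Fourier transform\<close>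

lemma stft_window_schwartz:
  assumes "\<phi> \<in> schwartz" shows "modulate \<xi> (translate t \<phi>) \<in> schwartz"
proof -
  have "(\<lambda>x. cis (2 * pi * (x \<bullet> \<xi>)) * \<phi> (x + - t)) \<in> schwartz"
    by (intro slow_mult_schwartz slow_cis_inner schwartz_translate assms)
  then show ?thesis by (simp add: modulate_def[abs_def] translate_def)
qed

text \<open>Moving the window to the origin costs a unimodular factor, which is why moduli are
  compared.\<close>

lemma stft_distribution_of:
  fixes g \<phi> :: "'a::euclidean_space \<Rightarrow> complex"
  assumes g: "g \<in> slow" and \<phi>: "\<phi> \<in> schwartz"
  shows "norm (stft \<phi> (distribution_of g) x \<eta>) = norm (fourier (\<lambda>s. g (s + x) * cnj (\<phi> s)) \<eta>)"
proof -
  let ?w = "\<lambda>s. g s * cnj (modulate \<eta> (translate x \<phi>) s)"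
  have S: "(\<lambda>s. cnj (modulate \<eta> (translate x \<phi>) s)) \<in> schwartz"
    by (intro schwartz_cnj stft_window_schwartz \<phi>)
  have "?w \<in> borel_measurable borel"
    by (intro smooth_borel_measurable schwartz_smooth slow_mult_schwartz g S)
  from lborel_integral_translate[OF this, of x]
  have "stft \<phi> (distribution_of g) x \<eta> = (\<integral>s. ?w (x + s) \<partial>lborel)"
    using S by (simp add: stft_def sesq_def distribution_of_def)
  also have "\<dots> = (\<integral>s. cis (- (2 * pi * (x \<bullet> \<eta>))) * (g (s + x) * cnj (\<phi> s) * cis (- (2 * pi * (s \<bullet> \<eta>)))) \<partial>lborel)"
    by (intro Bochner_Integration.integral_cong refl)
       (simp add: modulate_def translate_def cis_cnj inner_add_left ring_distribs flip: cis_mult, simp add: ac_simps)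
  also have "\<dots> = cis (- (2 * pi * (x \<bullet> \<eta>))) * fourier (\<lambda>s. g (s + x) * cnj (\<phi> s)) \<eta>"
    unfolding fourier_def by (rule integral_mult_right_zero)
  finally show ?thesis by (simp add: norm_mult)
qed

text \<open>On the cone of slope \<open>B = 1\<close> the loss \<open><x>^N\<close> is at most the
  same power of \<open><\<eta>>\<close>, and it is recovered by asking for \<open>n + N\<close>
  powers at the outset.\<close>

lemma C_slow_subset_V_con:
  fixes \<phi> :: "'a::euclidean_space \<Rightarrow> complex"
  assumes \<phi>: "\<phi> \<in> schwartz" shows "C_slow \<subseteq> V_con \<phi>"
proof
  fix u :: "'a distribution" assume "u \<in> C_slow"
  then obtain g where u: "u = distribution_of g" and "slow_function g" by (auto simp: C_slow_def)
  then obtain N where gN: "g \<in> derivs_in (bdd_by (\<lambda>x. jbracket x ^ N))" using slow_function_derivs_in by blast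
  then have g: "g \<in> slow" by (rule derivs_in_power_slow)
  have "bdd_above ((\<lambda>(x, \<eta>). jbracket (x, \<eta>) ^ n * norm (stft \<phi> u x \<eta>)) ` {(x, \<eta>). norm \<eta> > 1 * norm x})" for n
  proof -
    obtain C where C: "C \<ge> 0" "\<And>X \<zeta>. jbracket \<zeta> ^ (n + N) * norm (fourier (\<lambda>Y. g (Y + X) * cnj (\<phi> Y)) \<zeta>) \<le> C * jbracket X ^ N"
      using fourier_translate_bound[OF gN schwartz_cnj[OF \<phi>], of "n + N"] by blast
    have "jbracket (x, \<eta>) ^ n * norm (stft \<phi> u x \<eta>) \<le> 2 ^ n * C" if "norm x < norm \<eta>" for x \<eta>
    proof -
      let ?F = "norm (fourier (\<lambda>Y. g (Y + x) * cnj (\<phi> Y)) \<eta>)"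
      have "jbracket x \<le> jbracket \<eta>" using that by (intro jbracket_mono) simp
      then have "C * jbracket x ^ N \<le> C * jbracket \<eta> ^ N" by (intro mult_left_mono power_mono C) auto
      from order_trans[OF C(2)[of \<eta> x] this]
      have "jbracket \<eta> ^ N * (jbracket \<eta> ^ n * ?F) \<le> jbracket \<eta> ^ N * C"
        by (simp only: power_add ac_simps)
      then have F: "jbracket \<eta> ^ n * ?F \<le> C"
        by (simp only: mult_le_cancel_left_pos zero_less_power jbracket_pos)
      have four: "1 + (a + b) \<le> 4 * (1 + b)" if "a \<le> b" "0 \<le> b" for a b :: real
        using that by simp
      have "jbracket (x, \<eta>) \<le> 2 * jbracket \<eta>"
      proof (rule power2_le_imp_le)
        have "(norm x)\<^sup>2 \<le> (norm \<eta>)\<^sup>2" using that by (intro power_mono) auto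
        then have "1 + ((norm x)\<^sup>2 + (norm \<eta>)\<^sup>2) \<le> 4 * (1 + (norm \<eta>)\<^sup>2)"
          using four[OF _ zero_le_power2] by blast
        then show "(jbracket (x, \<eta>))\<^sup>2 \<le> (2 * jbracket \<eta>)\<^sup>2"
          by (simp only: jbracket_square power_mult_distrib norm_Pair real_sqrt_pow2 add_nonneg_nonneg zero_le_power2) simp
      qed simp
      then have "jbracket (x, \<eta>) ^ n * ?F \<le> (2 * jbracket \<eta>) ^ n * ?F"
        by (intro mult_right_mono power_mono) auto
      also have "\<dots> \<le> 2 ^ n * C" using F by (simp add: power_mult_distrib mult.assoc)
      finally show ?thesis by (simp add: u stft_distribution_of[OF g \<phi>])
    qed
    then show ?thesis by (intro bdd_aboveI2[where M="2 ^ n * C"]) auto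
  qed
  moreover have "u \<in> tempered" unfolding u by (rule slow_distribution_tempered[OF g])
  ultimately show "u \<in> V_con \<phi>" unfolding V_con_def by (auto intro!: exI[of _ 1])
qed

text \<open>The window shifted in time and frequency is a kernel of class
  \<open>derivs_in poly_rapid\<close> with parameter \<open>(t, \<xi>)\<close>.\<close>

lemma stft_poly_bound:
  fixes \<phi> :: "'a::euclidean_space \<Rightarrow> complex"
  assumes f: "f \<in> tempered" and \<phi>: "\<phi> \<in> schwartz"
  shows "\<exists>C\<ge>0. \<exists>m::nat. \<forall>t \<xi>. norm (stft \<phi> f t \<xi>) \<le> C * jbracket (t, \<xi>) ^ m"
proof -
  let ?K = "\<lambda>w::('a \<times> 'a) \<times> 'a. cis (- (2 * pi) * (snd w \<bullet> snd (fst w))) * cnj (\<phi> ((snd w - fst (fst w)) + 0))"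
  have "?K \<in> derivs_in poly_rapid"
  proof (intro slow_mult_poly_rapid slow_cis_inner_linear)
    show "(\<lambda>w::('a \<times> 'a) \<times> 'a. cnj (\<phi> ((snd w - fst (fst w)) + 0))) \<in> derivs_in poly_rapid"
    proof (rule schwartz_affine_poly_rapid[OF schwartz_cnj[OF \<phi>], where K=2 and k=1])
      fix p :: "'a \<times> 'a" and y :: 'a
      have "jbracket y \<le> 2 * jbracket (fst p) * jbracket (y - fst p)"
        using jbracket_add[of "fst p" "y - fst p"] by simp
      also have "\<dots> \<le> 2 * jbracket p * jbracket (y - fst p)"
        using jbracket_fst_le[of "fst p" "snd p"] by (intro mult_right_mono mult_left_mono) auto
      finally show "jbracket y \<le> 2 * jbracket p ^ 1 * jbracket (snd (p, y) - fst (fst (p, y)) + 0)" by simp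
    qed (auto intro!: linearI simp: algebra_simps)
  qed (auto intro: linearI)
  from pairing_slow[OF f this] have "(\<lambda>p. f (\<lambda>y. ?K (p, y))) \<in> poly_bdd"
    unfolding slow_def by (rule derivs_inD)
  from poly_bddD[OF this] obtain C m where C: "C \<ge> 0" "\<And>p. norm (f (\<lambda>y. ?K (p, y))) \<le> C * jbracket p ^ m" by blast
  have "norm (stft \<phi> f t \<xi>) \<le> C * jbracket (t, \<xi>) ^ m" for t \<xi>
    using C(2)[of "(t, \<xi>)"] by (simp add: stft_def sesq_def modulate_def translate_def cis_cnj)
  with C(1) show ?thesis by blast
qed

section \<open>The Wigner distribution\<close>

lemma inv_kappa: "inv kappa (a, b) = ((a + b) /\<^sub>R 2, a - b)"
proof -
  have "kappa ((a + b) /\<^sub>R 2, a - b) = (a, b)"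
    by (simp add: kappa_def algebra_simps flip: scaleR_add_left)
  then show ?thesis by (metis bij_kappa bij_inv_eq_iff)
qed

lemma inv_kappa_schwartz:
  fixes \<Theta> :: "'a::euclidean_space \<times> 'a \<Rightarrow> complex"
  assumes "\<Theta> \<in> schwartz" shows "\<Theta> \<circ> inv kappa \<in> schwartz"
proof -
  let ?A = "\<lambda>w::'a \<times> 'a. ((fst w + snd w) /\<^sub>R 2, fst w - snd w)"
  have "linear ?A" "linear (kappa :: 'a \<times> 'a \<Rightarrow> _)"
    by (auto intro!: linearI simp: kappa_def algebra_simps)
  obtain K where K: "\<And>w::'a \<times> 'a. jbracket (kappa w + 0) \<le> K * jbracket w"
    using jbracket_affine[OF \<open>linear kappa\<close>] by blast
  have eq: "?A w = inv kappa w" for w by (cases w) (simp add: inv_kappa)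
  have "(\<lambda>w. \<Theta> (?A w + 0)) \<in> schwartz"
  proof (rule schwartz_affine[OF assms \<open>linear ?A\<close>])
    fix w :: "'a \<times> 'a"
    show "jbracket w \<le> K * jbracket (?A w + 0)"
      using K[of "?A w"] unfolding eq by (simp add: surj_f_inv_f bij_is_surj bij_kappa)
  qed
  then show ?thesis by (simp only: eq add_0_right comp_def)
qed

text \<open>Under the partial Fourier transform, modulation in the second variable becomes the shift
  \<open>y + x\<close>, while modulation in \<open>t\<close> is untouched. The Schwartz property is
  stated along with the formula because distributions are \<open>undefined\<close> elsewhere, so
  \<open>wigner\<close> unfolds only with it.\<close>

lemma localized_wigner:
  fixes f :: "'a::euclidean_space distribution"
  assumes \<rho>: "\<rho> \<in> schwartz"
  shows "localized_fourier \<rho> (wigner f) (\<eta>, x) = tensor f (cnj_distribution f)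
      ((\<lambda>(t, y). cis (- (2 * pi * (t \<bullet> \<eta>))) * fourier2 \<rho> (t, y + x)) \<circ> inv kappa)"
    and "(\<lambda>(t, y). cis (- (2 * pi * (t \<bullet> \<eta>))) * fourier2 \<rho> (t, y + x)) \<in> schwartz"
proof -
  let ?X = "\<lambda>z. \<rho> z * cis (- (2 * pi * (z \<bullet> (\<eta>, x))))"
  have X: "?X \<in> schwartz" by (intro schwartz_mult_slow \<rho> slow_exponential)
  have eq: "fourier2 ?X = (\<lambda>(t, y). cis (- (2 * pi * (t \<bullet> \<eta>))) * fourier2 \<rho> (t, y + x))"
  proof (rule ext, clarify)
    fix t y
    have "fourier2 ?X (t, y) = (\<integral>\<xi>. cis (- (2 * pi * (t \<bullet> \<eta>))) * (\<rho> (t, \<xi>) * cis (- (2 * pi * (\<xi> \<bullet> (y + x))))) \<partial>lborel)"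
      unfolding fourier2_def prod.case
      by (intro Bochner_Integration.integral_cong refl)
         (simp add: mult.assoc cis_mult inner_add_right algebra_simps)
    then show "fourier2 ?X (t, y) = cis (- (2 * pi * (t \<bullet> \<eta>))) * fourier2 \<rho> (t, y + x)"
      by (simp add: fourier2_def)
  qed
  show S: "(\<lambda>(t, y). cis (- (2 * pi * (t \<bullet> \<eta>))) * fourier2 \<rho> (t, y + x)) \<in> schwartz"
    using fourier2_schwartz[OF X] by (simp add: eq)
  show "localized_fourier \<rho> (wigner f) (\<eta>, x) = tensor f (cnj_distribution f)
      ((\<lambda>(t, y). cis (- (2 * pi * (t \<bullet> \<eta>))) * fourier2 \<rho> (t, y + x)) \<circ> inv kappa)"
    using X S by (simp add: localized_fourier_def wigner_def fourier2_distribution_def eq pullback_kappa_def)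
qed

text \<open>A bump function at \<open>z\<close> and the cone \<open>norm x < R * norm \<eta>\<close>
  witness regularity. On this cone the bracket of \<open>(\<eta>, x)\<close> is comparable to that
  of \<open>\<eta>\<close>, so decay in \<open>\<eta>\<close> suffices.\<close>

lemma not_in_WF:
  fixes u :: "('a::euclidean_space \<times> 'a) distribution"
  assumes "\<eta>0 \<noteq> 0" "norm x0 < R * norm \<eta>0" "R > 0"
    and bound: "\<And>\<rho> M. \<rho> \<in> schwartz \<Longrightarrow>
      \<exists>C. \<forall>\<eta> x. norm x < R * norm \<eta> \<longrightarrow> jbracket \<eta> ^ M * norm (localized_fourier \<rho> u (\<eta>, x)) \<le> C"
  shows "(z, (\<eta>0, x0)) \<notin> WF u"
proof -
  obtain \<rho> where \<rho>: "\<rho> \<in> test_functions" "\<rho> z \<noteq> 0" using test_function_exists by blast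
  let ?\<Gamma> = "{\<theta>. norm (snd \<theta>) < R * norm (fst \<theta>)} :: ('a \<times> 'a) set"
  have "open_cone ?\<Gamma>"
    unfolding open_cone_def
  proof (intro conjI ballI allI impI)
    show "open ?\<Gamma>" by (intro open_Collect_less continuous_intros)
    fix \<theta> and c :: real assume "\<theta> \<in> ?\<Gamma>" "c > 0"
    then show "c *\<^sub>R \<theta> \<in> ?\<Gamma>" using mult_strict_left_mono[of "norm (snd \<theta>)" "R * norm (fst \<theta>)" c] by (simp add: ac_simps)
  qed
  moreover have "(\<eta>0, x0) \<in> ?\<Gamma>" using assms by simp
  moreover have "bdd_above ((\<lambda>\<theta>. jbracket \<theta> ^ M * norm (localized_fourier \<rho> u \<theta>)) ` ?\<Gamma>)" for M
  proof -
    obtain C where C: "\<And>\<eta> x. norm x < R * norm \<eta> \<Longrightarrow> jbracket \<eta> ^ M * norm (localized_fourier \<rho> u (\<eta>, x)) \<le> C"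
      using bound[OF test_functions_schwartz[OF \<rho>(1)], of M] by blast
    have "jbracket \<theta> ^ M * norm (localized_fourier \<rho> u \<theta>) \<le> (2 + R) ^ M * C" if "\<theta> \<in> ?\<Gamma>" for \<theta>
    proof -
      obtain \<eta> x where \<theta>: "\<theta> = (\<eta>, x)" by fastforce
      have x: "norm x < R * norm \<eta>" using that by (simp add: \<theta>)
      have "jbracket \<theta> \<le> 1 + (norm \<eta> + norm x)"
        using jbracket_le[of \<theta>] norm_Pair_le[of \<eta> x] by (simp add: \<theta>)
      also have "\<dots> \<le> jbracket \<eta> + jbracket \<eta> + R * jbracket \<eta>"
        using x jbracket_ge_1[of \<eta>] norm_le_jbracket[of \<eta>] mult_left_mono[OF norm_le_jbracket[of \<eta>], of R] \<open>R > 0\<close> by linarith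
      finally have "jbracket \<theta> ^ M \<le> ((2 + R) * jbracket \<eta>) ^ M"
        by (intro power_mono) (auto simp: algebra_simps)
      then have "jbracket \<theta> ^ M * norm (localized_fourier \<rho> u \<theta>)
          \<le> ((2 + R) * jbracket \<eta>) ^ M * norm (localized_fourier \<rho> u \<theta>)"
        by (intro mult_right_mono) auto
      also have "\<dots> = (2 + R) ^ M * (jbracket \<eta> ^ M * norm (localized_fourier \<rho> u (\<eta>, x)))"
        by (simp add: power_mult_distrib \<theta>)
      also have "\<dots> \<le> (2 + R) ^ M * C"
        using C[OF x] \<open>R > 0\<close> by (intro mult_left_mono) auto
      finally show ?thesis .
    qed
    then show ?thesis by (intro bdd_aboveI2[where M="(2 + R) ^ M * C"])
  qed
  ultimately show ?thesis using \<rho> unfolding WF_def by blast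
qed

section \<open>Wigner distributions of functions of slow growth\<close>

lemma lborel_distr_kappa: "distr lborel borel kappa = (lborel :: ('a::euclidean_space \<times> 'a) measure)"
proof (rule measure_eqI)
  have m: "(kappa :: 'a \<times> 'a \<Rightarrow> _) \<in> borel_measurable borel"
    unfolding kappa_def split_def by (intro borel_measurable_continuous_onI continuous_intros)
  show "sets (distr lborel borel kappa) = sets (lborel :: ('a \<times> 'a) measure)" by simp
  fix A :: "('a \<times> 'a) set" assume A: "A \<in> sets (distr lborel borel kappa)"
  then have "emeasure (distr lborel borel kappa) A = (\<integral>\<^sup>+p. indicator A (kappa p) \<partial>lborel)"
    using m by (subst nn_integral_indicator[symmetric], simp, subst nn_integral_distr) auto
  also have "\<dots> = emeasure lborel A"
    using A by (subst nn_integral_kappa) auto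
  finally show "emeasure (distr lborel borel kappa) A = emeasure lborel A" .
qed

text \<open>\<open>G\<close> is the tensor product of \<open>g\<close> and its conjugate composed
  with \<open>kappa\<close>; it keeps a degree \<open>N + N\<close> common to all derivatives. The
  slope of the cone can then be chosen after the direction, so each direction with nonzero first
  component is regular.\<close>

lemma C_slow_subset_WFW_perp: "(C_slow :: 'a::euclidean_space distribution set) \<subseteq> WFW_perp"
proof
  fix u :: "'a distribution" assume "u \<in> C_slow"
  then obtain g where u: "u = distribution_of g" and "slow_function g" by (auto simp: C_slow_def)
  then obtain N where gN: "g \<in> derivs_in (bdd_by (\<lambda>x. jbracket x ^ N))" using slow_function_derivs_in by blast
  then have g: "g \<in> slow" by (rule derivs_in_power_slow)
  have ut: "u \<in> tempered" unfolding u by (rule slow_distribution_tempered[OF g])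
  define G where "G p = g (fst p + snd p /\<^sub>R 2) * cnj (g (fst p - snd p /\<^sub>R 2))" for p
  have G: "G \<in> derivs_in (bdd_by (\<lambda>p. jbracket p ^ (N + N)))"
  proof -
    let ?A = "\<lambda>p::'a \<times> 'a. fst p + snd p /\<^sub>R 2" and ?B = "\<lambda>p::'a \<times> 'a. fst p - snd p /\<^sub>R 2"
    have lin: "linear ?A" "linear ?B" by (auto intro!: linearI simp: algebra_simps)
    obtain K L where K: "K \<ge> 1" "\<And>p. jbracket (?A p + 0) \<le> K * jbracket p"
        and L: "L \<ge> 1" "\<And>p. jbracket (?B p + 0) \<le> L * jbracket p"
      using jbracket_affine[OF lin(1)] jbracket_affine[OF lin(2)] by blast
    have cg: "(\<lambda>x. cnj (g x)) \<in> derivs_in (bdd_by (\<lambda>x. jbracket x ^ N))"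
      by (rule derivs_in_cnj[OF gN]) (auto simp: bdd_by_def)
    have "(\<lambda>p. g (?A p + 0) * cnj (g (?B p + 0))) \<in> derivs_in (bdd_by (\<lambda>p. jbracket (?A p + 0) ^ N * jbracket (?B p + 0) ^ N))"
      by (intro derivs_in_bdd_by_mult derivs_in_bdd_by_affine[OF gN lin(1)] derivs_in_bdd_by_affine[OF cg lin(2)])
    then have "(\<lambda>p. g (?A p + 0) * cnj (g (?B p + 0))) \<in> derivs_in (bdd_by (\<lambda>p. jbracket p ^ (N + N)))"
    proof (rule derivs_in_bdd_by_mono[where K="K ^ N * L ^ N"])
      fix p :: "'a \<times> 'a"
      have "jbracket (?A p + 0) ^ N * jbracket (?B p + 0) ^ N \<le> (K * jbracket p) ^ N * (L * jbracket p) ^ N"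
        using K L by (intro mult_mono power_mono) auto
      then show "jbracket (?A p + 0) ^ N * jbracket (?B p + 0) ^ N \<le> K ^ N * L ^ N * jbracket p ^ (N + N)"
        by (simp add: power_mult_distrib power_add ac_simps)
    qed simp
    then show ?thesis by (simp add: G_def[abs_def])
  qed
  have Gs: "G \<in> slow" by (rule derivs_in_power_slow[OF G])
  \<comment> \<open>Fubini and the measure preserving substitution \<open>kappa\<close> turn the
    tensor product into integration against \<open>G\<close>.\<close>
  have tens: "tensor u (cnj_distribution u) (\<Theta> \<circ> inv kappa) = (\<integral>p. G p * \<Theta> p \<partial>lborel)"
    if \<Theta>: "\<Theta> \<in> schwartz" for \<Theta>
  proof -
    let ?P = "\<Theta> \<circ> inv kappa"
    have P: "?P \<in> schwartz" by (rule inv_kappa_schwartz[OF \<Theta>])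
    note Psec = schwartz_section[OF P]
    let ?H = "\<lambda>w. (g (fst w + 0) * cnj (g (snd w + 0))) * ?P w"
    have "(\<lambda>w::'a \<times> 'a. g (fst w + 0) * cnj (g (snd w + 0))) \<in> slow"
      by (intro slow_mult slow_cnj slow_affine[OF g] linearI) auto
    then have H: "?H \<in> schwartz" by (rule slow_mult_schwartz[OF _ P])
    have c: "cnj_distribution u (\<lambda>b. ?P (a, b)) = (\<integral>b. cnj (g b) * ?P (a, b) \<partial>lborel)" for a
      using Psec[of a] schwartz_cnj[OF Psec[of a]]
      by (simp add: cnj_distribution_def u distribution_of_def del: o_apply Bochner_Integration.integral_cnj
            flip: Bochner_Integration.integral_cnj)
    have "(\<lambda>a. cnj_distribution u (\<lambda>b. ?P (a, b))) \<in> schwartz"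
      by (rule pairing_schwartz[OF cnj_distribution_tempered[OF ut] P])
    then have "tensor u (cnj_distribution u) ?P = (\<integral>a. g a * cnj_distribution u (\<lambda>b. ?P (a, b)) \<partial>lborel)"
      using P by (simp add: tensor_def u distribution_of_def)
    also have "\<dots> = (\<integral>a. \<integral>b. ?H (a, b) \<partial>lborel \<partial>lborel)"
      by (simp only: c fst_conv snd_conv add_0_right mult.assoc integral_mult_right_zero)
    also have "\<dots> = (\<integral>w. ?H w \<partial>lborel)"
      by (rule schwartz_integral_prod[OF H, symmetric])
    also have "\<dots> = (\<integral>w. ?H w \<partial>distr lborel borel kappa)" by (simp add: lborel_distr_kappa)
    also have "\<dots> = (\<integral>p. ?H (kappa p) \<partial>lborel)"
    proof (rule integral_distr)
      show "kappa \<in> lborel \<rightarrow>\<^sub>M (borel :: ('a \<times> 'a) measure)"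
        unfolding kappa_def split_def by (simp, intro borel_measurable_continuous_onI continuous_intros)
      show "?H \<in> borel_measurable borel" by (intro smooth_borel_measurable schwartz_smooth H)
    qed
    also have "\<dots> = (\<integral>p. G p * \<Theta> p \<partial>lborel)"
      by (intro Bochner_Integration.integral_cong refl)
         (simp add: inv_f_f[OF bij_is_inj[OF bij_kappa]] G_def, simp add: kappa_def split_def)
    finally show ?thesis .
  qed
  \<comment> \<open>Shifting the integration variable by \<open>(0, - x)\<close> moves
    \<open>x\<close> from the test function to \<open>G\<close>. Only the modulation in
    \<open>t\<close> is left, hence the frequency \<open>(\<eta>, 0)\<close>.\<close>
  have lf: "localized_fourier \<rho> (wigner u) (\<eta>, x) = fourier (\<lambda>Y. G (Y + (0, - x)) * fourier2 \<rho> Y) (\<eta>, 0)"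
    if \<rho>: "\<rho> \<in> schwartz" for \<rho> \<eta> x
  proof -
    let ?T = "\<lambda>(t, y). cis (- (2 * pi * (t \<bullet> \<eta>))) * fourier2 \<rho> (t, y + x)"
    have T: "?T \<in> schwartz" by (rule localized_wigner(2)[OF \<rho>])
    have "(\<lambda>p. G p * ?T p) \<in> borel_measurable borel"
      by (intro smooth_borel_measurable schwartz_smooth slow_mult_schwartz Gs T)
    from lborel_integral_translate[OF this, of "(0, - x)"]
    have "(\<integral>p. G p * ?T p \<partial>lborel) = (\<integral>p. G ((0, - x) + p) * ?T ((0, - x) + p) \<partial>lborel)" by simp
    also have "\<dots> = fourier (\<lambda>Y. G (Y + (0, - x)) * fourier2 \<rho> Y) (\<eta>, 0)"
      unfolding fourier_def
      by (intro Bochner_Integration.integral_cong refl) (auto simp: split_def add.commute)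
    finally show ?thesis by (simp only: localized_wigner(1)[OF \<rho>] tens[OF T])
  qed
  have notin: "(z, (\<eta>0, x0)) \<notin> WF (wigner u)" if "\<eta>0 \<noteq> 0" for z \<eta>0 x0
  proof (rule not_in_WF[OF that])
    \<comment> \<open>A slope beyond \<open>norm x0 / norm \<eta>0\<close> puts the given direction
      inside the cone; the added 1 also keeps it positive.\<close>
    let ?R = "norm x0 / norm \<eta>0 + 1"
    show "norm x0 < ?R * norm \<eta>0" using that by (simp add: distrib_right)
    show R: "?R > 0" by (simp add: add_nonneg_pos)
    fix \<rho> :: "'a \<times> 'a \<Rightarrow> complex" and M assume \<rho>: "\<rho> \<in> schwartz"
    \<comment> \<open>The additional \<open>N + N\<close> powers pay for \<open><x>^(N + N)\<close>,
      which on the cone is at most a multiple of the same power of \<open><\<eta>>\<close>.\<close>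
    obtain C where C: "C \<ge> 0" "\<And>X \<zeta>. jbracket \<zeta> ^ (M + (N + N)) * norm (fourier (\<lambda>Y. G (Y + X) * fourier2 \<rho> Y) \<zeta>) \<le> C * jbracket X ^ (N + N)"
      using fourier_translate_bound[OF G fourier2_schwartz[OF \<rho>]] by blast
    have "jbracket \<eta> ^ M * norm (localized_fourier \<rho> (wigner u) (\<eta>, x)) \<le> C * (1 + ?R) ^ (N + N)"
      if x: "norm x < ?R * norm \<eta>" for \<eta> x
    proof -
      let ?F = "norm (localized_fourier \<rho> (wigner u) (\<eta>, x))"
      have jb0: "jbracket (\<eta>, 0 :: 'a) = jbracket \<eta>" "jbracket (0 :: 'a, - x) = jbracket x"
        by (simp_all add: jbracket_def norm_Pair)
      have "jbracket x \<le> 1 + ?R * norm \<eta>" using jbracket_le[of x] x by linarith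
      also have "\<dots> \<le> (1 + ?R) * jbracket \<eta>"
        using jbracket_ge_1[of \<eta>] mult_left_mono[OF norm_le_jbracket[of \<eta>], of ?R] R by (simp add: distrib_right)
      finally have "jbracket x ^ (N + N) \<le> ((1 + ?R) * jbracket \<eta>) ^ (N + N)" by (intro power_mono) auto
      then have "C * jbracket x ^ (N + N) \<le> C * (1 + ?R) ^ (N + N) * jbracket \<eta> ^ (N + N)"
        using C(1) by (simp add: power_mult_distrib mult_left_mono mult.assoc)
      moreover have "jbracket \<eta> ^ (M + (N + N)) * ?F \<le> C * jbracket x ^ (N + N)"
        using C(2)[of "(\<eta>, 0)" "(0, - x)"] by (simp only: lf[OF \<rho>] jb0)
      ultimately have "jbracket \<eta> ^ (N + N) * (jbracket \<eta> ^ M * ?F) \<le> jbracket \<eta> ^ (N + N) * (C * (1 + ?R) ^ (N + N))"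
        by (simp only: power_add ac_simps) 
      then show ?thesis by (simp only: mult_le_cancel_left_pos zero_less_power jbracket_pos)
    qed
    then show "\<exists>C. \<forall>\<eta> x. norm x < ?R * norm \<eta> \<longrightarrow> jbracket \<eta> ^ M * norm (localized_fourier \<rho> (wigner u) (\<eta>, x)) \<le> C"
      by blast
  qed
  have "WF (wigner u) \<subseteq> UNIV \<times> ({0} \<times> (UNIV - {0}))"
  proof
    fix p assume p: "p \<in> WF (wigner u)"
    obtain z \<eta>0 x0 where pz: "p = (z, (\<eta>0, x0))" by (metis surj_pair)
    have "\<eta>0 = 0" using notin p pz by blast
    moreover have "(\<eta>0, x0) \<noteq> 0" using p by (simp add: pz WF_def)
    ultimately show "p \<in> UNIV \<times> ({0} \<times> (UNIV - {0}))" by (simp add: pz zero_prod_def)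
  qed
  with ut show "u \<in> WFW_perp" by (simp add: WFW_perp_def)
qed

section \<open>Wigner distributions of members of \<open>V_con\<close>\<close>

text \<open>For \<open>(p, \<alpha>)\<close> of norm at most \<open>\<delta> * norm \<eta>\<close>,
  the arguments of the first transform lie in the cone where \<open>f\<close> decays. Otherwise
  \<open><\<eta>>\<close> is at most \<open><(p, \<alpha>)> / \<delta>\<close>, and polynomial
  growth in \<open>(p, \<alpha>)\<close> pays for all powers. The second transform has a polynomial
  bound whose degree is independent of \<open>n\<close>.\<close>

lemma V_con_cone_decay:
  fixes \<phi> :: "'a::euclidean_space \<Rightarrow> complex"
  assumes f: "f \<in> tempered" and \<phi>: "\<phi> \<in> schwartz" and "B > 0"
    and decay: "\<And>n::nat. n > 0 \<Longrightarrow> bdd_above ((\<lambda>(x, \<eta>). jbracket (x, \<eta>) ^ n * norm (stft \<phi> f x \<eta>)) `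
      {(x, \<eta>). norm \<eta> > B * norm x})"
  defines "\<delta> \<equiv> 1 / (8 * (1 + B))"
  shows "\<exists>C\<ge>0. \<exists>k::nat. \<forall>x \<eta> p \<alpha>. norm x < \<delta> * norm \<eta> \<longrightarrow>
      jbracket \<eta> ^ n * norm (stft \<phi> f (p - x /\<^sub>R 2) (\<eta> /\<^sub>R 2 - \<alpha>)) \<le> C * jbracket (p, \<alpha>) ^ k" (is ?first)
    and "\<exists>C\<ge>0. \<exists>m::nat. \<forall>x \<eta> p \<alpha>. norm x < \<delta> * norm \<eta> \<longrightarrow>
      norm (stft \<phi> f (p + x /\<^sub>R 2) (\<alpha> - \<eta> /\<^sub>R 2)) \<le> C * jbracket (p, \<alpha>) ^ m * jbracket \<eta> ^ m" (is ?second)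
proof -
  \<comment> \<open>The origin of \<open>\<delta>\<close>: the bound
    \<open>\<delta> \<le> 1 / 8\<close> keeps the frequency near half of \<open>\<eta>\<close>, and
    \<open>B * \<delta> \<le> 1 / 8\<close> keeps the position small enough for the cone.\<close>
  have \<delta>: "0 < \<delta>" "\<delta> \<le> 1 / 8" "B * \<delta> \<le> 1 / 8"
    using \<open>B > 0\<close> by (auto simp: \<delta>_def field_simps)
  obtain C m where C: "C \<ge> 0" "\<And>t \<xi>. norm (stft \<phi> f t \<xi>) \<le> C * jbracket (t, \<xi>) ^ m"
    using stft_poly_bound[OF f \<phi>] by blast
  have half: "jbracket (x /\<^sub>R 2, \<eta> /\<^sub>R 2) \<le> jbracket \<eta>" if "norm x < \<delta> * norm \<eta>" for x \<eta> :: 'a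
  proof (rule jbracket_mono)
    have "norm x \<le> norm \<eta>" using that mult_right_mono[of \<delta> 1 "norm \<eta>"] \<delta> by simp
    then show "norm (x /\<^sub>R 2, \<eta> /\<^sub>R 2) \<le> norm \<eta>"
      using norm_Pair_le[of "x /\<^sub>R 2" "\<eta> /\<^sub>R 2"] by simp
  qed
  have sum: "jbracket (p + x /\<^sub>R 2, \<alpha> - \<eta> /\<^sub>R 2) \<le> 2 * jbracket (p, \<alpha>) * jbracket \<eta>"
      "jbracket (p - x /\<^sub>R 2, \<eta> /\<^sub>R 2 - \<alpha>) \<le> 2 * jbracket (p, \<alpha>) * jbracket \<eta>"
    if "norm x < \<delta> * norm \<eta>" for x \<eta> p \<alpha> :: 'a
  proof -
    have flip: "jbracket (x /\<^sub>R 2, - (\<eta> /\<^sub>R 2)) = jbracket (x /\<^sub>R 2, \<eta> /\<^sub>R 2)" "jbracket (- (x /\<^sub>R 2), \<eta> /\<^sub>R 2) = jbracket (x /\<^sub>R 2, \<eta> /\<^sub>R 2)"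
      "jbracket (p, - \<alpha>) = jbracket (p, \<alpha>)"
      by (simp_all add: jbracket_def norm_Pair)
    have le: "2 * jbracket (p, \<alpha>) * jbracket (x /\<^sub>R 2, \<eta> /\<^sub>R 2) \<le> 2 * jbracket (p, \<alpha>) * jbracket \<eta>"
      by (intro mult_left_mono half that) auto
    show "jbracket (p + x /\<^sub>R 2, \<alpha> - \<eta> /\<^sub>R 2) \<le> 2 * jbracket (p, \<alpha>) * jbracket \<eta>"
      using jbracket_add[of "(p, \<alpha>)" "(x /\<^sub>R 2, - (\<eta> /\<^sub>R 2))"]
      by (intro order_trans[OF _ le]) (simp only: flip add_Pair add_uminus_conv_diff)
    show "jbracket (p - x /\<^sub>R 2, \<eta> /\<^sub>R 2 - \<alpha>) \<le> 2 * jbracket (p, \<alpha>) * jbracket \<eta>"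
      using jbracket_add[of "(p, - \<alpha>)" "(- (x /\<^sub>R 2), \<eta> /\<^sub>R 2)"]
      by (intro order_trans[OF _ le]) (simp only: flip add_Pair add_uminus_conv_diff uminus_add_conv_diff)
  qed
  have poly: "norm (stft \<phi> f q \<beta>) \<le> C * 2 ^ m * (jbracket (p, \<alpha>) ^ m * jbracket \<eta> ^ m)"
    if "jbracket (q, \<beta>) \<le> 2 * jbracket (p, \<alpha>) * jbracket \<eta>" for q \<beta> p \<alpha> \<eta> :: 'a
  proof -
    have "C * jbracket (q, \<beta>) ^ m \<le> C * (2 * jbracket (p, \<alpha>) * jbracket \<eta>) ^ m"
      by (intro mult_left_mono power_mono that C) auto
    then show ?thesis using C(2)[of q \<beta>] by (simp add: power_mult_distrib mult.assoc)
  qed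
  show ?second
  proof (intro exI conjI allI impI)
    show "0 \<le> C * 2 ^ m" using C(1) by simp
    fix x \<eta> p \<alpha> :: 'a assume "norm x < \<delta> * norm \<eta>"
    from poly[OF sum(1)[OF this]]
    show "norm (stft \<phi> f (p + x /\<^sub>R 2) (\<alpha> - \<eta> /\<^sub>R 2)) \<le> C * 2 ^ m * jbracket (p, \<alpha>) ^ m * jbracket \<eta> ^ m"
      by (simp only: mult.assoc)
  qed
  \<comment> \<open>\<open>Suc n\<close>, since decay is assumed for positive orders only.\<close>
  obtain D where D: "\<And>q \<beta>. norm \<beta> > B * norm q \<Longrightarrow> jbracket (q, \<beta>) ^ Suc n * norm (stft \<phi> f q \<beta>) \<le> D"
    using decay[of "Suc n"] by (auto simp: bdd_above_def)
  let ?E = "4 ^ Suc n * \<bar>D\<bar> + C * 2 ^ m * (1 / \<delta>) ^ (n + m)"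
  have "jbracket \<eta> ^ n * norm (stft \<phi> f (p - x /\<^sub>R 2) (\<eta> /\<^sub>R 2 - \<alpha>)) \<le> ?E * jbracket (p, \<alpha>) ^ (n + m + m)"
    if x: "norm x < \<delta> * norm \<eta>" for x \<eta> p \<alpha>
  proof (cases "norm (p, \<alpha>) \<le> \<delta> * norm \<eta>")
    case True
    let ?q = "p - x /\<^sub>R 2" and ?\<beta> = "\<eta> /\<^sub>R 2 - \<alpha>"
    have \<eta>: "norm \<eta> > 0" using x \<delta> by (metis mult_zero_right norm_ge_zero not_le zero_less_norm_iff norm_zero)
    have "norm p \<le> norm (p, \<alpha>)" "norm \<alpha> \<le> norm (p, \<alpha>)"
      by (simp_all add: norm_Pair real_le_rsqrt)
    then have p: "norm p \<le> \<delta> * norm \<eta>" and \<alpha>: "norm \<alpha> \<le> \<delta> * norm \<eta>" using True by linarith+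
    have \<delta>8: "\<delta> * norm \<eta> \<le> norm \<eta> / 8" using mult_right_mono[OF \<delta>(2), of "norm \<eta>"] by simp
    have "norm ?q \<le> norm p + norm x / 2" using norm_triangle_ineq4[of p "x /\<^sub>R 2"] by simp
    also have "\<dots> \<le> 2 * (\<delta> * norm \<eta>)" using p x norm_ge_zero[of p] by linarith
    finally have "B * norm ?q \<le> B * (2 * (\<delta> * norm \<eta>))" using \<open>B > 0\<close> by (intro mult_left_mono) auto
    also have "\<dots> = (B * \<delta>) * (2 * norm \<eta>)" by simp
    also have "\<dots> \<le> 1 / 8 * (2 * norm \<eta>)" using \<delta>(3) by (intro mult_right_mono) auto
    finally have q: "B * norm ?q \<le> norm \<eta> / 4" by simp
    \<comment> \<open>Half of \<open>norm \<eta>\<close> less at most one eighth from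
      \<open>\<alpha>\<close>; this exceeds the quarter that bounds
      \<open>B * norm ?q\<close>.\<close>
    have \<beta>: "3 / 8 * norm \<eta> \<le> norm ?\<beta>"
      using norm_triangle_ineq2[of "\<eta> /\<^sub>R 2" \<alpha>] \<alpha> \<delta>8 by simp
    have "norm ?\<beta> > B * norm ?q" using q \<beta> \<eta> by linarith
    then have dec: "jbracket (?q, ?\<beta>) ^ Suc n * norm (stft \<phi> f ?q ?\<beta>) \<le> D" by (rule D)
    have "jbracket \<eta> \<le> 4 * jbracket ?\<beta>"
    proof (rule power2_le_imp_le)
      have "norm \<eta> \<le> 4 * norm ?\<beta>" using \<beta> norm_ge_zero[of \<eta>] by linarith
      then have "(norm \<eta>)\<^sup>2 \<le> (4 * norm ?\<beta>)\<^sup>2" by (intro power_mono) auto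
      then show "(jbracket \<eta>)\<^sup>2 \<le> (4 * jbracket ?\<beta>)\<^sup>2" by (simp add: jbracket_square power_mult_distrib)
    qed simp
    also have "\<dots> \<le> 4 * jbracket (?q, ?\<beta>)" using jbracket_snd_le by (intro mult_left_mono) auto
    finally have "jbracket \<eta> ^ Suc n \<le> (4 * jbracket (?q, ?\<beta>)) ^ Suc n" by (intro power_mono) auto
    with jbracket_power_mono[of n "Suc n" \<eta>] have "jbracket \<eta> ^ n \<le> (4 * jbracket (?q, ?\<beta>)) ^ Suc n"
      by linarith
    then have "jbracket \<eta> ^ n * norm (stft \<phi> f ?q ?\<beta>) \<le> (4 * jbracket (?q, ?\<beta>)) ^ Suc n * norm (stft \<phi> f ?q ?\<beta>)"
      by (intro mult_right_mono) auto
    also have "\<dots> = 4 ^ Suc n * (jbracket (?q, ?\<beta>) ^ Suc n * norm (stft \<phi> f ?q ?\<beta>))"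
      by (simp only: power_mult_distrib mult.assoc)
    also have "\<dots> \<le> 4 ^ Suc n * \<bar>D\<bar>" using dec by (intro mult_left_mono) auto
    also have "\<dots> \<le> ?E" using C(1) \<delta>(1) by simp
    also have "\<dots> \<le> ?E * jbracket (p, \<alpha>) ^ (n + m + m)"
      using mult_left_mono[OF jbracket_power_ge_1, of ?E "(p, \<alpha>)" "n + m + m"] C(1) \<delta>(1) by simp
    finally show ?thesis .
  next
    case False
    \<comment> \<open>Here \<open>(p, \<alpha>)\<close> is large, and powers of
      \<open><\<eta>>\<close> are traded for powers of its bracket, to be absorbed later by the
      Schwartz function in the integral.\<close>
    have le: "jbracket \<eta> \<le> 1 / \<delta> * jbracket (p, \<alpha>)"
    proof (rule power2_le_imp_le)
      have "norm \<eta> \<le> 1 / \<delta> * norm (p, \<alpha>)" using False \<delta>(1) by (simp add: field_simps)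
      then have "(norm \<eta>)\<^sup>2 \<le> (1 / \<delta> * norm (p, \<alpha>))\<^sup>2" by (intro power_mono) auto
      moreover have "1 \<le> (1 / \<delta>)\<^sup>2" using \<delta> by (intro one_le_power) (simp add: field_simps)
      ultimately show "(jbracket \<eta>)\<^sup>2 \<le> (1 / \<delta> * jbracket (p, \<alpha>))\<^sup>2"
        unfolding power_mult_distrib jbracket_square distrib_left by simp
    qed (use \<delta> in simp)
    have "jbracket \<eta> ^ n * norm (stft \<phi> f (p - x /\<^sub>R 2) (\<eta> /\<^sub>R 2 - \<alpha>))
        \<le> jbracket \<eta> ^ n * (C * 2 ^ m * (jbracket (p, \<alpha>) ^ m * jbracket \<eta> ^ m))"
      by (intro mult_left_mono poly sum(2) x) auto
    also have "\<dots> = C * 2 ^ m * jbracket (p, \<alpha>) ^ m * jbracket \<eta> ^ (n + m)" by (simp add: power_add)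
    also have "\<dots> \<le> C * 2 ^ m * jbracket (p, \<alpha>) ^ m * (1 / \<delta> * jbracket (p, \<alpha>)) ^ (n + m)"
      using C(1) by (intro mult_left_mono power_mono le) auto
    also have "\<dots> = C * 2 ^ m * (1 / \<delta>) ^ (n + m) * jbracket (p, \<alpha>) ^ (n + m + m)"
      by (simp only: power_mult_distrib power_add ac_simps)
    also have "\<dots> \<le> ?E * jbracket (p, \<alpha>) ^ (n + m + m)"
      by (intro mult_right_mono) auto
    finally show ?thesis .
  qed
  moreover have "?E \<ge> 0" using C(1) \<delta>(1) by simp
  ultimately show ?first by blast
qed

lemma tensor_product:
  assumes u: "u \<in> tempered" and v: "v \<in> tempered" and g: "g \<in> schwartz" and h: "h \<in> schwartz"
  shows "tensor u v (\<lambda>z. g (fst z) * h (snd z)) = u g * v h"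
proof -
  have "(\<lambda>x. v (\<lambda>y. g x * h y)) = (\<lambda>x. v h * g x)"
    by (simp add: temperedD(2)[OF v h] mult.commute[of "v h"])
  then have "tensor u v (\<lambda>z. g (fst z) * h (snd z)) = u (\<lambda>x. v h * g x)"
    using schwartz_tensor[OF g h] by (simp add: tensor_def)
  also have "\<dots> = u g * v h" by (subst temperedD(2)[OF u g]) (rule mult.commute)
  finally show ?thesis .
qed

text \<open>The window is conjugated in the first variable only: \<open>stft\<close> conjugates its
  window and \<open>cnj_distribution\<close> conjugates once more, so both factors become transforms
  of \<open>f\<close> with the same window. The conjugation in the first factor reverses the sign of
  its frequency.\<close>

lemma tensor_stft:
  fixes \<phi> :: "'a::euclidean_space \<Rightarrow> complex"
  assumes f: "f \<in> tempered" and \<phi>: "\<phi> \<in> schwartz"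
  shows "norm (tensor f (cnj_distribution f) (\<lambda>Y. cis (2 * pi * (Y \<bullet> A)) * (cnj (\<phi> (fst (Y - P))) * \<phi> (snd (Y - P)))))
    = norm (stft \<phi> f (fst P) (- fst A)) * norm (stft \<phi> f (snd P) (snd A))"
proof -
  let ?g = "\<lambda>a. cnj (modulate (- fst A) (translate (fst P) \<phi>) a)" and ?h = "modulate (snd A) (translate (snd P) \<phi>)"
  have "(\<lambda>Y. cis (2 * pi * (Y \<bullet> A)) * (cnj (\<phi> (fst (Y - P))) * \<phi> (snd (Y - P)))) = (\<lambda>Y. ?g (fst Y) * ?h (snd Y))"
    by (rule ext, simp add: modulate_def translate_def inner_prod_def cis_cnj distrib_left flip: cis_mult)
  then have "tensor f (cnj_distribution f) (\<lambda>Y. cis (2 * pi * (Y \<bullet> A)) * (cnj (\<phi> (fst (Y - P))) * \<phi> (snd (Y - P))))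
      = f ?g * cnj_distribution f ?h"
    using tensor_product[OF f cnj_distribution_tempered[OF f] schwartz_cnj stft_window_schwartz, OF stft_window_schwartz, OF \<phi> \<phi>]
    by simp
  also have "\<dots> = stft \<phi> f (fst P) (- fst A) * cnj (stft \<phi> f (snd P) (snd A))"
    using stft_window_schwartz[OF \<phi>] by (simp add: stft_def sesq_def cnj_distribution_def)
  finally show ?thesis by (simp add: norm_mult)
qed

text \<open>The choices are made in this order: \<open>m\<close> from the second factor, then
  \<open>k\<close> for the first factor with decay order \<open>M + m\<close>, then the decay order
  of \<open>G\<close>. All are independent of \<open>x\<close> and \<open>\<eta>\<close>, so the
  estimate is uniform on the cone.\<close>

lemma wigner_cone_decay:
  fixes \<phi> :: "'a::euclidean_space \<Rightarrow> complex"
  assumes f: "f \<in> tempered" and \<phi>: "\<phi> \<in> schwartz" "\<phi> x0 \<noteq> 0" and "B > 0"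
    and decay: "\<And>n::nat. n > 0 \<Longrightarrow> bdd_above ((\<lambda>(x, \<eta>). jbracket (x, \<eta>) ^ n * norm (stft \<phi> f x \<eta>)) `
      {(x, \<eta>). norm \<eta> > B * norm x})"
    and \<rho>: "\<rho> \<in> schwartz"
  defines "\<delta> \<equiv> 1 / (8 * (1 + B))"
  shows "\<exists>C. \<forall>\<eta> x. norm x < \<delta> * norm \<eta> \<longrightarrow> jbracket \<eta> ^ M * norm (localized_fourier \<rho> (wigner f) (\<eta>, x)) \<le> C"
proof -
  define W where "W = tensor f (cnj_distribution f)"
  have W: "W \<in> tempered" unfolding W_def by (intro tensor_tempered cnj_distribution_tempered f)
  define \<Psi> where "\<Psi> = fourier2 \<rho> \<circ> inv kappa"
  have \<Psi>: "\<Psi> \<in> schwartz" unfolding \<Psi>_def by (intro inv_kappa_schwartz fourier2_schwartz \<rho>)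
  define \<Phi> where "\<Phi> Y = cnj (\<phi> (fst Y)) * \<phi> (snd Y)" for Y
  have \<Phi>: "\<Phi> \<in> schwartz" unfolding \<Phi>_def[abs_def] by (intro schwartz_tensor schwartz_cnj \<phi>)
  define G where "G = window_kernel \<Psi> \<Phi>"
  have G: "G \<in> schwartz" unfolding G_def by (rule window_kernel_schwartz[OF \<Psi> \<Phi>])
  obtain c0 where c00: "c0 \<noteq> 0" and rep: "\<forall>\<Psi>\<in>schwartz. \<forall>\<Phi>\<in>schwartz. \<forall>Y::'a \<times> 'a.
     (\<integral>w. window_kernel \<Psi> \<Phi> w * cis (2 * pi * (snd w \<bullet> Y)) * \<Phi> (Y - fst w) \<partial>lborel)
       = c0 * (\<integral>y. \<Phi> y * cnj (\<Phi> y) \<partial>lborel) * \<Psi> Y"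
    using reproducing_formula[where 'a="'a \<times> 'a"] by (elim exE conjE)
  have c0: "(\<integral>w. G w * cis (2 * pi * (snd w \<bullet> Y)) * \<Phi> (Y - fst w) \<partial>lborel)
      = c0 * (\<integral>y. \<Phi> y * cnj (\<Phi> y) \<partial>lborel) * \<Psi> Y" for Y
    unfolding G_def by (rule rep[rule_format, OF \<Psi> \<Phi>])
  define c where "c = c0 * (\<integral>y. \<Phi> y * cnj (\<Phi> y) \<partial>lborel)"
  \<comment> \<open>A point where the window is nonzero makes its squared norm nonzero, so that the
    reproducing formula can be divided by \<open>c\<close>.\<close>
  have "\<Phi> (x0, x0) \<noteq> 0" using \<phi>(2) by (simp add: \<Phi>_def)
  then have "(\<integral>y. \<Phi> y * cnj (\<Phi> y) \<partial>lborel) \<noteq> 0" using schwartz_L2_zero[OF \<Phi>] by blast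
  then have c: "c \<noteq> 0" using c00 by (simp only: c_def mult_eq_0_iff de_Morgan_disj not_False_eq_True)
  have "\<exists>C\<ge>0. \<exists>m::nat. \<forall>x \<eta> p \<alpha>. norm x < \<delta> * norm \<eta> \<longrightarrow>
      norm (stft \<phi> f (p + x /\<^sub>R 2) (\<alpha> - \<eta> /\<^sub>R 2)) \<le> C * jbracket (p, \<alpha>) ^ m * jbracket \<eta> ^ m"
    unfolding \<delta>_def by (rule V_con_cone_decay(2)[OF f \<phi>(1) \<open>B > 0\<close>]) (rule decay)
  then obtain C2 m where C2: "C2 \<ge> 0" "\<And>x \<eta> p \<alpha>. norm x < \<delta> * norm \<eta> \<Longrightarrow>
      norm (stft \<phi> f (p + x /\<^sub>R 2) (\<alpha> - \<eta> /\<^sub>R 2)) \<le> C2 * jbracket (p, \<alpha>) ^ m * jbracket \<eta> ^ m"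
    by blast
  \<comment> \<open>The order \<open>M + m\<close> compensates the growth of degree \<open>m\<close>
    in \<open>\<eta>\<close> of the second factor.\<close>
  have "\<exists>C\<ge>0. \<exists>k::nat. \<forall>x \<eta> p \<alpha>. norm x < \<delta> * norm \<eta> \<longrightarrow>
      jbracket \<eta> ^ (M + m) * norm (stft \<phi> f (p - x /\<^sub>R 2) (\<eta> /\<^sub>R 2 - \<alpha>)) \<le> C * jbracket (p, \<alpha>) ^ k"
    unfolding \<delta>_def by (rule V_con_cone_decay(1)[OF f \<phi>(1) \<open>B > 0\<close>]) (rule decay)
  then obtain C1 k where C1: "C1 \<ge> 0" "\<And>x \<eta> p \<alpha>. norm x < \<delta> * norm \<eta> \<Longrightarrow>
      jbracket \<eta> ^ (M + m) * norm (stft \<phi> f (p - x /\<^sub>R 2) (\<eta> /\<^sub>R 2 - \<alpha>)) \<le> C1 * jbracket (p, \<alpha>) ^ k"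
    by blast
  let ?d = "DIM(('a \<times> 'a) \<times> 'a \<times> 'a) + 2"
  \<comment> \<open>The powers \<open>k\<close> and \<open>m\<close> absorb the bounds of the two
    factors, and \<open>?d\<close> powers leave an integrable weight.\<close>
  obtain D where D: "D \<ge> 0" "\<And>w. jbracket w ^ (k + m + ?d) * norm (G w) \<le> D"
    using schwartz_rapidD[OF G, of "k + m + ?d"] by blast
  let ?I = "\<integral>w. 1 / jbracket w ^ ?d \<partial>(lborel :: (('a \<times> 'a) \<times> 'a \<times> 'a) measure)"
  have "jbracket \<eta> ^ M * norm (localized_fourier \<rho> (wigner f) (\<eta>, x)) \<le> C1 * C2 * D * ?I / norm c"
    if x: "norm x < \<delta> * norm \<eta>" for \<eta> x
  proof -
    \<comment> \<open>With \<open>(a, b) = kappa (t, y)\<close>, so that \<open>t\<close> is half of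
      \<open>a + b\<close> and \<open>y = a - b\<close>, the shift of \<open>y\<close> by
      \<open>x\<close> is the shift by \<open>X\<close>, and \<open>t \<bullet> \<eta>\<close>
      equals \<open>(a, b) \<bullet> H\<close>.\<close>
    define X where "X = (x /\<^sub>R 2, - (x /\<^sub>R 2))"
    define H where "H = (\<eta> /\<^sub>R 2, \<eta> /\<^sub>R 2)"
    define \<Psi>' where "\<Psi>' = (\<lambda>(t, y). cis (- (2 * pi * (t \<bullet> \<eta>))) * fourier2 \<rho> (t, y + x)) \<circ> inv kappa"
    have \<Psi>': "\<Psi>' \<in> schwartz" unfolding \<Psi>'_def by (intro inv_kappa_schwartz localized_wigner(2) \<rho>)
    have \<Psi>'_eq: "\<Psi>' Y = cis (- (2 * pi) * (Y \<bullet> H)) * \<Psi> (Y + X)" for Y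
    proof -
      obtain a b where Y: "Y = (a, b)" by fastforce
      have "x /\<^sub>R 2 + x /\<^sub>R 2 = x" by (simp flip: scaleR_add_left)
      then have "a + x /\<^sub>R 2 + (b - x /\<^sub>R 2) = a + b" "a + x /\<^sub>R 2 - (b - x /\<^sub>R 2) = a - b + x"
        by (simp_all only: algebra_simps)
      moreover have "((a + b) /\<^sub>R 2) \<bullet> \<eta> = (a, b) \<bullet> H"
        by (simp add: H_def inner_add_left distrib_left)
      ultimately show ?thesis
        by (simp only: \<Psi>'_def \<Psi>_def Y X_def inv_kappa comp_def prod.case add_Pair add_uminus_conv_diff mult_minus_left)
    qed
    \<comment> \<open>The integrand whose integral over \<open>w\<close> is
      \<open>c * \<Psi>' Y\<close>. The first phase couples frequency and \<open>Y\<close>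
      quadratically, so \<open>K\<close> is handled as slow factors times a Schwartz
      function.\<close>
    define K where "K z = cis (2 * pi * (snd (fst z) \<bullet> snd z)) * cis (2 * pi * (snd (fst z) \<bullet> X)) * cis (- (2 * pi) * (snd z \<bullet> H))
        * (G (fst z) * \<Phi> (snd z - fst (fst z) + X))" for z
    have K: "K \<in> schwartz"
      unfolding K_def[abs_def]
    proof (rule slow_mult_schwartz[OF slow_mult[OF slow_mult]])
      let ?A = "\<lambda>z::(('a \<times> 'a) \<times> 'a \<times> 'a) \<times> 'a \<times> 'a. (fst z, snd z - fst (fst z))"
      let ?B = "\<lambda>z::(('a \<times> 'a) \<times> 'a \<times> 'a) \<times> 'a \<times> 'a. (fst z, snd z + fst (fst z))"
      have lin: "linear ?A" "linear ?B" by (auto intro!: linearI simp: algebra_simps)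
      obtain L where L: "\<And>z. jbracket (?B z + (0, - X)) \<le> L * jbracket z"
        using jbracket_affine[OF lin(2)] by blast
      have "(\<lambda>z. (\<lambda>w. G (fst w) * \<Phi> (snd w)) (?A z + (0, X))) \<in> schwartz"
      proof (rule schwartz_affine[OF schwartz_tensor[OF G \<Phi>] lin(1)])
        fix z :: "(('a \<times> 'a) \<times> 'a \<times> 'a) \<times> 'a \<times> 'a"
        have "?B (?A z + (0, X)) + (0, - X) = z" by (cases z) simp
        then show "jbracket z \<le> L * jbracket (?A z + (0, X))" using L[of "?A z + (0, X)"] by simp
      qed
      then show "(\<lambda>z. G (fst z) * \<Phi> (snd z - fst (fst z) + X)) \<in> schwartz" by simp
      show "(\<lambda>z::(('a \<times> 'a) \<times> 'a \<times> 'a) \<times> 'a \<times> 'a. cis (2 * pi * (snd (fst z) \<bullet> snd z))) \<in> slow"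
        by (intro slow_cis_inner_linear linearI) auto
      have "(\<lambda>z::(('a \<times> 'a) \<times> 'a \<times> 'a) \<times> 'a \<times> 'a. cis (2 * pi * ((snd (fst z) + 0) \<bullet> X))) \<in> slow"
        by (rule slow_affine[OF slow_cis_inner]) (auto intro: linearI)
      then show "(\<lambda>z::(('a \<times> 'a) \<times> 'a \<times> 'a) \<times> 'a \<times> 'a. cis (2 * pi * (snd (fst z) \<bullet> X))) \<in> slow" by simp
      have "(\<lambda>z::(('a \<times> 'a) \<times> 'a \<times> 'a) \<times> 'a \<times> 'a. cis (- (2 * pi) * ((snd z + 0) \<bullet> H))) \<in> slow"
        by (rule slow_affine[OF slow_cis_inner]) (auto intro: linearI)
      then show "(\<lambda>z::(('a \<times> 'a) \<times> 'a \<times> 'a) \<times> 'a \<times> 'a. cis (- (2 * pi) * (snd z \<bullet> H))) \<in> slow" by simp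
    qed
    have "c * \<Psi>' Y = (\<integral>w. K (w, Y) \<partial>lborel)" for Y
    proof -
      have "c * \<Psi>' Y = cis (- (2 * pi) * (Y \<bullet> H)) * (\<integral>w. G w * cis (2 * pi * (snd w \<bullet> (Y + X))) * \<Phi> (Y + X - fst w) \<partial>lborel)"
        by (simp add: c0 \<Psi>'_eq c_def)
      also have "\<dots> = (\<integral>w. cis (- (2 * pi) * (Y \<bullet> H)) * (G w * cis (2 * pi * (snd w \<bullet> (Y + X))) * \<Phi> (Y + X - fst w)) \<partial>lborel)"
        by (rule integral_mult_right_zero[symmetric])
      also have "\<dots> = (\<integral>w. K (w, Y) \<partial>lborel)"
      proof (rule Bochner_Integration.integral_cong)
        fix w :: "('a \<times> 'a) \<times> 'a \<times> 'a"
        have e: "cis (2 * pi * (snd w \<bullet> (Y + X))) = cis (2 * pi * (snd w \<bullet> Y)) * cis (2 * pi * (snd w \<bullet> X))"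
          "Y + X - fst w = Y - fst w + X"
          by (simp_all add: inner_add_right distrib_left cis_mult)
        show "cis (- (2 * pi) * (Y \<bullet> H)) * (G w * cis (2 * pi * (snd w \<bullet> (Y + X))) * \<Phi> (Y + X - fst w)) = K (w, Y)"
          unfolding K_def e fst_conv snd_conv by (simp only: mult.assoc mult.left_commute)
      qed simp
      finally show ?thesis .
    qed
    then have "c * W \<Psi>' = W (\<lambda>Y. \<integral>w. K (w, Y) \<partial>lborel)"
      using temperedD(2)[OF W \<Psi>', of c] by simp
    also have "\<dots> = (\<integral>w. W (\<lambda>Y. K (w, Y)) \<partial>lborel)"
      by (rule tempered_integral[OF W K])
    finally have rep: "c * W \<Psi>' = (\<integral>w. W (\<lambda>Y. K (w, Y)) \<partial>lborel)" .
    have F: "integrable lborel (\<lambda>w. W (\<lambda>Y. K (w, Y)))"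
      by (intro schwartz_integrable pairing_schwartz W K)
    have le: "jbracket \<eta> ^ M * norm (W (\<lambda>Y. K (w, Y))) \<le> C1 * C2 * D * (1 / jbracket w ^ ?d)" for w
    proof -
      obtain p1 p2 \<alpha>1 \<alpha>2 where w: "w = ((p1, p2), (\<alpha>1, \<alpha>2))" by (metis surj_pair)
      let ?v1 = "norm (stft \<phi> f (p1 - x /\<^sub>R 2) (\<eta> /\<^sub>R 2 - \<alpha>1))" and ?v2 = "norm (stft \<phi> f (p2 + x /\<^sub>R 2) (\<alpha>2 - \<eta> /\<^sub>R 2))"
      \<comment> \<open>For fixed \<open>w\<close> the kernel is the scalar \<open>?s\<close> times
        the window shifted to position \<open>fst w - X\<close> and frequency
        \<open>snd w - H\<close>, to which \<open>tensor_stft\<close> applies.\<close>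
      let ?k = "\<lambda>Y. cis (2 * pi * (Y \<bullet> (snd w - H))) * (cnj (\<phi> (fst (Y - (fst w - X)))) * \<phi> (snd (Y - (fst w - X))))"
      let ?s = "G w * cis (2 * pi * (snd w \<bullet> X))"
      have kS: "?k \<in> schwartz"
      proof -
        have "(\<lambda>Y. cis (2 * pi * (Y \<bullet> (snd w - H))) * \<Phi> (Y + - (fst w - X))) \<in> schwartz"
          by (intro slow_mult_schwartz slow_cis_inner schwartz_translate \<Phi>)
        then show ?thesis by (simp only: \<Phi>_def add_uminus_conv_diff)
      qed
      have "K (w, Y) = ?s * ?k Y" for Y
      proof -
        have e: "cis (2 * pi * (Y \<bullet> (snd w - H))) = cis (2 * pi * (snd w \<bullet> Y)) * cis (- (2 * pi) * (Y \<bullet> H))"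
          "Y - (fst w - X) = Y - fst w + X"
          by (simp_all add: inner_diff_right inner_commute[of "snd w"] right_diff_distrib cis_mult)
        show ?thesis
          unfolding K_def \<Phi>_def e fst_conv snd_conv by (simp only: mult.assoc mult.left_commute mult.commute[of "G w"])
      qed
      then have "W (\<lambda>Y. K (w, Y)) = ?s * W ?k" using temperedD(2)[OF W kS] by simp
      moreover have "norm (W ?k) = ?v1 * ?v2"
        unfolding W_def tensor_stft[OF f \<phi>(1)] by (simp add: w X_def H_def)
      ultimately have "norm (W (\<lambda>Y. K (w, Y))) = norm (G w) * (?v1 * ?v2)" by (simp add: norm_mult)
      then have "jbracket \<eta> ^ M * norm (W (\<lambda>Y. K (w, Y))) = norm (G w) * (jbracket \<eta> ^ M * ?v1) * ?v2" by simp
      also have "\<dots> \<le> norm (G w) * (jbracket \<eta> ^ M * ?v1) * (C2 * jbracket (p2, \<alpha>2) ^ m * jbracket \<eta> ^ m)"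
        by (intro mult_left_mono C2 x) auto
      also have "\<dots> = norm (G w) * (jbracket \<eta> ^ (M + m) * ?v1) * (C2 * jbracket (p2, \<alpha>2) ^ m)"
        by (simp add: power_add)
      also have "\<dots> \<le> norm (G w) * (C1 * jbracket (p1, \<alpha>1) ^ k) * (C2 * jbracket (p2, \<alpha>2) ^ m)"
        using C2(1) by (intro mult_left_mono mult_right_mono C1 x) auto
      also have "\<dots> \<le> norm (G w) * (C1 * jbracket w ^ k) * (C2 * jbracket w ^ m)"
      proof -
        have "jbracket (p1, \<alpha>1) \<le> jbracket w" "jbracket (p2, \<alpha>2) \<le> jbracket w"
          by (auto simp: w jbracket_def norm_Pair)
        then show ?thesis using C1(1) C2(1) by (intro mult_mono mult_left_mono power_mono) auto
      qed
      also have "\<dots> = C1 * C2 * (jbracket w ^ (k + m + ?d) * norm (G w)) * (1 / jbracket w ^ ?d)"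
        by (simp add: power_add)
      also have "\<dots> \<le> C1 * C2 * D * (1 / jbracket w ^ ?d)"
        using C1(1) C2(1) D(2)[of w] by (intro mult_right_mono mult_left_mono) auto
      finally show ?thesis .
    qed
    have "jbracket \<eta> ^ M * (norm c * norm (W \<Psi>')) = jbracket \<eta> ^ M * norm (\<integral>w. W (\<lambda>Y. K (w, Y)) \<partial>lborel)"
      by (simp add: norm_mult flip: rep)
    also have "\<dots> \<le> jbracket \<eta> ^ M * (\<integral>w. norm (W (\<lambda>Y. K (w, Y))) \<partial>lborel)"
      by (intro mult_left_mono integral_norm_bound) auto
    also have "\<dots> = (\<integral>w. jbracket \<eta> ^ M * norm (W (\<lambda>Y. K (w, Y))) \<partial>lborel)"
      by (rule integral_mult_right_zero[symmetric])
    also have "\<dots> \<le> (\<integral>w. C1 * C2 * D * (1 / jbracket w ^ ?d) \<partial>(lborel :: (('a \<times> 'a) \<times> 'a \<times> 'a) measure))"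
      by (intro integral_mono integrable_mult_right integrable_norm F integrable_jbracket le) simp
    also have "\<dots> = C1 * C2 * D * ?I" by (rule integral_mult_right_zero)
    finally have "jbracket \<eta> ^ M * norm (W \<Psi>') \<le> C1 * C2 * D * ?I / norm c"
      using c by (simp add: field_simps)
    then show ?thesis unfolding localized_wigner(1)[OF \<rho>] W_def \<Psi>'_def .
  qed
  then show ?thesis by blast
qed

text \<open>A direction \<open>(\<eta>, 0)\<close> lies in the cone
  \<open>norm x < \<delta> * norm \<eta>\<close> however small the positive slope is, and these are
  the directions that \<open>WFW_neq\<close> forbids.\<close>

lemma V_con_subset_WFW_neq:
  fixes \<phi> :: "'a::euclidean_space \<Rightarrow> complex"
  assumes \<phi>: "\<phi> \<in> schwartz" and nz: "\<phi> \<noteq> (\<lambda>x. 0)"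
  shows "V_con \<phi> \<subseteq> WFW_neq"
proof
  fix f assume "f \<in> V_con \<phi>"
  then obtain B where f: "f \<in> tempered" and B: "B > 0" "\<And>n::nat. n > 0 \<Longrightarrow>
      bdd_above ((\<lambda>(x, \<eta>). jbracket (x, \<eta>) ^ n * norm (stft \<phi> f x \<eta>)) ` {(x, \<eta>). norm \<eta> > B * norm x})"
    by (auto simp: V_con_def)
  obtain y where "\<phi> y \<noteq> 0" using nz by auto
  have "(z, (\<eta>, 0)) \<notin> WF (wigner f)" if "\<eta> \<noteq> 0" for z \<eta>
  proof (rule not_in_WF[OF that])
    show "norm (0::'a) < 1 / (8 * (1 + B)) * norm \<eta>" "1 / (8 * (1 + B)) > 0"
      using B(1) that by (auto simp: add_pos_pos)
  qed (rule wigner_cone_decay[OF f \<phi> \<open>\<phi> y \<noteq> 0\<close> B(1)], rule B(2))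
  then have "WF (wigner f) \<inter> (UNIV \<times> ((UNIV - {0}) \<times> {0})) = {}" by auto
  with f show "f \<in> WFW_neq" by (simp add: WFW_neq_def)
qed

theorem proposition3p13:
  shows "(C_slow :: (real ^ 'n) distribution set) \<subseteq> WFW_perp \<and>
    (\<forall>\<phi> :: real ^ 'n \<Rightarrow> complex. \<phi> \<in> schwartz \<and> \<phi> \<noteq> (\<lambda>x. 0) \<longrightarrow>
      C_slow \<subseteq> V_con \<phi> \<and> V_con \<phi> \<subseteq> WFW_neq)"
  using C_slow_subset_WFW_perp C_slow_subset_V_con V_con_subset_WFW_neq by blast

end
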